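(* There exists a constant $\alpha\ge 0$ such that for every integer $k\ge 2$ there exists a constant $a>0$ (which may depend on $k$ but not on $p$) such that, for every $p\in(0,p_c)$ with $p_c=1/k$, the relaxation time $T_{\rm rel}$ of the OFA-kf process at density $p$ on the infinite tree $\mathbb T^k$ satisfies $$a^{-1}(p_c-p)^{-2}\le T_{\rm rel}\le a\,(p_c-p)^{-(2+\alpha)}.$$
   Context: Let $k\ge 2$ and let $\mathbb T^k$ be the infinite rooted $k$-ary tree (every vertex has exactly $k$ children), with vertex set $V$. For a vertex $x$, $\mathcal K_x$ denotes the set of its $k$ children. Let $\Omega=\{0,1\}^V$. Fix $p\in(0,1)$, $q=1-p$, let $\mu_x$ be the Bernoulli measure on $\{0,1\}$ with $\mu_x(1)=p$, $\mu_x(0)=q$, and let $\mu=\bigotimes_{x\in V}\mu_x$ on $\Omega$; $\operatorname{Var}$ is the variance under $\mu$. For a function $f$ on $\Omega$, $\mu_x(f)$ denotes the function obtained by averaging $f$ over the variable at $x$ with respect to $\mu_x$, the other variables being kept fixed. The OFA-kf (oriented Fredrickson-Andersen $k$-facilitated) model at density $p$ is the continuous time Glauber type Markov process on $\Omega$, reversible with respect to $\mu$, whose generator $\mathcal L$ acts on local functions $f:\Omega\to\mathbb R$ (functions depending on finitely many variables) by $$\mathcal Lf(\omega)=\sum_{x\in\mathbb T^k}c_x(\omega)\,[\mu_x(f)(\omega)-f(\omega)],$$ where $c_x(\omega)=1$ if $\omega_y=0$ for all $y\in\mathcal K_x$ and $c_x(\omega)=0$ otherwise. $\mathcal L$ extends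 to a non-positive self-adjoint operator on $L^2(\Omega,\mu)$. Its Dirichlet form is $\mathcal D(f)=\mu(f\cdot(-\mathcal Lf))$, its spectral gap is $$\operatorname{gap}(\mathcal L)=\inf_{f\in\mathrm{Dom}(\mathcal L),\ f\ne\text{const}}\frac{\mathcal D(f)}{\operatorname{Var}(f)},$$ and the relaxation time is $T_{\rm rel}=\operatorname{gap}(\mathcal L)^{-1}$. The critical density of the model is $p_c=1/k$. *)

theory Defs
  imports "HOL-Probability.Probability"
begin

text \<open>Vertices of the \<open>k\<close>-ary tree are the finite words over \<open>{0, ..., k - 1}\<close>; the root is the
  empty word and the children of a word are its one-letter extensions.\<close>

definition tree_vertices :: "nat \<Rightarrow> nat list set" where
  "tree_vertices k = lists {..<k}"

definition children :: "nat \<Rightarrow> nat list \<Rightarrow> nat list set" where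
  "children k x = (\<lambda>i. x @ [i]) ` {..<k}"

text \<open>A configuration assigns \<open>True\<close> (for \<open>1\<close>) or \<open>False\<close> (for \<open>0\<close>) to each vertex. The space of
  the product measure consists of the extensional functions on \<open>tree_vertices k\<close>; observables are
  total functions, but only their values on that space matter.\<close>

type_synonym config = "nat list \<Rightarrow> bool"

definition bernoulli_tree :: "nat \<Rightarrow> real \<Rightarrow> config measure" where
  "bernoulli_tree k p = (\<Pi>\<^sub>M x\<in>tree_vertices k. measure_pmf (bernoulli_pmf p))"

definition configs :: "nat \<Rightarrow> config set" where
  "configs k = (\<Pi>\<^sub>E x\<in>tree_vertices k. UNIV)"

definition local_fun :: "nat \<Rightarrow> (config \<Rightarrow> real) \<Rightarrow> bool" where
  "local_fun k f \<longleftrightarrow>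
     (\<exists>A. finite A \<and> A \<subseteq> tree_vertices k \<and>
       (\<forall>\<omega>\<in>configs k. \<forall>\<eta>\<in>configs k. (\<forall>x\<in>A. \<omega> x = \<eta> x) \<longrightarrow> f \<omega> = f \<eta>))"

definition site_average :: "real \<Rightarrow> nat list \<Rightarrow> (config \<Rightarrow> real) \<Rightarrow> config \<Rightarrow> real" where
  "site_average p x f \<omega> = measure_pmf.expectation (bernoulli_pmf p) (\<lambda>b. f (fun_upd \<omega> x b))"

definition constraint :: "nat \<Rightarrow> nat list \<Rightarrow> config \<Rightarrow> real" where
  "constraint k x \<omega> = (if \<forall>y\<in>children k x. \<not> \<omega> y then 1 else 0)"

text \<open>The generator on local functions. For local \<open>f\<close> and \<open>\<omega>\<close> in \<open>configs k\<close> only finitely many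
  terms of the sum are nonzero.\<close>

definition local_generator :: "nat \<Rightarrow> real \<Rightarrow> (config \<Rightarrow> real) \<Rightarrow> config \<Rightarrow> real" where
  "local_generator k p f \<omega> =
     (\<Sum>\<^sub>\<infinity>x\<in>tree_vertices k. constraint k x \<omega> * (site_average p x f \<omega> - f \<omega>))"

definition in_L2 :: "'a measure \<Rightarrow> ('a \<Rightarrow> real) \<Rightarrow> bool" where
  "in_L2 M f \<longleftrightarrow> f \<in> borel_measurable M \<and> integrable M (\<lambda>\<omega>. (f \<omega>)\<^sup>2)"

definition tendsto_L2 :: "'a measure \<Rightarrow> (nat \<Rightarrow> 'a \<Rightarrow> real) \<Rightarrow> ('a \<Rightarrow> real) \<Rightarrow> bool" where
  "tendsto_L2 M F f \<longleftrightarrow> (\<lambda>n. \<integral>\<omega>. (F n \<omega> - f \<omega>)\<^sup>2 \<partial>M) \<longlonglongrightarrow> 0"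

text \<open>The self-adjoint generator on \<open>L\<^sup>2\<close> is the closure of the generator on local functions, which
  form a core (the flip rates are bounded and of finite range). \<open>generator_graph k p f g\<close> says that
  \<open>(f, g)\<close> lies in the graph of this closure. Elements of \<open>L\<^sup>2\<close> are represented by functions, so
  \<open>g\<close> is determined by \<open>f\<close> only almost everywhere; this is why a choice is made in
  \<open>generator\<close>, and it does not affect the Dirichlet form.\<close>

definition generator_graph ::
    "nat \<Rightarrow> real \<Rightarrow> (config \<Rightarrow> real) \<Rightarrow> (config \<Rightarrow> real) \<Rightarrow> bool" where
  "generator_graph k p f g \<longleftrightarrow>
     in_L2 (bernoulli_tree k p) f \<and> in_L2 (bernoulli_tree k p) g \<and>
     (\<exists>F. (\<forall>n. local_fun k (F n)) \<and>
          tendsto_L2 (bernoulli_tree k p) F f \<and>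
          tendsto_L2 (bernoulli_tree k p) (\<lambda>n. local_generator k p (F n)) g)"

definition generator_dom :: "nat \<Rightarrow> real \<Rightarrow> (config \<Rightarrow> real) set" where
  "generator_dom k p = {f. \<exists>g. generator_graph k p f g}"

definition generator :: "nat \<Rightarrow> real \<Rightarrow> (config \<Rightarrow> real) \<Rightarrow> config \<Rightarrow> real" where
  "generator k p f = (SOME g. generator_graph k p f g)"

definition dirichlet_form :: "nat \<Rightarrow> real \<Rightarrow> (config \<Rightarrow> real) \<Rightarrow> real" where
  "dirichlet_form k p f = (\<integral>\<omega>. f \<omega> * (- generator k p f \<omega>) \<partial>bernoulli_tree k p)"

definition ae_const :: "'a measure \<Rightarrow> ('a \<Rightarrow> real) \<Rightarrow> bool" where
  "ae_const M f \<longleftrightarrow> (\<exists>c. AE \<omega> in M. f \<omega> = c)"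

text \<open>Extended reals are used so that a vanishing gap gives an infinite relaxation time.\<close>

definition spectral_gap :: "nat \<Rightarrow> real \<Rightarrow> ereal" where
  "spectral_gap k p =
     (INF f\<in>{f \<in> generator_dom k p. \<not> ae_const (bernoulli_tree k p) f}.
        ereal (dirichlet_form k p f / prob_space.variance (bernoulli_tree k p) f))"

definition relaxation_time :: "nat \<Rightarrow> real \<Rightarrow> ereal" where
  "relaxation_time k p = inverse (spectral_gap k p)"

definition critical_density :: "nat \<Rightarrow> real" where
  "critical_density k = 1 / real k"

end

theory Submission
  imports Defs
begin

text \<open>
  Both bounds are statements about the quotient of Dirichlet form and variance, and the form
  is explicit on functions of finitely many sites: it is the sum over \<open>x\<close> of the mean of
  \<open>constraint k x\<close> times the variance in the variable at \<open>x\<close>. Two facts about the closure of the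
  generator reduce everything to such functions: the generator is symmetric on them, so the
  chosen value of \<open>generator\<close> on a local function gives the explicit form, and both the form and
  the variance pass to limits along the graph.
  
  The lower bound on the relaxation time is a computation with one function. Explore the
  cluster of ones that hangs from the root; every vertex \<open>y\<close> whose strict ancestors are all one
  contributes the centred variable at \<open>y\<close>. The sum \<open>cluster_martingale n\<close> over the levels up to \<open>n\<close> is
  a multiple of the centred size of the cluster, up to a boundary term. Its summands are
  orthogonal, with variance \<open>p (1 - p) p ^ length y\<close>. When the children of \<open>x\<close> are
  all zero, a flip at \<open>x\<close> changes the summand at \<open>x\<close> by one, but it also opens \<open>k\<close> summands with
  value \<open>- p\<close>, so that the total changes by \<open>1 - k p\<close> only. Hence the quotient is of order
  \<open>(1 - k p)\<^sup>2\<close> (\<open>spectral_gap_upper\<close>).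
  
  For the upper bound consider blocks of consecutive levels in which only the children inside the block
  constrain a vertex, so that the last level of the block is free. The heart is that the Poincare
  constant of a block grows at most polynomially with its depth: passing from \<open>33 w\<close> levels to
  \<open>34 w\<close> levels costs a factor of six (\<open>Poincare_depth_scale\<close>). Reveal the configuration from the
  bottom of a block upwards, and stop at zeros: a vertex is revealed only if a path of ones
  leads from one of its children down to the last revealed level. What stays unrevealed is
  a random set with two properties. Its variables are still independent Bernoulli
  given the revealed ones, and the children that a vertex of the set has outside the set are
  all zero. So the known block inequality applies on the unrevealed set, and there the
  constraint that looks at the set only is the true constraint (\<open>explored_avg_Poincare\<close>).
  
  A vertex far above the bottom is revealed only if a branching process with mean at most one
  survives for long, which for \<open>h\<close> generations has probability at most \<open>8 / (8 + h)\<close>. The part of the variance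
  that a revealed vertex may lose is charged to its descendants (\<open>blocked_part_le\<close>). Each
  vertex is charged by at most one vertex on each of the \<open>w\<close> top levels, each time with weight at most
  \<open>1 / (4 w)\<close>, so the charges amount to a fixed fraction of the total variance and are
  absorbed (\<open>block_inequality\<close>, \<open>Poincare_extend\<close>). The levels below the top \<open>w\<close> ones form a block
  of \<open>33 w\<close> levels themselves. Since nothing in this step depends on \<open>k\<close> and \<open>p\<close>, neither does the
  resulting power of the depth.
  
  For the infinite tree the same argument is run once for each level, with depth \<open>l\<close> of order
  \<open>(1 - k p) ^ (-2)\<close>: survival for \<open>l\<close> generations has probability at most \<open>(k p) ^ l\<close>,
  which beats the \<open>l + 1\<close> charges per vertex (\<open>Poincare_infinite\<close>). The constant for depth
  \<open>l\<close> is then a power of \<open>1 / (1 - k p)\<close>, and \<open>1 - k p\<close> is \<open>k\<close> times the distance of \<open>p\<close> to \<open>1 / k\<close>.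
\<close>

section \<open>Elementary inequalities\<close>

text \<open>Every form of the Cauchy-Schwarz inequality below is this discriminant criterion.\<close>

lemma square_le_mult_of_nonneg_form:
  fixes a b c :: real
  assumes q: "\<And>s t. 0 \<le> s\<^sup>2 * a - 2 * s * t * b + t\<^sup>2 * c"
  shows "b\<^sup>2 \<le> a * c"
proof (cases "c = 0")
  case True
  show ?thesis
  proof (rule ccontr)
    assume "\<not> ?thesis"
    then have b: "b \<noteq> 0" using True by auto
    have "0 \<le> 1 * a - 2 * 1 * ((a + 1) / (2 * b)) * b" using q[of 1 "(a + 1) / (2 * b)"] True by simp
    then show False using b by (simp add: field_simps)
  qed
next
  case False
  have "0 \<le> c" using q[of 0 1] by simp
  moreover have "0 \<le> c * (a * c - b\<^sup>2)" using q[of c b] by (simp add: power2_eq_square algebra_simps)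
  ultimately show ?thesis using False by (simp add: zero_le_mult_iff)
qed

lemma square_add_le:
  fixes u v e :: real assumes "0 < e"
  shows "(u + v)\<^sup>2 \<le> (1 + 1 / e) * u\<^sup>2 + (1 + e) * v\<^sup>2"
proof -
  have "0 \<le> (u - e * v)\<^sup>2 / e" using assms by simp
  also have "\<dots> = (1 + 1 / e) * u\<^sup>2 + (1 + e) * v\<^sup>2 - (u + v)\<^sup>2"
    using assms by (simp add: power2_eq_square field_simps)
  finally show ?thesis by simp
qed

lemma power_one_minus_le:
  fixes y :: real assumes "0 \<le> y" "real i * y \<le> 1" "y \<le> 1"
  shows "(1 - y) ^ i \<le> 1 - real i * y / 2"
  using assms(2)
proof (induction i)
  case (Suc i)
  have iy: "real i * y \<le> 1" using Suc.prems assms(1) by (simp add: algebra_simps)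
  have "(1 - y) ^ Suc i \<le> (1 - y) * (1 - real i * y / 2)"
    using Suc.IH[OF iy] assms by (auto intro: mult_left_mono)
  also have "\<dots> = 1 - real (Suc i) * y / 2 - y * (1 - real i * y) / 2"
    by (simp add: field_simps)
  also have "\<dots> \<le> 1 - real (Suc i) * y / 2" using iy assms(1) by simp
  finally show ?case .
qed simp

text \<open>Double counting: each \<open>y\<close> is charged by at most \<open>w\<close> of the sets.\<close>

lemma sum_swap_count_le:
  fixes d :: "'b \<Rightarrow> real"
  assumes "finite J" "finite Y" "\<And>j. j \<in> J \<Longrightarrow> A j \<subseteq> Y" "\<And>y. 0 \<le> d y"
    and count: "\<And>y. card {j \<in> J. y \<in> A j} \<le> w"
  shows "(\<Sum>j\<in>J. \<Sum>y\<in>A j. d y) \<le> real w * (\<Sum>y\<in>Y. d y)"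
proof -
  have "(\<Sum>j\<in>J. \<Sum>y\<in>A j. d y) = (\<Sum>j\<in>J. \<Sum>y\<in>Y. if y \<in> A j then d y else 0)"
  proof (rule sum.cong[OF refl])
    fix j assume "j \<in> J"
    then have "Y \<inter> A j = A j" using assms(3) by blast
    then show "(\<Sum>y\<in>A j. d y) = (\<Sum>y\<in>Y. if y \<in> A j then d y else 0)"
      using sum.inter_restrict[OF assms(2), of d "A j"] by simp
  qed
  also have "\<dots> = (\<Sum>y\<in>Y. \<Sum>j\<in>J. if y \<in> A j then d y else 0)" by (rule sum.swap)
  also have "\<dots> = (\<Sum>y\<in>Y. real (card {j \<in> J. y \<in> A j}) * d y)"
    using assms(1) by (intro sum.cong refl) (simp add: sum.inter_filter[symmetric])
  also have "\<dots> \<le> (\<Sum>y\<in>Y. real w * d y)"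
    using assms(4) count by (intro sum_mono mult_right_mono) auto
  finally show ?thesis by (simp add: sum_distrib_left)
qed

section \<open>Averages over finitely many sites\<close>

locale bernoulli_sites =
  fixes p :: real
  assumes p_pos: "0 < p" and p_less_1: "p < 1"
begin

abbreviation avg1 :: "nat list \<Rightarrow> (config \<Rightarrow> real) \<Rightarrow> config \<Rightarrow> real" where
  "avg1 \<equiv> site_average p"

lemma avg1_eq: "avg1 x f \<sigma> = p * f (\<sigma>(x := True)) + (1 - p) * f (\<sigma>(x := False))"
  using p_pos p_less_1 by (simp add: site_average_def)

text \<open>Averages over finitely many sites are iterated single-site averages, applied pointwise to
  functions of the whole configuration. This keeps the finite part of the argument free of measure
  theory; the link to the product measure is \<open>integral_cylinder\<close>.\<close>

definition avg :: "nat list set \<Rightarrow> (config \<Rightarrow> real) \<Rightarrow> config \<Rightarrow> real" where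
  "avg A f = Finite_Set.fold (site_average p) f A"

lemma avg1_commute: "avg1 x (avg1 y f) = avg1 y (avg1 x f)"
  by (rule ext, cases "x = y") (simp_all add: avg1_eq fun_upd_twist[of x y] algebra_simps)

interpretation comm: comp_fun_commute "site_average p"
  by standard (auto simp: fun_eq_iff avg1_commute)

lemma avg_empty [simp]: "avg {} f = f"
  by (simp add: avg_def)

lemma avg_insert: "finite A \<Longrightarrow> x \<notin> A \<Longrightarrow> avg (insert x A) f = avg1 x (avg A f)"
  by (simp add: avg_def)

lemma avg_insert2: "finite A \<Longrightarrow> x \<notin> A \<Longrightarrow> avg (insert x A) f = avg A (avg1 x f)"
  unfolding avg_def by (rule comm.fold_insert2)

lemma avg_single [simp]: "avg {x} f = avg1 x f"
  by (simp add: avg_insert)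

lemma avg_Un: "finite A \<Longrightarrow> finite B \<Longrightarrow> A \<inter> B = {} \<Longrightarrow> avg (A \<union> B) f = avg A (avg B f)"
proof (induction A rule: finite_induct)
  case (insert x A)
  then show ?case by (simp add: avg_insert)
qed simp

lemma avg_split: "finite A \<Longrightarrow> B \<subseteq> A \<Longrightarrow> avg A f = avg B (avg (A - B) f)"
  using avg_Un[of B "A - B" f] by (auto simp: finite_subset Un_absorb1)

lemma avg_split': "finite A \<Longrightarrow> B \<subseteq> A \<Longrightarrow> avg A f = avg (A - B) (avg B f)"
  using avg_Un[of "A - B" B f] by (auto simp: finite_subset Un_absorb2)

text \<open>The comparison is needed only at the configurations that agree with \<open>\<sigma>\<close> off \<open>A\<close>. This matters
  later, where the set of averaged sites itself is determined by \<open>\<sigma>\<close>.\<close>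

lemma avg_mono:
  "finite A \<Longrightarrow> (\<And>\<eta>. (\<And>x. x \<notin> A \<Longrightarrow> \<eta> x = \<sigma> x) \<Longrightarrow> f \<eta> \<le> g \<eta>) \<Longrightarrow> avg A f \<sigma> \<le> avg A g \<sigma>"
proof (induction A arbitrary: \<sigma> rule: finite_induct)
  case (insert x A)
  have "avg A f (\<sigma>(x := b)) \<le> avg A g (\<sigma>(x := b))" for b
    by (rule insert.IH) (use insert.prems in auto)
  then show ?case
    using p_pos p_less_1 by (auto simp: insert avg_insert avg1_eq intro!: add_mono mult_left_mono)
qed simp

lemma avg_cong:
  "finite A \<Longrightarrow> (\<And>\<eta>. (\<And>x. x \<notin> A \<Longrightarrow> \<eta> x = \<sigma> x) \<Longrightarrow> f \<eta> = g \<eta>) \<Longrightarrow> avg A f \<sigma> = avg A g \<sigma>"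
  by (intro antisym avg_mono) auto

lemma avg_add: "finite A \<Longrightarrow> avg A (\<lambda>\<eta>. f \<eta> + g \<eta>) \<sigma> = avg A f \<sigma> + avg A g \<sigma>"
  by (induction A arbitrary: \<sigma> rule: finite_induct) (simp_all add: avg_insert avg1_eq algebra_simps)

lemma avg_cmult: "finite A \<Longrightarrow> avg A (\<lambda>\<eta>. c * f \<eta>) \<sigma> = c * avg A f \<sigma>"
  by (induction A arbitrary: \<sigma> rule: finite_induct) (simp_all add: avg_insert avg1_eq algebra_simps)

lemma avg_diff: "finite A \<Longrightarrow> avg A (\<lambda>\<eta>. f \<eta> - g \<eta>) \<sigma> = avg A f \<sigma> - avg A g \<sigma>"
  using avg_add[of A f "\<lambda>\<eta>. (-1) * g \<eta>" \<sigma>] avg_cmult[of A "-1" g \<sigma>] by simp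

lemma avg_const [simp]: "finite A \<Longrightarrow> avg A (\<lambda>\<eta>. c) \<sigma> = c"
  by (induction A arbitrary: \<sigma> rule: finite_induct) (simp_all add: avg_insert avg1_eq algebra_simps)

lemma avg_sum: "finite A \<Longrightarrow> avg A (\<lambda>\<eta>. \<Sum>i\<in>I. f i \<eta>) \<sigma> = (\<Sum>i\<in>I. avg A (f i) \<sigma>)"
  by (induction I rule: infinite_finite_induct) (simp_all add: avg_add)

lemma avg_nonneg: "finite A \<Longrightarrow> (\<And>\<eta>. 0 \<le> f \<eta>) \<Longrightarrow> 0 \<le> avg A f \<sigma>"
  using avg_mono[of A \<sigma> "\<lambda>_. 0" f] by simp

text \<open>\<open>indep f A\<close> refers to functional dependence, not to stochastic independence.\<close>

definition indep :: "(config \<Rightarrow> 'b) \<Rightarrow> nat list set \<Rightarrow> bool" where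
  "indep f A \<longleftrightarrow> (\<forall>\<sigma> \<eta>. (\<forall>x. x \<notin> A \<longrightarrow> \<sigma> x = \<eta> x) \<longrightarrow> f \<sigma> = f \<eta>)"

lemma indepD: "indep f A \<Longrightarrow> (\<And>x. x \<notin> A \<Longrightarrow> \<sigma> x = \<eta> x) \<Longrightarrow> f \<sigma> = f \<eta>"
  unfolding indep_def by blast

lemma indep_upd: "indep f A \<Longrightarrow> x \<in> A \<Longrightarrow> f (\<sigma>(x := b)) = f \<sigma>"
  by (rule indepD) auto

lemma indep_subset: "indep f A \<Longrightarrow> B \<subseteq> A \<Longrightarrow> indep f B"
  unfolding indep_def by blast

lemma indep_comp2: "indep f A \<Longrightarrow> indep g A \<Longrightarrow> indep (\<lambda>\<sigma>. h (f \<sigma>) (g \<sigma>)) A"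
  unfolding indep_def by metis

lemma indep_comp: "indep f A \<Longrightarrow> indep (\<lambda>\<sigma>. h (f \<sigma>)) A"
  unfolding indep_def by metis

lemma avg_mult_indep:
  "finite A \<Longrightarrow> indep f A \<Longrightarrow> avg A (\<lambda>\<eta>. f \<eta> * g \<eta>) \<sigma> = f \<sigma> * avg A g \<sigma>"
proof -
  assume A: "finite A" "indep f A"
  have "avg A (\<lambda>\<eta>. f \<eta> * g \<eta>) \<sigma> = avg A (\<lambda>\<eta>. f \<sigma> * g \<eta>) \<sigma>"
    using A by (intro avg_cong) (auto dest: indepD)
  then show ?thesis using A by (simp add: avg_cmult)
qed

lemma avg_indep: "finite A \<Longrightarrow> indep f A \<Longrightarrow> avg A f = f"
  by (rule ext) (use avg_mult_indep[of A f "\<lambda>_. 1"] in simp)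

lemma avg1_indep: "indep f {x} \<Longrightarrow> avg1 x f = f"
  using avg_indep[of "{x}" f] by simp

lemma indep_avg_other: "finite A \<Longrightarrow> indep f B \<Longrightarrow> indep (avg A f) (A \<union> B)"
proof (induction A rule: finite_induct)
  case (insert x A)
  show ?case
    unfolding indep_def
  proof (intro allI impI)
    fix \<sigma> \<eta> :: config assume *: "\<forall>y. y \<notin> insert x A \<union> B \<longrightarrow> \<sigma> y = \<eta> y"
    have "avg A f (\<sigma>(x := b)) = avg A f (\<eta>(x := b))" for b
      by (rule indepD[OF insert.IH[OF insert.prems]]) (use * in auto)
    then show "avg (insert x A) f \<sigma> = avg (insert x A) f \<eta>"
      using insert by (simp add: avg_insert avg1_eq)
  qed
qed simp

lemma indep_avg: "finite A \<Longrightarrow> indep (avg A f) A"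
  using indep_avg_other[of A f "{}"] by (simp add: indep_def fun_eq_iff[symmetric])

lemma avg_absorb: "finite A \<Longrightarrow> B \<subseteq> A \<Longrightarrow> avg A (avg B f) = avg A f"
proof -
  assume A: "finite A" "B \<subseteq> A"
  then have "finite B" by (auto simp: finite_subset)
  then have "avg B (avg B f) = avg B f" using indep_avg avg_indep by blast
  then show ?thesis using A by (simp add: avg_split'[of A B])
qed

lemma avg_avg1_absorb: "finite A \<Longrightarrow> x \<in> A \<Longrightarrow> avg A (avg1 x f) = avg A f"
  using avg_absorb[of A "{x}" f] by simp

section \<open>Variances and the chain rule\<close>

text \<open>The single-site variance is \<open>p (1 - p)\<close> times the squared discrete gradient. Gradients commute with
  averages over other sites, so convexity of the variance becomes Jensen's inequality.\<close>

definition grad :: "nat list \<Rightarrow> (config \<Rightarrow> real) \<Rightarrow> config \<Rightarrow> real" where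
  "grad x f \<sigma> = f (\<sigma>(x := True)) - f (\<sigma>(x := False))"

definition var1 :: "nat list \<Rightarrow> (config \<Rightarrow> real) \<Rightarrow> config \<Rightarrow> real" where
  "var1 x f \<sigma> = p * (1 - p) * (grad x f \<sigma>)\<^sup>2"

definition Var :: "nat list set \<Rightarrow> (config \<Rightarrow> real) \<Rightarrow> config \<Rightarrow> real" where
  "Var A f \<sigma> = avg A (\<lambda>\<eta>. (f \<eta>)\<^sup>2) \<sigma> - (avg A f \<sigma>)\<^sup>2"

lemma var1_nonneg [simp]: "0 \<le> var1 x f \<sigma>"
  using p_pos p_less_1 by (simp add: var1_def)

lemma var1_eq: "var1 x f \<sigma> = avg1 x (\<lambda>\<eta>. (f \<eta>)\<^sup>2) \<sigma> - (avg1 x f \<sigma>)\<^sup>2"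
  by (simp add: var1_def grad_def avg1_eq power2_eq_square algebra_simps)

lemma indep_grad: "indep (grad x f) {x}"
  unfolding indep_def
proof (intro allI impI)
  fix \<sigma> \<eta> :: config assume "\<forall>y. y \<notin> {x} \<longrightarrow> \<sigma> y = \<eta> y"
  then have "\<sigma>(x := b) = \<eta>(x := b)" for b by (auto simp: fun_eq_iff)
  then show "grad x f \<sigma> = grad x f \<eta>" by (simp add: grad_def)
qed

lemma indep_var1: "indep (var1 x f) {x}"
  unfolding var1_def[abs_def] by (rule indep_comp[OF indep_grad])

lemma indep_grad_other: assumes "indep f A" shows "indep (grad x f) A"
  unfolding indep_def
proof (intro allI impI)
  fix \<sigma> \<eta> :: config assume *: "\<forall>y. y \<notin> A \<longrightarrow> \<sigma> y = \<eta> y"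
  have "f (\<sigma>(x := b)) = f (\<eta>(x := b))" for b by (rule indepD[OF assms]) (use * in auto)
  then show "grad x f \<sigma> = grad x f \<eta>" by (simp add: grad_def)
qed

lemma indep_var1_other: "indep f A \<Longrightarrow> indep (var1 x f) A"
  unfolding var1_def[abs_def] by (rule indep_comp[OF indep_grad_other])

lemma var1_indep: "indep f {x} \<Longrightarrow> var1 x f \<sigma> = 0"
  by (simp add: var1_def grad_def indep_upd)

lemma avg_upd_notin: "finite A \<Longrightarrow> x \<notin> A \<Longrightarrow> avg A f (\<sigma>(x := b)) = avg A (\<lambda>\<eta>. f (\<eta>(x := b))) \<sigma>"
proof (induction A arbitrary: \<sigma> rule: finite_induct)
  case (insert y A)
  then have "x \<noteq> y" "x \<notin> A" by auto
  then show ?case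
    using insert.IH[OF \<open>x \<notin> A\<close>] insert.hyps
    by (simp only: avg_insert avg1_eq fun_upd_twist[of x y] simp_thms)
qed simp

lemma grad_avg: "finite A \<Longrightarrow> x \<notin> A \<Longrightarrow> grad x (avg A f) \<sigma> = avg A (grad x f) \<sigma>"
  by (simp add: grad_def avg_upd_notin avg_diff[symmetric] grad_def[abs_def])

lemma avg_Cauchy_Schwarz:
  assumes "finite A"
  shows "(avg A (\<lambda>\<eta>. f \<eta> * g \<eta>) \<sigma>)\<^sup>2 \<le> avg A (\<lambda>\<eta>. (f \<eta>)\<^sup>2) \<sigma> * avg A (\<lambda>\<eta>. (g \<eta>)\<^sup>2) \<sigma>"
proof (rule square_le_mult_of_nonneg_form)
  fix s t :: real
  have "0 \<le> avg A (\<lambda>\<eta>. (s * f \<eta> - t * g \<eta>)\<^sup>2) \<sigma>" using assms by (rule avg_nonneg) simp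
  also have "(\<lambda>\<eta>. (s * f \<eta> - t * g \<eta>)\<^sup>2) =
      (\<lambda>\<eta>. s\<^sup>2 * (f \<eta>)\<^sup>2 - 2 * s * t * (f \<eta> * g \<eta>) + t\<^sup>2 * (g \<eta>)\<^sup>2)"
    by (simp add: power2_eq_square algebra_simps)
  also have "avg A \<dots> \<sigma> = s\<^sup>2 * avg A (\<lambda>\<eta>. (f \<eta>)\<^sup>2) \<sigma>
      - 2 * s * t * avg A (\<lambda>\<eta>. f \<eta> * g \<eta>) \<sigma> + t\<^sup>2 * avg A (\<lambda>\<eta>. (g \<eta>)\<^sup>2) \<sigma>"
    using assms by (simp add: avg_add avg_diff avg_cmult)
  finally show "0 \<le> s\<^sup>2 * avg A (\<lambda>\<eta>. (f \<eta>)\<^sup>2) \<sigma>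
      - 2 * s * t * avg A (\<lambda>\<eta>. f \<eta> * g \<eta>) \<sigma> + t\<^sup>2 * avg A (\<lambda>\<eta>. (g \<eta>)\<^sup>2) \<sigma>" .
qed

lemma avg_square_le: "finite A \<Longrightarrow> (avg A f \<sigma>)\<^sup>2 \<le> avg A (\<lambda>\<eta>. (f \<eta>)\<^sup>2) \<sigma>"
  using avg_Cauchy_Schwarz[of A f "\<lambda>_. 1" \<sigma>] by simp

lemma Var_nonneg: "finite A \<Longrightarrow> 0 \<le> Var A f \<sigma>"
  using avg_square_le[of A f \<sigma>] by (simp add: Var_def)

lemma var1_avg_le:
  assumes "finite A" "x \<notin> A" shows "var1 x (avg A f) \<sigma> \<le> avg A (var1 x f) \<sigma>"
  using assms p_pos p_less_1 avg_square_le[of A "grad x f" \<sigma>]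
  unfolding var1_def[abs_def] by (simp add: grad_avg avg_cmult mult_left_mono)

text \<open>The law of total variance, for the variable at \<open>x\<close> and the variables in \<open>A\<close>.\<close>

lemma Var_insert:
  assumes "finite A" "x \<notin> A"
  shows "Var (insert x A) f \<sigma> = avg1 x (Var A f) \<sigma> + var1 x (avg A f) \<sigma>"
  using assms by (simp add: Var_def avg_insert var1_eq avg1_eq algebra_simps)

lemma Var_mono_set:
  assumes "finite A" "B \<subseteq> A"
  shows "avg A (Var B f) \<sigma> \<le> Var A f \<sigma>"
proof -
  have B: "finite B" using assms finite_subset by blast
  have "avg A (Var B f) \<sigma> = avg A (\<lambda>\<eta>. avg B (\<lambda>\<eta>. (f \<eta>)\<^sup>2) \<eta>) \<sigma> - avg A (\<lambda>\<eta>. (avg B f \<eta>)\<^sup>2) \<sigma>"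
    unfolding Var_def using assms by (simp add: avg_diff)
  also have "\<dots> = avg A (\<lambda>\<eta>. (f \<eta>)\<^sup>2) \<sigma> - avg A (\<lambda>\<eta>. (avg B f \<eta>)\<^sup>2) \<sigma>"
    using assms by (simp add: avg_absorb)
  also have "(avg A f \<sigma>)\<^sup>2 \<le> avg A (\<lambda>\<eta>. (avg B f \<eta>)\<^sup>2) \<sigma>"
    using avg_square_le[OF assms(1), of "avg B f" \<sigma>] assms by (simp add: avg_absorb)
  then have "avg A (\<lambda>\<eta>. (f \<eta>)\<^sup>2) \<sigma> - avg A (\<lambda>\<eta>. (avg B f \<eta>)\<^sup>2) \<sigma> \<le> Var A f \<sigma>"
    by (simp add: Var_def)
  finally show ?thesis .
qed

definition later :: "(nat list \<Rightarrow> nat) \<Rightarrow> nat list set \<Rightarrow> nat list \<Rightarrow> nat list set" where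
  "later r S x = {y \<in> S. r x < r y}"

lemma finite_later [simp]: "finite S \<Longrightarrow> finite (later r S x)"
  by (simp add: later_def)

lemma later_notin [simp]: "x \<notin> later r S x"
  by (simp add: later_def)

lemma later_subset: "later r S x \<subseteq> S"
  by (auto simp: later_def)

text \<open>Induction that adds sites in decreasing order of rank; the set of later sites of the sites that
  are already present does not change.\<close>

lemma rank_induct [consumes 2, case_names empty insert]:
  fixes r :: "nat list \<Rightarrow> nat" and P :: "nat list set \<Rightarrow> bool"
  assumes "finite S" "inj_on r S"
    and emp: "P {}"
    and ins: "\<And>x S. finite S \<Longrightarrow> x \<notin> S \<Longrightarrow> inj_on r (insert x S) \<Longrightarrow> (\<And>y. y \<in> S \<Longrightarrow> r x < r y)
      \<Longrightarrow> later r (insert x S) x = S \<Longrightarrow> (\<And>y. y \<in> S \<Longrightarrow> later r (insert x S) y = later r S y)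
      \<Longrightarrow> P S \<Longrightarrow> P (insert x S)"
  shows "P S"
  using assms(1,2)
proof (induction S rule: finite_ranking_induct[where f = "\<lambda>x. - int (r x)"])
  case empty
  show ?case by (rule emp)
next
  case (insert x S)
  show ?case
  proof (cases "x \<in> S")
    case True
    then show ?thesis using insert by (simp add: insert_absorb)
  next
    case False
    have less: "r x < r y" if "y \<in> S" for y
    proof -
      have "r x \<le> r y" using insert(2)[OF that] by simp
      moreover have "r x \<noteq> r y" using insert.prems that False by (auto simp: inj_on_def)
      ultimately show ?thesis by simp
    qed
    have "later r (insert x S) x = S" "\<And>y. y \<in> S \<Longrightarrow> later r (insert x S) y = later r S y"
      using less by (auto simp: later_def dest: less_asym)
    moreover have "inj_on r S" using insert.prems by (rule inj_on_subset) auto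
    ultimately show ?thesis
      using insert False less by (intro ins) auto
  qed
qed

text \<open>The variance is the sum of the squared martingale differences when the sites are revealed in order
  of increasing rank: \<open>avg (later r S y) f\<close> is the conditional expectation of \<open>f\<close> once \<open>y\<close> and all sites
  before \<open>y\<close> are known.\<close>

lemma Var_chain_rule:
  assumes "finite S" "inj_on r S"
  shows "Var S f \<sigma> = (\<Sum>y\<in>S. avg S (var1 y (avg (later r S y) f)) \<sigma>)"
  using assms
proof (induction S arbitrary: \<sigma> rule: rank_induct)
  case empty
  then show ?case by (simp add: Var_def)
next
  case (insert x S)
  note [simp] = insert(1,2)
  have "Var (insert x S) f \<sigma> = avg1 x (\<lambda>\<sigma>. \<Sum>y\<in>S. avg S (var1 y (avg (later r S y) f)) \<sigma>) \<sigma> + var1 x (avg S f) \<sigma>"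
    by (simp add: Var_insert insert.IH[abs_def])
  also have "avg1 x (\<lambda>\<sigma>. \<Sum>y\<in>S. avg S (var1 y (avg (later r S y) f)) \<sigma>) \<sigma>
      = (\<Sum>y\<in>S. avg (insert x S) (var1 y (avg (later r S y) f)) \<sigma>)"
    using avg_sum[of "{x}" "\<lambda>y. avg S (var1 y (avg (later r S y) f))" S \<sigma>]
    by (simp add: avg_insert)
  also have "var1 x (avg S f) \<sigma> = avg (insert x S) (var1 x (avg S f)) \<sigma>"
  proof -
    have "indep (var1 x (avg S f)) (insert x S)"
      unfolding indep_def
    proof (intro allI impI)
      fix \<sigma> \<eta> :: config assume *: "\<forall>y. y \<notin> insert x S \<longrightarrow> \<sigma> y = \<eta> y"
      have "avg S f (\<sigma>(x := b)) = avg S f (\<eta>(x := b))" for b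
        by (rule indepD[OF indep_avg[OF insert(1)]]) (use * in auto)
      then show "var1 x (avg S f) \<sigma> = var1 x (avg S f) \<eta>" by (simp add: var1_def grad_def)
    qed
    then show ?thesis by (simp add: avg_indep)
  qed
  finally show ?case using insert(5,6) by (simp cong: sum.cong)
qed

end

section \<open>Blocked vertices and exploration from below\<close>

definition levels :: "nat \<Rightarrow> nat \<Rightarrow> nat \<Rightarrow> nat list set" where
  "levels k a c = {x \<in> tree_vertices k. a \<le> length x \<and> length x < c}"

text \<open>The strict descendants of \<open>x\<close> in the next \<open>h\<close> generations.\<close>

primrec descendants :: "nat \<Rightarrow> nat \<Rightarrow> nat list \<Rightarrow> nat list set" where
  "descendants k 0 x = {}"
| "descendants k (Suc h) x = (\<Union>y\<in>children k x. insert y (descendants k h y))"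

text \<open>\<open>blocked k h x\<close> says that a path of ones starts at a child of \<open>x\<close> and reaches \<open>h\<close> levels below \<open>x\<close>. The
  value at \<open>h = 0\<close> makes every vertex of the last level count as blocked, so that exploration
  from that level upwards starts by revealing all of it.\<close>

primrec blocked :: "nat \<Rightarrow> nat \<Rightarrow> nat list \<Rightarrow> config \<Rightarrow> bool" where
  "blocked k 0 x \<sigma> = True"
| "blocked k (Suc h) x \<sigma> = (\<exists>y\<in>children k x. \<sigma> y \<and> blocked k h y \<sigma>)"

lemma finite_levels [simp]: "finite (levels k a c)"
proof -
  have "levels k a c \<subseteq> {x. set x \<subseteq> {..<k} \<and> length x \<le> c}"
    by (auto simp: levels_def tree_vertices_def)
  then show ?thesis by (rule finite_subset) (rule finite_lists_length_le, simp)
qed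

lemma length_child: "y \<in> children k x \<Longrightarrow> length y = Suc (length x)"
  by (auto simp: children_def)

lemma child_in_tree: "x \<in> tree_vertices k \<Longrightarrow> y \<in> children k x \<Longrightarrow> y \<in> tree_vertices k"
  by (auto simp: children_def tree_vertices_def)

lemma take_child: "y \<in> children k x \<Longrightarrow> take (length x) y = x"
  by (auto simp: children_def)

lemma finite_children [simp]: "finite (children k x)"
  by (simp add: children_def)

lemma card_children: "card (children k x) = k"
  by (simp add: children_def card_image inj_on_def)

lemma finite_descendants [simp]: "finite (descendants k h x)"
  by (induction h arbitrary: x) auto

lemma descendantsD:
  "z \<in> descendants k h x \<Longrightarrow> length x < length z \<and> length z \<le> length x + h \<and> take (length x) z = x
     \<and> (x \<in> tree_vertices k \<longrightarrow> z \<in> tree_vertices k)"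
proof (induction h arbitrary: x)
  case (Suc h)
  then obtain y where y: "y \<in> children k x" "z = y \<or> z \<in> descendants k h y" by auto
  from y(2) show ?case
  proof
    assume "z = y"
    then show ?thesis using y by (auto simp: length_child take_child child_in_tree)
  next
    assume "z \<in> descendants k h y"
    note IH = Suc.IH[OF this]
    have "take (length x) z = take (length x) (take (length y) z)"
      using y(1) by (simp add: length_child min_def)
    also have "\<dots> = x" using IH y(1) by (simp add: take_child)
    finally show ?thesis using IH y(1) by (auto simp: length_child child_in_tree)
  qed
qed simp

lemma blocked_cong: "(\<And>z. z \<in> descendants k h x \<Longrightarrow> \<sigma> z = \<tau> z) \<Longrightarrow> blocked k h x \<sigma> = blocked k h x \<tau>"
proof (induction h arbitrary: x)
  case (Suc h)
  have "blocked k h y \<sigma> = blocked k h y \<tau>" if "y \<in> children k x" for y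
    by (rule Suc.IH) (use Suc.prems that in auto)
  then show ?case using Suc.prems by auto
qed simp

text \<open>A vertex that is not blocked lies on no path of ones that reaches level \<open>c\<close>, whatever its own
  value is. Hence a flip at such a vertex changes no blocked status, and the set of vertices that are
  not blocked is independent of the values on it.\<close>

lemma blocked_upd_free:
  assumes "\<not> blocked k (c - length y) y \<sigma>" "length x \<le> c"
  shows "blocked k (c - length x) x (\<sigma>(y := b)) = blocked k (c - length x) x \<sigma>"
proof -
  have "blocked k h x (\<sigma>(y := b)) = blocked k h x \<sigma>" if "length x + h = c" for h x
    using that
  proof (induction h arbitrary: x)
    case (Suc h)
    have "((\<sigma>(y := b)) z \<and> blocked k h z (\<sigma>(y := b))) = (\<sigma> z \<and> blocked k h z \<sigma>)"
      if z: "z \<in> children k x" for z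
    proof -
      have l: "length z + h = c" using Suc.prems z by (simp add: length_child)
      have "\<not> blocked k h z \<sigma>" if "z = y" using assms(1) l that by auto
      then show ?thesis unfolding Suc.IH[OF l] by (cases "z = y") simp_all
    qed
    then show ?case unfolding blocked.simps by (rule bex_cong[OF refl])
  qed simp
  then show ?thesis using assms(2) by simp
qed

text \<open>The vertices of \<open>S\<close> that stay unrevealed when the configuration is explored from level \<open>c\<close> upwards
  along ones.\<close>

definition free_region :: "nat \<Rightarrow> nat \<Rightarrow> nat list set \<Rightarrow> config \<Rightarrow> nat list set" where
  "free_region k c S \<sigma> = {y \<in> S. \<not> blocked k (c - length y) y \<sigma>}"

lemma free_region_subset: "free_region k c S \<sigma> \<subseteq> S"
  by (auto simp: free_region_def)

lemma finite_free_region [simp]: "finite S \<Longrightarrow> finite (free_region k c S \<sigma>)"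
  by (simp add: free_region_def)

lemma free_region_upd:
  assumes "\<not> blocked k (c - length y) y \<sigma>" "\<And>x. x \<in> S \<Longrightarrow> length x \<le> c"
  shows "free_region k c S (\<sigma>(y := b)) = free_region k c S \<sigma>"
  using blocked_upd_free[OF assms(1)] assms(2) by (auto simp: free_region_def)

section \<open>Poincare inequalities on the unrevealed region\<close>

locale bernoulli_tree_sites = bernoulli_sites p for p +
  fixes k :: nat
  assumes two_le_k: "2 \<le> k"
begin

text \<open>The constraint of the dynamics on \<open>G\<close> with zeros outside \<open>G\<close>.\<close>

definition inner_constraint :: "nat list set \<Rightarrow> nat list \<Rightarrow> config \<Rightarrow> real" where
  "inner_constraint G y \<sigma> = of_bool (\<forall>z\<in>children k y \<inter> G. \<not> \<sigma> z)"

definition Poincare :: "nat list set \<Rightarrow> real \<Rightarrow> bool" where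
  "Poincare G T \<longleftrightarrow> (\<forall>f \<sigma>. Var G f \<sigma> \<le> T * (\<Sum>y\<in>G. avg G (\<lambda>\<eta>. inner_constraint G y \<eta> * var1 y f \<eta>) \<sigma>))"

lemma inner_constraint_nonneg [simp]: "0 \<le> inner_constraint G y \<sigma>" by (simp add: inner_constraint_def)

lemma constraint_nonneg [simp]: "0 \<le> constraint k y \<sigma>" by (simp add: constraint_def)

lemma constraint_le_inner_constraint: "constraint k y \<sigma> \<le> inner_constraint G y \<sigma>"
  by (auto simp: constraint_def inner_constraint_def)

lemma inner_constraint_anti: "G \<subseteq> H \<Longrightarrow> inner_constraint H y \<sigma> \<le> inner_constraint G y \<sigma>"
  by (auto simp: inner_constraint_def)

lemma indep_inner_constraint: "A \<inter> G = {} \<Longrightarrow> indep (inner_constraint G y) A"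
  unfolding indep_def inner_constraint_def by (intro allI impI arg_cong[where f = of_bool]) blast

text \<open>A function of the variables in \<open>G\<close> can be viewed as a function on the larger set \<open>H\<close>. This leaves the
  variance unchanged, and the constraints on \<open>H\<close> are stronger. Monotonicity is what allows one
  constant for all realisations of the unrevealed set.\<close>

lemma Poincare_mono:
  assumes PI: "Poincare H T" and fin: "finite H" and sub: "G \<subseteq> H" and T: "0 \<le> T"
  shows "Poincare G T"
  unfolding Poincare_def
proof (intro allI)
  fix f :: "config \<Rightarrow> real" and \<sigma> :: config
  have finG: "finite G" using fin sub finite_subset by blast
  \<comment> \<open>Freezing the sites outside \<open>G\<close> at their values in \<open>\<sigma>\<close> makes \<open>f\<close> a function of the sites in \<open>G\<close>.\<close>
  define f' where "f' \<eta> = f (\<lambda>x. if x \<in> G then \<eta> x else \<sigma> x)" for \<eta>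
  have ind: "indep f' (- G)"
    unfolding indep_def f'_def by (intro allI impI arg_cong[where f = f]) auto
  have indH: "indep g (- G) \<Longrightarrow> avg H g \<tau> = avg G g \<tau>" for g \<tau>
  proof -
    assume "indep g (- G)"
    then have "indep g (H - G)" by (rule indep_subset) auto
    then have "avg (H - G) g = g" by (intro avg_indep) (auto simp: fin)
    then show ?thesis using avg_split[OF fin sub, of g] by simp
  qed
  have eq: "f' \<eta> = f \<eta>" if "\<And>x. x \<notin> G \<Longrightarrow> \<eta> x = \<sigma> x" for \<eta>
    unfolding f'_def by (rule arg_cong[where f = f]) (use that in auto)
  have "Var G f \<sigma> = Var G f' \<sigma>"
    unfolding Var_def
    using avg_cong[OF finG, of \<sigma> f f'] avg_cong[OF finG, of \<sigma> "\<lambda>\<eta>. (f \<eta>)\<^sup>2" "\<lambda>\<eta>. (f' \<eta>)\<^sup>2"] eq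
    by simp
  also have "\<dots> = Var H f' \<sigma>"
    unfolding Var_def indH[OF ind] indH[OF indep_comp[OF ind, where h = "\<lambda>t. t\<^sup>2"]] ..
  also have "\<dots> \<le> T * (\<Sum>y\<in>H. avg H (\<lambda>\<eta>. inner_constraint H y \<eta> * var1 y f' \<eta>) \<sigma>)"
    using PI by (auto simp: Poincare_def)
  also have "\<dots> \<le> T * (\<Sum>y\<in>G. avg G (\<lambda>\<eta>. inner_constraint G y \<eta> * var1 y f \<eta>) \<sigma>)"
  proof (rule mult_left_mono[OF _ T])
    have zero: "var1 y f' \<eta> = 0" if "y \<notin> G" for y \<eta>
      by (rule var1_indep, rule indep_subset[OF ind]) (use that in auto)
    have "(\<Sum>y\<in>H. avg H (\<lambda>\<eta>. inner_constraint H y \<eta> * var1 y f' \<eta>) \<sigma>) = (\<Sum>y\<in>G. avg H (\<lambda>\<eta>. inner_constraint H y \<eta> * var1 y f' \<eta>) \<sigma>)"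
      by (rule sum.mono_neutral_right) (use fin sub zero in auto)
    also have "\<dots> \<le> (\<Sum>y\<in>G. avg G (\<lambda>\<eta>. inner_constraint G y \<eta> * var1 y f \<eta>) \<sigma>)"
    proof (rule sum_mono)
      fix y assume y: "y \<in> G"
      have "avg H (\<lambda>\<eta>. inner_constraint H y \<eta> * var1 y f' \<eta>) \<sigma> \<le> avg H (\<lambda>\<eta>. inner_constraint G y \<eta> * var1 y f' \<eta>) \<sigma>"
        using fin sub by (intro avg_mono mult_right_mono inner_constraint_anti) auto
      also have "\<dots> = avg G (\<lambda>\<eta>. inner_constraint G y \<eta> * var1 y f' \<eta>) \<sigma>"
        by (rule indH[OF indep_comp2[OF indep_inner_constraint indep_var1_other[OF ind]]]) auto
      also have "\<dots> = avg G (\<lambda>\<eta>. inner_constraint G y \<eta> * var1 y f \<eta>) \<sigma>"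
      proof (intro avg_cong finG)
        fix \<eta> assume e: "\<And>x. x \<notin> G \<Longrightarrow> \<eta> x = \<sigma> x"
        have "f' (\<eta>(y := b)) = f (\<eta>(y := b))" for b by (rule eq) (use e y in auto)
        then show "inner_constraint G y \<eta> * var1 y f' \<eta> = inner_constraint G y \<eta> * var1 y f \<eta>"
          by (simp add: var1_def grad_def)
      qed
      finally show "avg H (\<lambda>\<eta>. inner_constraint H y \<eta> * var1 y f' \<eta>) \<sigma> \<le> avg G (\<lambda>\<eta>. inner_constraint G y \<eta> * var1 y f \<eta>) \<sigma>" .
    qed
    finally show "(\<Sum>y\<in>H. avg H (\<lambda>\<eta>. inner_constraint H y \<eta> * var1 y f' \<eta>) \<sigma>)
        \<le> (\<Sum>y\<in>G. avg G (\<lambda>\<eta>. inner_constraint G y \<eta> * var1 y f \<eta>) \<sigma>)" .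
  qed
  finally show "Var G f \<sigma> \<le> T * (\<Sum>y\<in>G. avg G (\<lambda>\<eta>. inner_constraint G y \<eta> * var1 y f \<eta>) \<sigma>)" .
qed

text \<open>The conditional expectation given the revealed region and the values on it.\<close>

definition explored_avg :: "nat \<Rightarrow> nat list set \<Rightarrow> (config \<Rightarrow> real) \<Rightarrow> config \<Rightarrow> real" where
  "explored_avg c S f \<sigma> = avg (free_region k c S \<sigma>) f \<sigma>"

lemma explored_avg_insert:
  assumes "finite S" "x \<notin> S" "length x \<le> c" "\<And>y. y \<in> S \<Longrightarrow> length y \<le> c"
  shows "explored_avg c (insert x S) f \<sigma> =
    (if blocked k (c - length x) x \<sigma> then explored_avg c S f \<sigma> else avg1 x (explored_avg c S f) \<sigma>)"
proof (cases "blocked k (c - length x) x \<sigma>")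
  case True
  then have "free_region k c (insert x S) \<sigma> = free_region k c S \<sigma>" by (auto simp: free_region_def)
  then show ?thesis using True by (simp add: explored_avg_def)
next
  case False
  then have "free_region k c (insert x S) \<sigma> = insert x (free_region k c S \<sigma>)" by (auto simp: free_region_def)
  moreover have "free_region k c S (\<sigma>(x := b)) = free_region k c S \<sigma>" for b
    by (rule free_region_upd) (use assms False in auto)
  ultimately show ?thesis using False assms(1,2)
    by (simp add: explored_avg_def avg_insert avg1_eq) (auto simp: free_region_def avg_insert avg1_eq)
qed

lemma indep_blocked: "A \<inter> descendants k h x = {} \<Longrightarrow> indep (blocked k h x) A"
  unfolding indep_def by (auto intro!: blocked_cong)

lemma indep_blocked_self: "indep (blocked k h x) {x}"
  by (rule indep_blocked) (use descendantsD in auto)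

text \<open>The defining property of a conditional expectation: \<open>\<phi>\<close> is measurable with respect to the revealed
  information because flips at unblocked sites do not change it.\<close>

lemma avg_mult_explored_avg:
  assumes "finite B" "S \<subseteq> B" "\<And>y. y \<in> S \<Longrightarrow> length y \<le> c"
    and inv: "\<And>y \<eta> b. y \<in> S \<Longrightarrow> \<not> blocked k (c - length y) y \<eta> \<Longrightarrow> \<phi> (\<eta>(y := b)) = \<phi> \<eta>"
  shows "avg B (\<lambda>\<eta>. \<phi> \<eta> * explored_avg c S f \<eta>) \<sigma> = avg B (\<lambda>\<eta>. \<phi> \<eta> * f \<eta>) \<sigma>"
proof -
  have "finite S" using assms(1,2) finite_subset by blast
  then show ?thesis using assms(2-)
  proof (induction S rule: finite_induct)
    case empty
    then show ?case by (simp add: explored_avg_def free_region_def)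
  next
    case (insert x S)
    \<comment> \<open>If \<open>x\<close> is unblocked, the factor \<open>\<phi>\<close> does not see the variable at \<open>x\<close>, so averaging over that variable
      once more changes nothing; if \<open>x\<close> is blocked, both integrands agree.\<close>
    let ?h = "explored_avg c S f"
    have "avg1 x (\<lambda>\<eta>. \<phi> \<eta> * explored_avg c (insert x S) f \<eta>) \<tau> = avg1 x (\<lambda>\<eta>. \<phi> \<eta> * ?h \<eta>) \<tau>" for \<tau>
    proof -
      have Q: "explored_avg c (insert x S) f \<eta> = (if blocked k (c - length x) x \<eta> then ?h \<eta> else avg1 x ?h \<eta>)" for \<eta>
        by (rule explored_avg_insert) (use insert in auto)
      have b: "blocked k (c - length x) x (\<tau>(x := b)) = blocked k (c - length x) x \<tau>" for b
        by (rule indep_upd[OF indep_blocked_self]) simp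
      have "\<phi> (\<tau>(x := b)) = \<phi> \<tau>" if "\<not> blocked k (c - length x) x \<tau>" for b
        by (rule insert.prems) (use that in auto)
      then show ?thesis by (simp add: avg1_eq Q b algebra_simps)
    qed
    then have "avg1 x (\<lambda>\<eta>. \<phi> \<eta> * explored_avg c (insert x S) f \<eta>) = avg1 x (\<lambda>\<eta>. \<phi> \<eta> * ?h \<eta>)" ..
    then have "avg B (\<lambda>\<eta>. \<phi> \<eta> * explored_avg c (insert x S) f \<eta>) \<sigma> = avg B (\<lambda>\<eta>. \<phi> \<eta> * ?h \<eta>) \<sigma>"
      using insert.prems assms(1) avg_avg1_absorb[of B x "\<lambda>\<eta>. \<phi> \<eta> * explored_avg c (insert x S) f \<eta>"]
        avg_avg1_absorb[of B x "\<lambda>\<eta>. \<phi> \<eta> * ?h \<eta>"] by simp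
    also have "\<dots> = avg B (\<lambda>\<eta>. \<phi> \<eta> * f \<eta>) \<sigma>"
      by (rule insert.IH) (use insert.prems in auto)
    finally show ?case .
  qed
qed

lemma avg_explored_avg:
  assumes "finite B" "S \<subseteq> B" "\<And>y. y \<in> S \<Longrightarrow> length y \<le> c"
  shows "avg B (explored_avg c S f) \<sigma> = avg B f \<sigma>"
  using avg_mult_explored_avg[OF assms(1,2), of c "\<lambda>_. 1" f \<sigma>] assms(3) by simp

definition unblocked :: "nat \<Rightarrow> nat list \<Rightarrow> config \<Rightarrow> real" where
  "unblocked c x \<sigma> = of_bool (\<not> blocked k (c - length x) x \<sigma>)"

lemma unblocked_square [simp]: "(unblocked c x \<sigma>)\<^sup>2 = unblocked c x \<sigma>" by (simp add: unblocked_def)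
lemma unblocked_nonneg [simp]: "0 \<le> unblocked c x \<sigma>" by (simp add: unblocked_def)

lemma indep_unblocked_self: "indep (unblocked c x) {x}"
  unfolding unblocked_def[abs_def] using indep_comp[OF indep_blocked_self] by (rule indep_comp)

text \<open>The chain rule for the unrevealed region: a vertex contributes only when it is not blocked.\<close>

lemma explored_avg_telescope:
  assumes "finite R" "S \<subseteq> R" "inj_on r S" "\<And>y. y \<in> S \<Longrightarrow> length y \<le> c"
  shows "avg R (\<lambda>\<eta>. (f \<eta>)\<^sup>2) \<sigma> - avg R (\<lambda>\<eta>. (explored_avg c S f \<eta>)\<^sup>2) \<sigma> =
    (\<Sum>x\<in>S. avg R (\<lambda>\<eta>. unblocked c x \<eta> * var1 x (explored_avg c (later r S x) f) \<eta>) \<sigma>)"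
proof -
  have "finite S" using assms(1,2) finite_subset by blast
  then show ?thesis using assms(3,2,4)
  proof (induction S rule: rank_induct)
    case empty
    then show ?case by (simp add: explored_avg_def free_region_def)
  next
    case (insert x S)
    note [simp] = insert(1,2)
    let ?h = "explored_avg c S f"
    have "avg1 x (\<lambda>\<eta>. (?h \<eta>)\<^sup>2 - (explored_avg c (insert x S) f \<eta>)\<^sup>2) \<tau> = avg1 x (\<lambda>\<eta>. unblocked c x \<eta> * var1 x ?h \<eta>) \<tau>" for \<tau>
    proof -
      have Q: "explored_avg c (insert x S) f \<eta> = (if blocked k (c - length x) x \<eta> then ?h \<eta> else avg1 x ?h \<eta>)" for \<eta>
        by (rule explored_avg_insert) (use insert in auto)
      have b: "blocked k (c - length x) x (\<tau>(x := b)) = blocked k (c - length x) x \<tau>" for b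
        by (rule indep_upd[OF indep_blocked_self]) simp
      show ?thesis
        by (simp add: avg1_eq Q b unblocked_def var1_def grad_def power2_eq_square algebra_simps)
    qed
    then have "avg1 x (\<lambda>\<eta>. (?h \<eta>)\<^sup>2 - (explored_avg c (insert x S) f \<eta>)\<^sup>2) = avg1 x (\<lambda>\<eta>. unblocked c x \<eta> * var1 x ?h \<eta>)" ..
    then have "avg R (\<lambda>\<eta>. (?h \<eta>)\<^sup>2 - (explored_avg c (insert x S) f \<eta>)\<^sup>2) \<sigma> = avg R (\<lambda>\<eta>. unblocked c x \<eta> * var1 x ?h \<eta>) \<sigma>"
      using insert.prems assms(1) avg_avg1_absorb[of R x "\<lambda>\<eta>. (?h \<eta>)\<^sup>2 - (explored_avg c (insert x S) f \<eta>)\<^sup>2"]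
        avg_avg1_absorb[of R x "\<lambda>\<eta>. unblocked c x \<eta> * var1 x ?h \<eta>"] by simp
    moreover have "avg R (\<lambda>\<eta>. (f \<eta>)\<^sup>2) \<sigma> - avg R (\<lambda>\<eta>. (?h \<eta>)\<^sup>2) \<sigma> =
        (\<Sum>y\<in>S. avg R (\<lambda>\<eta>. unblocked c y \<eta> * var1 y (explored_avg c (later r S y) f) \<eta>) \<sigma>)"
      by (rule insert.IH) (use insert.prems in auto)
    ultimately show ?case using insert(5,6) assms(1) by (simp add: avg_diff cong: sum.cong)
  qed
qed

lemma levelsD: "y \<in> levels k a c \<Longrightarrow> a \<le> length y \<and> length y < c \<and> y \<in> tree_vertices k"
  by (auto simp: levels_def)

text \<open>Given the revealed information, apply the Poincare inequality to the unrevealed region, which is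
  a subset of the block. A child outside the region of a vertex inside it is revealed or lies on
  level \<open>c\<close>, and it is zero because its parent is not blocked. So the constraint inside the region
  agrees with the constraint on the tree.\<close>

lemma explored_avg_Poincare:
  assumes PI: "Poincare (levels k a c) T" and T: "0 \<le> T" and R: "finite R" "levels k a c \<subseteq> R"
  shows "avg R (\<lambda>\<eta>. (f \<eta>)\<^sup>2) \<sigma> - avg R (\<lambda>\<eta>. (explored_avg c (levels k a c) f \<eta>)\<^sup>2) \<sigma>
    \<le> T * (\<Sum>y\<in>levels k a c. avg R (\<lambda>\<eta>. constraint k y \<eta> * var1 y f \<eta>) \<sigma>)"
proof -
  let ?S = "levels k a c"
  let ?Q = "explored_avg c ?S"
  have len: "\<And>y. y \<in> ?S \<Longrightarrow> length y \<le> c" by (auto dest: levelsD)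
  have pt: "?Q (\<lambda>\<eta>. (f \<eta>)\<^sup>2) \<tau> - (?Q f \<tau>)\<^sup>2 \<le> T * (\<Sum>y\<in>?S. ?Q (\<lambda>\<eta>. constraint k y \<eta> * var1 y f \<eta>) \<tau>)" for \<tau>
  proof -
    let ?G = "free_region k c ?S \<tau>"
    have "?Q (\<lambda>\<eta>. (f \<eta>)\<^sup>2) \<tau> - (?Q f \<tau>)\<^sup>2 = Var ?G f \<tau>" by (simp add: explored_avg_def Var_def)
    also have "\<dots> \<le> T * (\<Sum>y\<in>?G. avg ?G (\<lambda>\<eta>. inner_constraint ?G y \<eta> * var1 y f \<eta>) \<tau>)"
      using Poincare_mono[OF PI _ free_region_subset T] by (simp add: Poincare_def)
    also have "\<dots> \<le> T * (\<Sum>y\<in>?G. avg ?G (\<lambda>\<eta>. constraint k y \<eta> * var1 y f \<eta>) \<tau>)"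
    proof (intro mult_left_mono T sum_mono avg_mono)
      fix y \<eta> assume y: "y \<in> ?G" and \<eta>: "\<And>x. x \<notin> ?G \<Longrightarrow> \<eta> x = \<tau> x"
      have "inner_constraint ?G y \<eta> \<le> constraint k y \<eta>"
      proof -
        have "\<not> \<eta> z" if c: "\<forall>z\<in>children k y \<inter> ?G. \<not> \<eta> z" and z: "z \<in> children k y" for z
        proof (cases "z \<in> ?G")
          case False
          have yS: "y \<in> ?S" and yb: "\<not> blocked k (c - length y) y \<tau>" using y by (auto simp: free_region_def)
          have "c - length y = Suc (c - length z)" using levelsD[OF yS] length_child[OF z] by linarith
          then have *: "\<not> (\<tau> z \<and> blocked k (c - length z) z \<tau>)" using yb z by auto
          have "blocked k (c - length z) z \<tau>"
          proof (cases "length z < c")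
            case True
            then have "z \<in> ?S" using levelsD[OF yS] z child_in_tree[OF _ z]
              by (simp add: levels_def length_child)
            then show ?thesis using False by (simp add: free_region_def)
          qed simp
          then show ?thesis using * \<eta>[OF False] by simp
        qed (use c z in auto)
        then show ?thesis by (auto simp: inner_constraint_def constraint_def)
      qed
      then show "inner_constraint ?G y \<eta> * var1 y f \<eta> \<le> constraint k y \<eta> * var1 y f \<eta>"
        by (rule mult_right_mono) simp
    qed simp
    also have "\<dots> \<le> T * (\<Sum>y\<in>?S. ?Q (\<lambda>\<eta>. constraint k y \<eta> * var1 y f \<eta>) \<tau>)"
      unfolding explored_avg_def by (intro mult_left_mono T sum_mono2 free_region_subset avg_nonneg) auto
    finally show ?thesis .
  qed
  have "avg R (\<lambda>\<eta>. (f \<eta>)\<^sup>2) \<sigma> - avg R (\<lambda>\<eta>. (?Q f \<eta>)\<^sup>2) \<sigma>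
      = avg R (\<lambda>\<tau>. ?Q (\<lambda>\<eta>. (f \<eta>)\<^sup>2) \<tau> - (?Q f \<tau>)\<^sup>2) \<sigma>"
    using R len by (simp add: avg_diff avg_explored_avg)
  also have "\<dots> \<le> avg R (\<lambda>\<tau>. T * (\<Sum>y\<in>?S. ?Q (\<lambda>\<eta>. constraint k y \<eta> * var1 y f \<eta>) \<tau>)) \<sigma>"
    using R pt by (intro avg_mono) auto
  also have "\<dots> = T * (\<Sum>y\<in>?S. avg R (\<lambda>\<eta>. constraint k y \<eta> * var1 y f \<eta>) \<sigma>)"
    using R len by (simp add: avg_cmult avg_sum avg_explored_avg)
  finally show ?thesis .
qed

end

section \<open>Survival probabilities and contributions of single vertices\<close>

text \<open>An order of exploration from the top of the tree downwards, total on \<open>R\<close>.\<close>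

definition level_order :: "(nat list \<Rightarrow> nat) \<Rightarrow> nat list set \<Rightarrow> bool" where
  "level_order r R \<longleftrightarrow> inj_on r R \<and> (\<forall>x\<in>R. \<forall>y\<in>R. length x < length y \<longrightarrow> r x < r y)"

lemma level_order_exists:
  assumes "finite R" shows "\<exists>r. level_order r R"
proof -
  obtain g :: "nat list \<Rightarrow> nat" and n where g: "g ` R = {i. i < n}" "inj_on g R"
    using finite_imp_inj_to_nat_seg[OF assms] by auto
  \<comment> \<open>Compare first by length, then by an arbitrary enumeration with values below \<open>n\<close>.\<close>
  define r where "r x = length x * n + g x" for x
  have less: "r x < r y" if "x \<in> R" "length x < length y" for x y
  proof -
    have "g x < n" using g(1) that(1) by auto
    then have "r x < Suc (length x) * n" by (simp add: r_def)
    also have "\<dots> \<le> length y * n" using that(2) by (intro mult_right_mono) auto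
    finally show ?thesis by (simp add: r_def)
  qed
  have "inj_on r R"
  proof (rule inj_onI)
    fix x y assume xy: "x \<in> R" "y \<in> R" "r x = r y"
    then have "\<not> length x < length y" "\<not> length y < length x"
      using less[of x y] less[of y x] by auto
    then have "length x = length y" by simp
    then have "g x = g y" using xy by (simp add: r_def)
    then show "x = y" using g(2) xy by (auto simp: inj_on_def)
  qed
  then show ?thesis using less by (auto simp: level_order_def)
qed

lemma level_order_subset: "level_order r R \<Longrightarrow> S \<subseteq> R \<Longrightarrow> level_order r S"
  unfolding level_order_def using inj_on_subset[of r R S] by blast

context bernoulli_sites
begin

text \<open>Independence of the variables in disjoint sets of sites.\<close>

lemma avg_prod:
  assumes "finite I" "\<And>i. i \<in> I \<Longrightarrow> finite (A i)"
    and "\<And>i j. i \<in> I \<Longrightarrow> j \<in> I \<Longrightarrow> i \<noteq> j \<Longrightarrow> A i \<inter> A j = {}"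
    and "\<And>i. i \<in> I \<Longrightarrow> indep (f i) (- A i)"
  shows "avg (\<Union>i\<in>I. A i) (\<lambda>\<eta>. \<Prod>i\<in>I. f i \<eta>) \<sigma> = (\<Prod>i\<in>I. avg (A i) (f i) \<sigma>)"
  using assms
proof (induction I arbitrary: \<sigma> rule: finite_induct)
  case (insert i I)
  let ?U = "\<Union>j\<in>I. A j" and ?g = "\<lambda>\<eta>. \<Prod>j\<in>I. f j \<eta>"
  have finU: "finite ?U" and finA: "finite (A i)" using insert by auto
  have "A i \<inter> A j = {}" if "j \<in> I" for j
    by (rule insert.prems(2)) (use that insert.hyps in auto)
  then have disj: "A i \<inter> ?U = {}" by auto
  have ind: "indep (f i) ?U" by (rule indep_subset[OF insert.prems(3)]) (use disj in auto)
  have const: "avg (A j) (f j) \<tau> = avg (A j) (f j) \<sigma>" if "j \<in> I" for j \<tau>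
  proof (rule indepD)
    show "indep (avg (A j) (f j)) (A j \<union> - A j)"
      by (rule indep_avg_other) (use insert.prems that in auto)
  qed auto
  have IH: "avg ?U ?g \<tau> = (\<Prod>j\<in>I. avg (A j) (f j) \<sigma>)" for \<tau>
  proof -
    have "avg ?U ?g \<tau> = (\<Prod>j\<in>I. avg (A j) (f j) \<tau>)"
      by (rule insert.IH) (use insert.prems in auto)
    also have "\<dots> = (\<Prod>j\<in>I. avg (A j) (f j) \<sigma>)"
      by (rule prod.cong[OF refl const])
    finally show ?thesis .
  qed
  have "avg (\<Union>j\<in>insert i I. A j) (\<lambda>\<eta>. \<Prod>j\<in>insert i I. f j \<eta>) \<sigma>
      = avg (A i) (avg ?U (\<lambda>\<eta>. f i \<eta> * ?g \<eta>)) \<sigma>"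
    using insert.hyps finU finA disj by (simp add: avg_Un)
  also have "avg ?U (\<lambda>\<eta>. f i \<eta> * ?g \<eta>) = (\<lambda>\<eta>. (\<Prod>j\<in>I. avg (A j) (f j) \<sigma>) * f i \<eta>)"
    using avg_mult_indep[OF finU ind, of ?g] IH by (auto simp: fun_eq_iff)
  finally show ?case using insert.hyps unfolding avg_cmult[OF finA] by simp
qed simp

end

context bernoulli_tree_sites
begin

text \<open>The probability that a branching process with binomial offspring of parameters \<open>k\<close> and \<open>p\<close> has
  descendants in generation \<open>h\<close>.\<close>

primrec survival :: "nat \<Rightarrow> real" where
  "survival 0 = 1"
| "survival (Suc h) = 1 - (1 - p * survival h) ^ k"

text \<open>The events that \<open>y\<close> is one and blocked, for the children \<open>y\<close> of \<open>x\<close>, live on disjoint sets of sites.\<close>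

lemma avg_blocked: "avg (descendants k h x) (\<lambda>\<eta>. of_bool (blocked k h x \<eta>)) \<sigma> = survival h"
proof (induction h arbitrary: x \<sigma>)
  case (Suc h)
  let ?A = "\<lambda>y. insert y (descendants k h y)"
  let ?f = "\<lambda>y \<eta>. 1 - of_bool (\<eta> y) * of_bool (blocked k h y \<eta>) :: real"
  have self: "y \<notin> descendants k h y" for y using descendantsD by blast
  have one: "avg (?A y) (?f y) \<sigma> = 1 - p * survival h" for y
  proof -
    have "avg (descendants k h y) (?f y) \<tau> = 1 - of_bool (\<tau> y) * survival h" for \<tau>
    proof -
      have "indep (\<lambda>\<eta>. of_bool (\<eta> y) :: real) (descendants k h y)"
        unfolding indep_def using self by auto
      then show ?thesis by (simp add: avg_diff avg_mult_indep Suc.IH)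
    qed
    then have "avg (descendants k h y) (?f y) = (\<lambda>\<tau>. 1 - of_bool (\<tau> y) * survival h)" by auto
    then show ?thesis using self by (simp add: avg_insert avg1_eq algebra_simps)
  qed
  have disj: "?A y \<inter> ?A z = {}" if "y \<in> children k x" "z \<in> children k x" "y \<noteq> z" for y z
  proof (rule ccontr)
    assume "?A y \<inter> ?A z \<noteq> {}"
    then obtain w where w: "w \<in> ?A y" "w \<in> ?A z" by auto
    then have "take (length y) w = y" "take (length z) w = z" using descendantsD by auto
    then show False using that by (simp add: length_child)
  qed
  have ind: "indep (?f y) (- ?A y)" for y
    unfolding indep_def
  proof (intro allI impI)
    fix \<omega> \<eta> :: config assume *: "\<forall>z. z \<notin> - ?A y \<longrightarrow> \<omega> z = \<eta> z"
    then have "blocked k h y \<omega> = blocked k h y \<eta>" by (intro blocked_cong) auto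
    then show "?f y \<omega> = ?f y \<eta>" using * by auto
  qed
  have "avg (descendants k (Suc h) x) (\<lambda>\<eta>. of_bool (blocked k (Suc h) x \<eta>)) \<sigma>
      = avg (\<Union>y\<in>children k x. ?A y) (\<lambda>\<eta>. 1 - (\<Prod>y\<in>children k x. ?f y \<eta>)) \<sigma>"
  proof -
    have "of_bool (blocked k (Suc h) x \<eta>) = 1 - (\<Prod>y\<in>children k x. ?f y \<eta>)" for \<eta>
    proof (cases "blocked k (Suc h) x \<eta>")
      case True
      then obtain y where "y \<in> children k x" "\<eta> y" "blocked k h y \<eta>" by auto
      then have "(\<Prod>y\<in>children k x. ?f y \<eta>) = 0" by (intro prod_zero) auto
      then show ?thesis using True by (simp only:) simp
    next
      case False
      then have "(\<Prod>y\<in>children k x. ?f y \<eta>) = 1" by (intro prod.neutral) auto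
      then show ?thesis using False by (simp only:) simp
    qed
    then show ?thesis by (simp only: descendants.simps)
  qed
  also have "\<dots> = 1 - (\<Prod>y\<in>children k x. avg (?A y) (?f y) \<sigma>)"
    using avg_prod[of "children k x" ?A ?f \<sigma>] disj ind by (simp add: avg_diff)
  also have "\<dots> = survival (Suc h)" by (simp add: one card_children)
  finally show ?case .
qed simp

text \<open>The mean square of the martingale difference at \<open>x\<close> in the chain rule for \<open>Var R f\<close>.\<close>

definition influence :: "(nat list \<Rightarrow> nat) \<Rightarrow> nat list set \<Rightarrow> (config \<Rightarrow> real) \<Rightarrow> nat list \<Rightarrow> config \<Rightarrow> real" where
  "influence r R f x \<sigma> = avg R (var1 x (avg (later r R x) f)) \<sigma>"

lemma influence_nonneg: "finite R \<Longrightarrow> 0 \<le> influence r R f x \<sigma>"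
  by (simp add: influence_def avg_nonneg)

lemma Var_eq_influence: "finite R \<Longrightarrow> level_order r R \<Longrightarrow> Var R f \<sigma> = (\<Sum>x\<in>R. influence r R f x \<sigma>)"
  by (simp add: influence_def Var_chain_rule level_order_def)

text \<open>Averaging over more sites decreases the mean variance at \<open>y\<close>, by convexity.\<close>

lemma avg_var1_avg_le:
  assumes "finite R" "L \<subseteq> Z" "Z \<subseteq> R" "y \<notin> Z"
  shows "avg R (var1 y (avg Z f)) \<sigma> \<le> avg R (var1 y (avg L f)) \<sigma>"
proof -
  have Z: "finite Z" using assms finite_subset by blast
  have "avg Z f = avg (Z - L) (avg L f)" using avg_split'[OF Z assms(2)] .
  then have "avg R (var1 y (avg Z f)) \<sigma> \<le> avg R (avg (Z - L) (var1 y (avg L f))) \<sigma>"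
    using assms Z by (auto intro!: avg_mono var1_avg_le)
  also have "\<dots> = avg R (var1 y (avg L f)) \<sigma>"
    using assms by (subst avg_absorb) auto
  finally show ?thesis .
qed

text \<open>The part of \<open>f\<close> on which \<open>x\<close> is blocked. Blocking is decided by the descendants \<open>D\<close> of \<open>x\<close>, and it has
  probability \<open>survival h\<close> for any value at \<open>x\<close>. By the Cauchy-Schwarz inequality this
  probability comes out as a factor in front of the variance in the variables at \<open>x\<close> and in \<open>D\<close>, which
  the chain rule splits into contributions of the sites of \<open>insert x D\<close>.\<close>

lemma blocked_part_le:
  assumes R: "finite R" and ord: "level_order r R" and x: "x \<in> R" and D: "descendants k h x \<subseteq> R"
  shows "avg R (var1 x (avg (later r R x) (\<lambda>\<eta>. of_bool (blocked k h x \<eta>) * f \<eta>))) \<sigma>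
    \<le> survival h * (\<Sum>y\<in>insert x (descendants k h x). influence r R f y \<sigma>)"
proof -
  define B where "B = later r R x"
  define D where "D = descendants k h x"
  define W where "W = B - D"
  define g where "g = avg W f"
  let ?\<psi> = "\<lambda>\<eta>. of_bool (blocked k h x \<eta>) :: real"
  let ?X = "insert x D"
  have DB: "D \<subseteq> B"
    using ord x D descendantsD by (auto simp: D_def B_def later_def level_order_def)
  have xB: "x \<notin> B" by (simp add: B_def)
  have fin: "finite B" "finite D" "finite W" using R by (auto simp: B_def D_def W_def)
  have XR: "?X \<subseteq> R" using x D by (simp add: D_def)
  have BR: "B \<subseteq> R" by (simp add: B_def later_subset)
  have indW: "indep ?\<psi> W"
    by (rule indep_comp[OF indep_blocked]) (auto simp: W_def D_def)
  have th: "0 \<le> survival h"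
    using avg_nonneg[OF fin(2), of ?\<psi>] avg_blocked[of h x] by (simp add: D_def)
  \<comment> \<open>Averages over the later sites outside \<open>D\<close> pass through the indicator and are absorbed into \<open>g\<close>.\<close>
  have pt: "var1 x (avg B (\<lambda>\<eta>. ?\<psi> \<eta> * f \<eta>)) \<tau> \<le> survival h * Var ?X g \<tau>" for \<tau>
  proof -
    have "avg B (\<lambda>\<eta>. ?\<psi> \<eta> * f \<eta>) = avg D (avg W (\<lambda>\<eta>. ?\<psi> \<eta> * f \<eta>))"
      unfolding W_def by (rule avg_split) (use fin DB in auto)
    also have "avg W (\<lambda>\<eta>. ?\<psi> \<eta> * f \<eta>) = (\<lambda>\<eta>. ?\<psi> \<eta> * g \<eta>)"
      using avg_mult_indep[OF fin(3) indW] by (auto simp: g_def)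
    finally have "grad x (avg B (\<lambda>\<eta>. ?\<psi> \<eta> * f \<eta>)) \<tau> = avg D (grad x (\<lambda>\<eta>. ?\<psi> \<eta> * g \<eta>)) \<tau>"
      using grad_avg[OF fin(2), of x] DB xB by auto
    also have "grad x (\<lambda>\<eta>. ?\<psi> \<eta> * g \<eta>) = (\<lambda>\<eta>. ?\<psi> \<eta> * grad x g \<eta>)"
      by (auto simp: grad_def indep_upd[OF indep_blocked_self] fun_eq_iff algebra_simps)
    finally have "(grad x (avg B (\<lambda>\<eta>. ?\<psi> \<eta> * f \<eta>)) \<tau>)\<^sup>2 \<le> avg D (\<lambda>\<eta>. (?\<psi> \<eta>)\<^sup>2) \<tau> * avg D (\<lambda>\<eta>. (grad x g \<eta>)\<^sup>2) \<tau>"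
      using avg_Cauchy_Schwarz[OF fin(2)] by simp
    also have "avg D (\<lambda>\<eta>. (?\<psi> \<eta>)\<^sup>2) \<tau> = survival h"
    proof -
      have "(\<lambda>\<eta>. (?\<psi> \<eta>)\<^sup>2) = ?\<psi>" by (auto simp: fun_eq_iff)
      then show ?thesis using avg_blocked[of h x \<tau>] by (simp only: D_def)
    qed
    finally have "var1 x (avg B (\<lambda>\<eta>. ?\<psi> \<eta> * f \<eta>)) \<tau> \<le> p * (1 - p) * (survival h * avg D (\<lambda>\<eta>. (grad x g \<eta>)\<^sup>2) \<tau>)"
      unfolding var1_def using p_pos p_less_1 by (intro mult_left_mono) auto
    also have "\<dots> = survival h * avg D (var1 x g) \<tau>"
      unfolding var1_def[abs_def] using fin by (simp add: avg_cmult)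
    also have "avg D (var1 x g) = avg ?X (var1 x g)"
      using fin DB xB avg1_indep[OF indep_var1] by (subst avg_insert2) auto
    also have "avg ?X (var1 x g) \<tau> = avg ?X (Var {x} g) \<tau>"
      using fin by (intro avg_cong) (auto simp: Var_def var1_eq)
    also have "survival h * \<dots> \<le> survival h * Var ?X g \<tau>"
      using th fin by (intro mult_left_mono Var_mono_set) auto
    finally show ?thesis .
  qed
  have "avg R (var1 x (avg B (\<lambda>\<eta>. ?\<psi> \<eta> * f \<eta>))) \<sigma> \<le> avg R (\<lambda>\<tau>. survival h * Var ?X g \<tau>) \<sigma>"
    using R pt by (intro avg_mono) auto
  also have "\<dots> = survival h * (\<Sum>y\<in>?X. avg R (avg ?X (var1 y (avg (later r ?X y) g))) \<sigma>)"
  proof -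
    have "inj_on r ?X" using level_order_subset[OF ord XR] by (simp add: level_order_def)
    then have "Var ?X g = (\<lambda>\<tau>. \<Sum>y\<in>?X. avg ?X (var1 y (avg (later r ?X y) g)) \<tau>)"
      using fin by (intro ext Var_chain_rule) auto
    then show ?thesis using R by (simp only: avg_cmult avg_sum)
  qed
  also have "\<dots> \<le> survival h * (\<Sum>y\<in>?X. influence r R f y \<sigma>)"
  proof (intro mult_left_mono th sum_mono)
    fix y assume y: "y \<in> ?X"
    let ?L = "later r ?X y"
    have disj: "?L \<inter> W = {}" using xB by (auto simp: later_def W_def)
    have merge: "avg ?L g = avg (?L \<union> W) f"
      unfolding g_def using fin disj by (intro avg_Un[symmetric]) auto
    have "avg R (avg ?X (var1 y (avg ?L g))) \<sigma> = avg R (var1 y (avg (?L \<union> W) f)) \<sigma>"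
      unfolding merge using R XR by (simp add: avg_absorb)
    also have "avg R (var1 y (avg (?L \<union> W) f)) \<sigma> \<le> avg R (var1 y (avg (later r R y) f)) \<sigma>"
    proof (rule avg_var1_avg_le[OF R])
      have "r x \<le> r y" using y DB by (auto simp: B_def later_def)
      then show "later r R y \<subseteq> ?L \<union> W" by (auto simp: later_def W_def B_def)
      show "?L \<union> W \<subseteq> R" using XR BR by (auto simp: later_def W_def)
      show "y \<notin> ?L \<union> W" using y xB by (auto simp: W_def)
    qed
    finally show "avg R (avg ?X (var1 y (avg ?L g))) \<sigma> \<le> influence r R f y \<sigma>" by (simp add: influence_def)
  qed
  finally show ?thesis by (simp add: B_def D_def)
qed

text \<open>The part of \<open>f\<close> on which \<open>x\<close> is not blocked. Averaging first over the later unrevealed sites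
  changes nothing, and the indicator does not depend on the value at \<open>x\<close>; the rest is convexity.
  The right-hand side is a term of \<open>explored_avg_telescope\<close>.\<close>

lemma unblocked_part_le:
  assumes R: "finite R" and x: "x \<in> S" and S: "S \<subseteq> R" "\<And>y. y \<in> S \<Longrightarrow> length y \<le> c"
  shows "avg R (var1 x (avg (later r R x) (\<lambda>\<eta>. unblocked c x \<eta> * f \<eta>))) \<sigma>
    \<le> avg R (\<lambda>\<eta>. unblocked c x \<eta> * var1 x (explored_avg c (later r S x) f) \<eta>) \<sigma>"
proof -
  let ?B = "later r R x" and ?h = "\<lambda>\<eta>. unblocked c x \<eta> * explored_avg c (later r S x) f \<eta>"
  have fin: "finite ?B" using R by simp
  have "avg ?B (\<lambda>\<eta>. unblocked c x \<eta> * f \<eta>) = avg ?B ?h"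
  proof (rule ext, rule avg_mult_explored_avg[OF fin, symmetric])
    show "later r S x \<subseteq> ?B" using S by (auto simp: later_def)
    show "length y \<le> c" if "y \<in> later r S x" for y using that S by (auto simp: later_def)
    show "unblocked c x (\<eta>(y := b)) = unblocked c x \<eta>" if "\<not> blocked k (c - length y) y \<eta>" for y \<eta> b
      using blocked_upd_free[OF that] S x by (simp add: unblocked_def)
  qed
  then have "avg R (var1 x (avg ?B (\<lambda>\<eta>. unblocked c x \<eta> * f \<eta>))) \<sigma> = avg R (var1 x (avg ?B ?h)) \<sigma>" by simp
  also have "\<dots> \<le> avg R (var1 x (avg {} ?h)) \<sigma>"
    by (rule avg_var1_avg_le[OF R]) (auto simp: later_def)
  also have "var1 x (avg {} ?h) = (\<lambda>\<eta>. unblocked c x \<eta> * var1 x (explored_avg c (later r S x) f) \<eta>)"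
  proof
    fix \<eta>
    have u: "unblocked c x (\<eta>(x := b)) = unblocked c x \<eta>" for b by (rule indep_upd[OF indep_unblocked_self]) simp
    show "var1 x (avg {} ?h) \<eta> = unblocked c x \<eta> * var1 x (explored_avg c (later r S x) f) \<eta>"
      by (simp add: var1_def grad_def u power_mult_distrib flip: right_diff_distrib)
  qed
  finally show ?thesis .
qed

lemma descendants_subset_levels:
  assumes "x \<in> levels k a b" "b \<le> c" shows "descendants k (c - length x) x \<subseteq> levels k a (Suc c)"
proof
  fix z assume "z \<in> descendants k (c - length x) x"
  note descendantsD[OF this]
  then show "z \<in> levels k a (Suc c)" using assms by (simp add: levels_def)
qed

text \<open>The variance carried by the levels from \<open>a\<close> to \<open>b\<close> is split according to whether the vertex is blocked
  for exploration from level \<open>c\<close>. The unblocked parts add up to at most the variance of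
  the unrevealed region. The parameter \<open>e\<close> weighs the two parts: it must be small when \<open>\<epsilon>\<close> is close to one.\<close>

lemma block_inequality:
  assumes R: "finite R" and ord: "level_order r R" and sub: "levels k a (Suc c) \<subseteq> R" and "b \<le> c"
    and PI: "Poincare (levels k a c) T" and T: "0 \<le> T" and e: "0 < e"
    and eps: "\<And>x. x \<in> levels k a b \<Longrightarrow> survival (c - length x) \<le> \<epsilon>"
  shows "(\<Sum>x\<in>levels k a b. influence r R f x \<sigma>)
    \<le> (1 + 1 / e) * (T * (\<Sum>y\<in>levels k a c. avg R (\<lambda>\<eta>. constraint k y \<eta> * var1 y f \<eta>) \<sigma>))
      + (1 + e) * \<epsilon> * (\<Sum>x\<in>levels k a b. \<Sum>y\<in>insert x (descendants k (c - length x) x). influence r R f y \<sigma>)"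
proof -
  let ?S = "levels k a c" and ?U = "levels k a b"
  let ?u = "\<lambda>x. avg R (\<lambda>\<eta>. unblocked c x \<eta> * var1 x (explored_avg c (later r ?S x) f) \<eta>) \<sigma>"
  have SR: "?S \<subseteq> R" and US: "?U \<subseteq> ?S" using sub \<open>b \<le> c\<close> by (auto simp: levels_def)
  have one: "influence r R f x \<sigma> \<le> (1 + 1 / e) * ?u x
      + (1 + e) * (\<epsilon> * (\<Sum>y\<in>insert x (descendants k (c - length x) x). influence r R f y \<sigma>))" if x: "x \<in> ?U" for x
  proof -
    let ?B = "later r R x" and ?D = "descendants k (c - length x) x"
    let ?f1 = "\<lambda>\<eta>. unblocked c x \<eta> * f \<eta>" and ?f2 = "\<lambda>\<eta>. of_bool (blocked k (c - length x) x \<eta>) * f \<eta>"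
    have "var1 x (avg ?B f) \<tau> \<le> (1 + 1 / e) * var1 x (avg ?B ?f1) \<tau> + (1 + e) * var1 x (avg ?B ?f2) \<tau>" for \<tau>
    proof -
      have "f = (\<lambda>\<eta>. ?f1 \<eta> + ?f2 \<eta>)" by (auto simp: unblocked_def)
      then have "avg ?B f \<tau> = avg ?B ?f1 \<tau> + avg ?B ?f2 \<tau>" for \<tau>
        using R avg_add[of ?B ?f1 ?f2 \<tau>] by simp
      then have "grad x (avg ?B f) \<tau> = grad x (avg ?B ?f1) \<tau> + grad x (avg ?B ?f2) \<tau>"
        by (simp add: grad_def)
      then have "var1 x (avg ?B f) \<tau> \<le> p * (1 - p) *
          ((1 + 1 / e) * (grad x (avg ?B ?f1) \<tau>)\<^sup>2 + (1 + e) * (grad x (avg ?B ?f2) \<tau>)\<^sup>2)"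
        unfolding var1_def using square_add_le[OF e] p_pos p_less_1 by (intro mult_left_mono) auto
      also have "\<dots> = (1 + 1 / e) * var1 x (avg ?B ?f1) \<tau> + (1 + e) * var1 x (avg ?B ?f2) \<tau>"
        unfolding var1_def by (simp only: distrib_left mult.left_commute)
      finally show ?thesis .
    qed
    then have "influence r R f x \<sigma> \<le> avg R (\<lambda>\<tau>. (1 + 1 / e) * var1 x (avg ?B ?f1) \<tau> + (1 + e) * var1 x (avg ?B ?f2) \<tau>) \<sigma>"
      unfolding influence_def using R by (intro avg_mono) auto
    also have "\<dots> = (1 + 1 / e) * avg R (var1 x (avg ?B ?f1)) \<sigma> + (1 + e) * avg R (var1 x (avg ?B ?f2)) \<sigma>"
      using R by (simp only: avg_add avg_cmult)
    also have "\<dots> \<le> (1 + 1 / e) * ?u x + (1 + e) * (\<epsilon> * (\<Sum>y\<in>insert x ?D. influence r R f y \<sigma>))"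
    proof (intro add_mono mult_left_mono)
      show "avg R (var1 x (avg ?B ?f1)) \<sigma> \<le> ?u x"
        by (rule unblocked_part_le) (use R x US SR in \<open>auto dest: levelsD\<close>)
      have "avg R (var1 x (avg ?B ?f2)) \<sigma> \<le> survival (c - length x) * (\<Sum>y\<in>insert x ?D. influence r R f y \<sigma>)"
        using x US SR descendants_subset_levels[OF x \<open>b \<le> c\<close>] sub by (intro blocked_part_le[OF R ord]) auto
      also have "\<dots> \<le> \<epsilon> * (\<Sum>y\<in>insert x ?D. influence r R f y \<sigma>)"
        using R eps[OF x] by (intro mult_right_mono sum_nonneg influence_nonneg)
      finally show "avg R (var1 x (avg ?B ?f2)) \<sigma> \<le> \<epsilon> * (\<Sum>y\<in>insert x ?D. influence r R f y \<sigma>)" .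
    qed (use e in auto)
    finally show ?thesis .
  qed
  have "(\<Sum>x\<in>?U. ?u x) \<le> (\<Sum>x\<in>?S. ?u x)"
    using US R by (intro sum_mono2 avg_nonneg) auto
  also have "\<dots> = avg R (\<lambda>\<eta>. (f \<eta>)\<^sup>2) \<sigma> - avg R (\<lambda>\<eta>. (explored_avg c ?S f \<eta>)\<^sup>2) \<sigma>"
    using level_order_subset[OF ord SR]
    by (intro explored_avg_telescope[symmetric] R SR) (auto simp: level_order_def dest: levelsD)
  also have "\<dots> \<le> T * (\<Sum>y\<in>?S. avg R (\<lambda>\<eta>. constraint k y \<eta> * var1 y f \<eta>) \<sigma>)"
    by (rule explored_avg_Poincare[OF PI T R SR])
  finally have u: "(\<Sum>x\<in>?U. ?u x) \<le> T * (\<Sum>y\<in>?S. avg R (\<lambda>\<eta>. constraint k y \<eta> * var1 y f \<eta>) \<sigma>)" .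
  have "(\<Sum>x\<in>?U. influence r R f x \<sigma>) \<le> (\<Sum>x\<in>?U. (1 + 1 / e) * ?u x
      + (1 + e) * (\<epsilon> * (\<Sum>y\<in>insert x (descendants k (c - length x) x). influence r R f y \<sigma>)))"
    by (intro sum_mono one)
  also have "\<dots> = (1 + 1 / e) * (\<Sum>x\<in>?U. ?u x)
      + (1 + e) * \<epsilon> * (\<Sum>x\<in>?U. \<Sum>y\<in>insert x (descendants k (c - length x) x). influence r R f y \<sigma>)"
    by (simp only: sum.distrib sum_distrib_left mult.assoc)
  also have "(1 + 1 / e) * (\<Sum>x\<in>?U. ?u x) \<le>
      (1 + 1 / e) * (T * (\<Sum>y\<in>?S. avg R (\<lambda>\<eta>. constraint k y \<eta> * var1 y f \<eta>) \<sigma>))"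
    using u e by (intro mult_left_mono) auto
  finally show ?thesis by simp
qed

end

section \<open>Poincare inequalities for blocks of levels\<close>

lemma levels_split: "a \<le> b \<Longrightarrow> b \<le> c \<Longrightarrow> levels k a c = levels k a b \<union> levels k b c"
  by (auto simp: levels_def)

lemma levels_disjoint: "levels k a b \<inter> levels k b c = {}"
  by (auto simp: levels_def)

lemma levels_mono: "a' \<le> a \<Longrightarrow> c \<le> c' \<Longrightarrow> levels k a c \<subseteq> levels k a' c'"
  by (auto simp: levels_def)

text \<open>A vertex has at most one ancestor on each level.\<close>

lemma card_ancestors_le:
  assumes "finite I" "\<And>x. x \<in> X \<Longrightarrow> y \<in> insert x (descendants k (h x) x) \<Longrightarrow> length x \<in> I"
  shows "card {x \<in> X. y \<in> insert x (descendants k (h x) x)} \<le> card I"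
proof -
  have "{x \<in> X. y \<in> insert x (descendants k (h x) x)} \<subseteq> (\<lambda>i. take i y) ` I"
  proof
    fix x assume x: "x \<in> {x \<in> X. y \<in> insert x (descendants k (h x) x)}"
    then have "take (length x) y = x" using descendantsD[of y k "h x" x] by auto
    then show "x \<in> (\<lambda>i. take i y) ` I" using x assms(2)[of x] by (intro image_eqI[of _ _ "length x"]) auto
  qed
  then show ?thesis using surj_card_le[OF assms(1)] by blast
qed

context bernoulli_tree_sites
begin

lemma Poincare_weaken: "Poincare G T \<Longrightarrow> T \<le> T' \<Longrightarrow> finite G \<Longrightarrow> Poincare G T'"
  unfolding Poincare_def
proof (intro allI)
  fix f \<sigma>
  assume PI: "\<forall>f \<sigma>. Var G f \<sigma> \<le> T * (\<Sum>y\<in>G. avg G (\<lambda>\<eta>. inner_constraint G y \<eta> * var1 y f \<eta>) \<sigma>)"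
    and "T \<le> T'" "finite G"
  then have "T * (\<Sum>y\<in>G. avg G (\<lambda>\<eta>. inner_constraint G y \<eta> * var1 y f \<eta>) \<sigma>)
      \<le> T' * (\<Sum>y\<in>G. avg G (\<lambda>\<eta>. inner_constraint G y \<eta> * var1 y f \<eta>) \<sigma>)"
    by (intro mult_right_mono sum_nonneg avg_nonneg) auto
  then show "Var G f \<sigma> \<le> T' * (\<Sum>y\<in>G. avg G (\<lambda>\<eta>. inner_constraint G y \<eta> * var1 y f \<eta>) \<sigma>)"
    using PI order_trans by blast
qed

text \<open>No two vertices of one level are parent and child, so this is the tensorised variance inequality
  for a product measure.\<close>

lemma Poincare_single_level: "Poincare (levels k a (Suc a)) 1"
  unfolding Poincare_def
proof (intro allI)
  fix f :: "config \<Rightarrow> real" and \<sigma> :: config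
  let ?S = "levels k a (Suc a)"
  obtain r where r: "level_order r ?S" using level_order_exists finite_levels by blast
  have "Var ?S f \<sigma> = (\<Sum>x\<in>?S. influence r ?S f x \<sigma>)" using r by (simp add: Var_eq_influence)
  also have "\<dots> \<le> (\<Sum>x\<in>?S. avg ?S (var1 x (avg {} f)) \<sigma>)"
    unfolding influence_def by (intro sum_mono avg_var1_avg_le) (auto simp: later_def)
  also have "\<dots> = (\<Sum>x\<in>?S. avg ?S (\<lambda>\<eta>. inner_constraint ?S x \<eta> * var1 x f \<eta>) \<sigma>)"
  proof (rule sum.cong[OF refl])
    fix x assume "x \<in> ?S"
    then have "children k x \<inter> ?S = {}" by (auto simp: levels_def dest: length_child)
    then have "inner_constraint ?S x \<eta> = 1" for \<eta> by (simp add: inner_constraint_def)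
    then show "avg ?S (var1 x (avg {} f)) \<sigma> = avg ?S (\<lambda>\<eta>. inner_constraint ?S x \<eta> * var1 x f \<eta>) \<sigma>" by simp
  qed
  finally show "Var ?S f \<sigma> \<le> 1 * (\<Sum>x\<in>?S. avg ?S (\<lambda>\<eta>. inner_constraint ?S x \<eta> * var1 x f \<eta>) \<sigma>)" by simp
qed

text \<open>The recursion in the depth. The levels from \<open>a\<close> to \<open>b\<close> are treated by \<open>block_inequality\<close>, with at most
  \<open>b - a\<close> charges per vertex, and the levels from \<open>b\<close> to \<open>N\<close> by their own Poincare inequality. The
  assumption \<open>c < N\<close> puts the children of all vertices above level \<open>c\<close> into the block, so the true
  constraint is bounded by that of the block.\<close>

lemma Poincare_extend:
  assumes up: "Poincare (levels k a c) T" "0 \<le> T" and low: "Poincare (levels k b N) T'" "0 \<le> T'"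
    and abc: "a \<le> b" "b \<le> c" "c < N" and e: "0 < e"
    and eps: "\<And>x. x \<in> levels k a b \<Longrightarrow> survival (c - length x) \<le> \<epsilon>"
    and \<rho>: "0 \<le> \<epsilon>" "(1 + e) * \<epsilon> * real (b - a) \<le> \<rho>" "\<rho> < 1"
  shows "Poincare (levels k a N) (((1 + 1 / e) * T + T') / (1 - \<rho>))"
  unfolding Poincare_def
proof (intro allI)
  fix f :: "config \<Rightarrow> real" and \<sigma> :: config
  define R where "R = levels k a N"
  let ?U = "levels k a b" and ?L = "levels k b N"
  define D where "D = (\<Sum>y\<in>R. avg R (\<lambda>\<eta>. inner_constraint R y \<eta> * var1 y f \<eta>) \<sigma>)"
  have R: "finite R" by (simp add: R_def)
  obtain r where ord: "level_order r R" using level_order_exists R by blast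
  let ?v = "\<lambda>x. influence r R f x \<sigma>"
  have split: "R = ?U \<union> ?L" unfolding R_def by (rule levels_split) (use abc in auto)
  have V: "Var R f \<sigma> = (\<Sum>x\<in>?U. ?v x) + (\<Sum>x\<in>?L. ?v x)"
    unfolding Var_eq_influence[OF R ord]
    by (subst sum.cong[OF split refl], rule sum.union_disjoint) (auto simp: levels_disjoint)
  have up_sum: "(\<Sum>x\<in>?U. ?v x) \<le> (1 + 1 / e) * (T * D) + \<rho> * Var R f \<sigma>"
  proof -
    let ?A = "\<lambda>x. insert x (descendants k (c - length x) x)"
    have "(\<Sum>x\<in>?U. ?v x) \<le> (1 + 1 / e) * (T * (\<Sum>y\<in>levels k a c. avg R (\<lambda>\<eta>. constraint k y \<eta> * var1 y f \<eta>) \<sigma>))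
      + (1 + e) * \<epsilon> * (\<Sum>x\<in>?U. \<Sum>y\<in>?A x. ?v y)"
      using abc by (intro block_inequality R ord up e eps) (auto simp: R_def levels_def)
    also have "\<dots> \<le> (1 + 1 / e) * (T * D) + (1 + e) * \<epsilon> * (real (b - a) * (\<Sum>y\<in>R. ?v y))"
    proof (intro add_mono mult_left_mono up)
      have "(\<Sum>y\<in>levels k a c. avg R (\<lambda>\<eta>. constraint k y \<eta> * var1 y f \<eta>) \<sigma>)
          \<le> (\<Sum>y\<in>levels k a c. avg R (\<lambda>\<eta>. inner_constraint R y \<eta> * var1 y f \<eta>) \<sigma>)"
        using R by (intro sum_mono avg_mono mult_right_mono constraint_le_inner_constraint) auto
      also have "\<dots> \<le> D"
        unfolding D_def using R abc
        by (intro sum_mono2 avg_nonneg) (auto simp: R_def levels_def)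
      finally show "(\<Sum>y\<in>levels k a c. avg R (\<lambda>\<eta>. constraint k y \<eta> * var1 y f \<eta>) \<sigma>) \<le> D" .
      show "(\<Sum>x\<in>?U. \<Sum>y\<in>?A x. ?v y) \<le> real (b - a) * (\<Sum>y\<in>R. ?v y)"
      proof (rule sum_swap_count_le)
        show "?A x \<subseteq> R" if x: "x \<in> ?U" for x
        proof -
          have "levels k a (Suc c) \<subseteq> R" "x \<in> R" using abc x by (auto simp: R_def levels_def)
          then show ?thesis using descendants_subset_levels[OF x \<open>b \<le> c\<close>] by blast
        qed
        show "card {x \<in> ?U. y \<in> ?A x} \<le> b - a" for y
          using card_ancestors_le[of "{a..<b}" ?U y k "\<lambda>x. c - length x"] by (auto dest: levelsD)
      qed (use R in \<open>auto intro: influence_nonneg\<close>)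
    qed (use e \<rho> in auto)
    also have "(1 + e) * \<epsilon> * (real (b - a) * (\<Sum>y\<in>R. ?v y)) \<le> \<rho> * (\<Sum>y\<in>R. ?v y)"
      unfolding mult.assoc[symmetric] using \<rho>(2) R
      by (intro mult_right_mono sum_nonneg influence_nonneg)
    finally show ?thesis by (simp add: Var_eq_influence[OF R ord])
  qed
  have low_sum: "(\<Sum>x\<in>?L. ?v x) \<le> T' * D"
  proof -
    have LR: "?L \<subseteq> R" using split by blast
    have later: "later r R x = later r ?L x" if x: "x \<in> ?L" for x
    proof
      show "later r ?L x \<subseteq> later r R x" using LR by (auto simp: later_def)
      show "later r R x \<subseteq> later r ?L x"
      proof
        fix y assume y: "y \<in> later r R x"
        then have "\<not> length y < length x"
          using ord x LR by (auto simp: later_def level_order_def dest: less_asym)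
        then show "y \<in> later r ?L x" using x y by (auto simp: later_def R_def levels_def)
      qed
    qed
    have "(\<Sum>x\<in>?L. ?v x) = (\<Sum>x\<in>?L. avg R (avg ?L (var1 x (avg (later r ?L x) f))) \<sigma>)"
      unfolding influence_def using R LR by (simp add: later avg_absorb)
    also have "\<dots> = avg R (Var ?L f) \<sigma>"
    proof -
      have "Var ?L f = (\<lambda>\<tau>. \<Sum>x\<in>?L. avg ?L (var1 x (avg (later r ?L x) f)) \<tau>)"
        using level_order_subset[OF ord LR] by (intro ext Var_chain_rule) (auto simp: level_order_def)
      then show ?thesis using R by (simp only: avg_sum)
    qed
    also have "\<dots> \<le> avg R (\<lambda>\<tau>. T' * (\<Sum>y\<in>?L. avg ?L (\<lambda>\<eta>. inner_constraint ?L y \<eta> * var1 y f \<eta>) \<tau>)) \<sigma>"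
      using R low(1) by (intro avg_mono) (auto simp: Poincare_def)
    also have "\<dots> = T' * (\<Sum>y\<in>?L. avg R (avg ?L (\<lambda>\<eta>. inner_constraint ?L y \<eta> * var1 y f \<eta>)) \<sigma>)"
      using R by (simp only: avg_cmult avg_sum)
    also have "\<dots> = T' * (\<Sum>y\<in>?L. avg R (\<lambda>\<eta>. inner_constraint R y \<eta> * var1 y f \<eta>) \<sigma>)"
    proof -
      have "inner_constraint ?L y = inner_constraint R y" if "y \<in> ?L" for y
      proof -
        have "children k y \<inter> ?L = children k y \<inter> R"
          using that abc by (auto simp: R_def levels_def dest: length_child)
        then show ?thesis by (simp add: inner_constraint_def fun_eq_iff)
      qed
      then show ?thesis using R LR by (simp add: avg_absorb)
    qed
    also have "\<dots> \<le> T' * D"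
      unfolding D_def using R LR low(2) by (intro mult_left_mono sum_mono2 avg_nonneg) auto
    finally show ?thesis .
  qed
  \<comment> \<open>The charges are absorbed into the left-hand side.\<close>
  have "(1 - \<rho>) * Var R f \<sigma> \<le> ((1 + 1 / e) * T + T') * D"
    using V up_sum low_sum by (simp add: algebra_simps)
  then have "Var R f \<sigma> \<le> ((1 + 1 / e) * T + T') * D / (1 - \<rho>)"
    using \<rho>(3) by (simp add: pos_le_divide_eq mult.commute)
  then show "Var (levels k a N) f \<sigma> \<le> ((1 + 1 / e) * T + T') / (1 - \<rho>) *
      (\<Sum>y\<in>levels k a N. avg (levels k a N) (\<lambda>\<eta>. inner_constraint (levels k a N) y \<eta> * var1 y f \<eta>) \<sigma>)"
    by (simp add: R_def D_def)
qed

text \<open>The starting level is arbitrary, which spares any argument about products of subtrees and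
  translations: a block is a forest, and it is treated as a whole.\<close>

definition Poincare_depth :: "nat \<Rightarrow> real \<Rightarrow> bool" where
  "Poincare_depth n T \<longleftrightarrow> (\<forall>a. Poincare (levels k a (a + n)) T)"

lemma Poincare_depth_mono:
  assumes "Poincare_depth n T" "m \<le> n" "T \<le> T'" "0 \<le> T"
  shows "Poincare_depth m T'"
  unfolding Poincare_depth_def
proof
  fix a
  have "Poincare (levels k a (a + m)) T"
    by (rule Poincare_mono[of "levels k a (a + n)"]) (use assms levels_mono[of a a "a + m" "a + n" k] in \<open>auto simp: Poincare_depth_def\<close>)
  then show "Poincare (levels k a (a + m)) T'" using assms(3) by (rule Poincare_weaken) simp
qed

end

section \<open>Polynomial growth in the depth and the infinite tree\<close>

locale subcritical_tree = bernoulli_tree_sites p k for p k +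
  assumes subcritical: "real k * p < 1"
begin

lemma survival_bounds: "0 \<le> survival h \<and> survival h \<le> 1"
proof (induction h)
  case (Suc h)
  have "0 \<le> 1 - p * survival h" "1 - p * survival h \<le> 1"
    using Suc p_pos p_less_1 by (auto intro: mult_le_one)
  then have "0 \<le> (1 - p * survival h) ^ k" "(1 - p * survival h) ^ k \<le> 1" by (auto intro: power_le_one)
  then show ?case by simp
qed simp

lemma survival_le_power: "survival h \<le> (real k * p) ^ h"
proof (induction h)
  case (Suc h)
  have "p * survival h \<le> 1" using survival_bounds[of h] p_pos p_less_1 by (auto intro: mult_le_one)
  then have "survival (Suc h) \<le> real k * p * survival h"
    using Bernoulli_inequality[of "- (p * survival h)" k] by simp
  also have "\<dots> \<le> real k * p * (real k * p) ^ h"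
    using Suc p_pos by (intro mult_left_mono) auto
  finally show ?case by simp
qed simp

text \<open>For mean offspring at most one, the second-order term of \<open>1 - (1 - y) ^ k\<close> is what makes survival
  probabilities decay. The constant \<open>8\<close> is uniform in \<open>k \<ge> 2\<close>.\<close>

lemma survival_step: "survival (Suc h) \<le> survival h * (1 - survival h / 8)"
proof -
  define t y x where "t = survival h" and "y = p * t" and "x = real k * y"
  have t: "0 \<le> t" "t \<le> 1" using survival_bounds by (auto simp: t_def)
  have y: "0 \<le> y" "y \<le> 1" using t p_pos p_less_1 by (auto simp: y_def intro: mult_le_one)
  have "x = (real k * p) * t" by (simp add: x_def y_def)
  also have "\<dots> \<le> 1 * t" using subcritical t by (intro mult_right_mono) auto
  finally have x: "x \<le> t" "0 \<le> x" using y by (auto simp: x_def)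
  have "survival (Suc h) = 1 - (1 - y) ^ k" by (simp add: y_def t_def)
  also have "\<dots> = y * (\<Sum>i<k. (1 - y) ^ i)" using one_diff_power_eq[of "1 - y" k] by simp
  also have "\<dots> \<le> y * (\<Sum>i<k. 1 - real i * y / 2)"
  proof (intro mult_left_mono sum_mono power_one_minus_le y)
    fix i assume "i \<in> {..<k}"
    then have "real i * y \<le> real k * y" using y by (intro mult_right_mono) auto
    then show "real i * y \<le> 1" using x t by (simp add: x_def)
  qed
  also have "(\<Sum>i<k. 1 - real i * y / 2) = real k - y * (real k * (real k - 1)) / 4"
  proof -
    have "(\<Sum>i<n. 1 - real i * y / 2) = real n - y * (real n * (real n - 1)) / 4" for n
      by (induction n) (simp_all add: field_simps)
    then show ?thesis .
  qed
  also have "y * \<dots> = x * (1 - (real k - 1) * y / 4)" by (simp add: x_def algebra_simps)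
  also have "\<dots> \<le> x * (1 - x / 8)"
  proof (rule mult_left_mono[OF _ x(2)])
    have "real k \<le> 2 * (real k - 1)" using two_le_k by simp
    then have "real k * y \<le> 2 * (real k - 1) * y" using y by (intro mult_right_mono) auto
    then have "x \<le> 2 * ((real k - 1) * y)" by (simp only: mult.assoc x_def)
    then show "1 - (real k - 1) * y / 4 \<le> 1 - x / 8" by linarith
  qed
  also have "\<dots> \<le> t * (1 - t / 8)"
  proof -
    have "0 \<le> (t - x) * (1 - (t + x) / 8)" using x t by (intro mult_nonneg_nonneg) auto
    also have "\<dots> = t * (1 - t / 8) - x * (1 - x / 8)" by (simp add: field_simps)
    finally show ?thesis by simp
  qed
  finally show ?thesis by (simp add: t_def)
qed

text \<open>Kolmogorov's estimate: by \<open>survival_step\<close> the reciprocal of the survival probability grows by at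
  least \<open>1 / 8\<close> per generation.\<close>

lemma survival_le: "survival h \<le> 8 / (8 + real h)"
proof (induction h)
  case (Suc h)
  define s t where "s = 8 / (8 + real h)" and "t = survival h"
  have t: "0 \<le> t" "t \<le> s" and s: "s \<le> 1" using survival_bounds[of h] Suc by (auto simp: s_def t_def)
  have "survival (Suc h) \<le> t * (1 - t / 8)" using survival_step by (simp add: t_def)
  also have "\<dots> \<le> s * (1 - s / 8)"
  proof -
    have "0 \<le> (s - t) * (1 - (s + t) / 8)" using s t by (intro mult_nonneg_nonneg) auto
    also have "\<dots> = s * (1 - s / 8) - t * (1 - t / 8)" by (simp add: field_simps)
    finally show ?thesis by simp
  qed
  also have "\<dots> \<le> 8 / (8 + real (Suc h))"
  proof -
    define u where "u = 8 + real h"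
    have u: "0 < u" by (simp add: u_def)
    have "8 / u * (1 - 8 / u / 8) = 8 * ((u - 1) / (u * u))"
      using u by (simp add: field_simps)
    also have "(u - 1) / (u * u) \<le> 1 / (1 + u)"
    proof (subst divide_le_eq)
      have "(u - 1) * (1 + u) \<le> u * u" by (simp add: algebra_simps)
      then have "u - 1 \<le> u * u / (1 + u)" using u by (simp add: pos_le_divide_eq)
      then show "if 0 < u * u then u - 1 \<le> 1 / (1 + u) * (u * u)
        else if u * u < 0 then 1 / (1 + u) * (u * u) \<le> u - 1 else 0 \<le> 1 / (1 + u)" using u by simp
    qed
    finally show ?thesis by (simp add: s_def u_def add_ac)
  qed
  finally show ?case .
qed simp

text \<open>Here \<open>b = c = a + 1\<close>, and a vertex is blocked unless its children are all zero, with probability at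
  most \<open>8 / 9\<close>. The weight \<open>e = 1 / 16\<close> bounds the charges by the fraction \<open>(1 + e) 8 / 9 = 17 / 18\<close> of the variance.
  This step is only used to start the recursion.\<close>

lemma Poincare_depth_Suc:
  assumes "Poincare_depth n T" "1 \<le> T" "1 \<le> n" shows "Poincare_depth (Suc n) (400 * T)"
  unfolding Poincare_depth_def
proof
  fix a
  have th: "survival (Suc a - length x) \<le> 8 / 9" if "x \<in> levels k a (Suc a)" for x
  proof -
    have "Suc a - length x = 1" using levelsD[OF that] by linarith
    then show ?thesis using survival_le[of 1] by simp
  qed
  have low: "Poincare (levels k (Suc a) (a + Suc n)) T"
    using assms(1)[unfolded Poincare_depth_def, rule_format, of "Suc a"] by simp
  have "Poincare (levels k a (a + Suc n)) (((1 + 1 / (1/16)) * 1 + T) / (1 - 17/18))"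
    by (rule Poincare_extend[OF Poincare_single_level _ low, where \<epsilon> = "8/9"]) (use assms th in simp_all)
  then show "Poincare (levels k a (a + Suc n)) (400 * T)"
    by (rule Poincare_weaken) (use assms in auto)
qed

lemma Poincare_depth_exp: "Poincare_depth n (400 ^ n)"
proof (induction n)
  case 0
  have "levels k a (a + 0) = {}" for a by (auto simp: levels_def)
  then show ?case by (simp add: Poincare_depth_def Poincare_def Var_def)
next
  case (Suc n)
  show ?case
  proof (cases "n = 0")
    case True
    then show ?thesis
      using Poincare_weaken[OF Poincare_single_level, of 400] by (simp add: Poincare_depth_def)
  next
    case False
    then show ?thesis using Poincare_depth_Suc[OF Suc] by simp
  qed
qed

text \<open>Vertices of the top \<open>w\<close> levels are at least \<open>32 w\<close> levels above level \<open>a + 33 w\<close>, so they are blocked with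
  probability at most \<open>1 / (4 w)\<close>. With \<open>e = 1\<close> the charges amount to half of the variance.\<close>

lemma Poincare_depth_scale:
  assumes PI: "Poincare_depth (33 * w) T" and T: "0 \<le> T" and w: "1 \<le> w"
  shows "Poincare_depth (34 * w) (6 * T)"
  unfolding Poincare_depth_def
proof
  fix a
  have up: "Poincare (levels k a (a + 33 * w)) T" using PI by (simp add: Poincare_depth_def)
  have low: "Poincare (levels k (a + w) (a + 34 * w)) T"
    using PI[unfolded Poincare_depth_def, rule_format, of "a + w"] by (simp add: add.assoc)
  have th: "survival (a + 33 * w - length x) \<le> 1 / (4 * real w)" if "x \<in> levels k a (a + w)" for x
  proof -
    have "32 * w \<le> a + 33 * w - length x" using levelsD[OF that] by linarith
    then have "32 * real w \<le> real (a + 33 * w - length x)" by linarith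
    then have "8 / (8 + real (a + 33 * w - length x)) \<le> 8 / (32 * real w)"
      using w by (intro divide_left_mono) auto
    then show ?thesis using survival_le[of "a + 33 * w - length x"] by simp
  qed
  have "Poincare (levels k a (a + 34 * w)) (((1 + 1 / 1) * T + T) / (1 - 1/2))"
    by (rule Poincare_extend[OF up T low T _ _ _ _ th]) (use w in simp_all)
  then show "Poincare (levels k a (a + 34 * w)) (6 * T)" by simp
qed

text \<open>A block of \<open>n\<close> levels is contained in one of \<open>34 w\<close> levels with \<open>33 w \<le> (67 / 68) n\<close> as soon as \<open>n \<ge> 2178\<close>.
  So each application of \<open>Poincare_depth_scale\<close> reduces the depth by a fixed factor, and the
  condition on \<open>\<beta>\<close> says that \<open>n ^ \<beta>\<close> pays for the factor of six.\<close>

lemma Poincare_depth_poly: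
  assumes small: "\<And>m. m < 2178 \<Longrightarrow> Poincare_depth m K" and K: "0 \<le> K" and \<beta>: "6 \<le> (68 / 67 :: real) ^ \<beta>"
    and "1 \<le> n"
  shows "Poincare_depth n (K * real n ^ \<beta>)"
  using \<open>1 \<le> n\<close>
proof (induction n rule: less_induct)
  case (less n)
  show ?case
  proof (cases "n < 2178")
    case True
    have "1 \<le> real n ^ \<beta>" using less.prems by (simp add: one_le_power)
    then have "K \<le> K * real n ^ \<beta>" using K mult_left_mono[of 1 "real n ^ \<beta>" K] by simp
    then show ?thesis by (rule Poincare_depth_mono[OF small[OF True] order_refl _ K])
  next
    case False
    define w where "w = (n + 33) div 34"
    have n34: "n \<le> 34 * w" "34 * w \<le> n + 33" unfolding w_def by linarith+
    then have w: "1 \<le> w" "33 * w < n" using False by linarith+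
    have "68 * (33 * w) \<le> 67 * n" using n34 False by linarith
    then have "68 * real (33 * w) \<le> 67 * real n" by linarith
    then have "(68 / 67) * real (33 * w) \<le> real n" by simp
    then have "((68 / 67) * real (33 * w)) ^ \<beta> \<le> real n ^ \<beta>" by (rule power_mono) simp
    then have "(68 / 67) ^ \<beta> * real (33 * w) ^ \<beta> \<le> real n ^ \<beta>" by (simp only: power_mult_distrib)
    moreover have "6 * real (33 * w) ^ \<beta> \<le> (68 / 67) ^ \<beta> * real (33 * w) ^ \<beta>"
      using \<beta> by (rule mult_right_mono) simp
    ultimately have "6 * real (33 * w) ^ \<beta> \<le> real n ^ \<beta>" by linarith
    then have "K * (6 * real (33 * w) ^ \<beta>) \<le> K * real n ^ \<beta>" using K by (rule mult_left_mono)
    then have le: "6 * (K * real (33 * w) ^ \<beta>) \<le> K * real n ^ \<beta>" by (simp only: mult.left_commute)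
    have nn: "0 \<le> K * real (33 * w) ^ \<beta>" using K by simp
    have "Poincare_depth (33 * w) (K * real (33 * w) ^ \<beta>)" by (rule less.IH) (use w in auto)
    then have "Poincare_depth (34 * w) (6 * (K * real (33 * w) ^ \<beta>))"
      using nn w(1) by (rule Poincare_depth_scale)
    then show ?thesis by (rule Poincare_depth_mono) (use n34 le nn in auto)
  qed
qed

text \<open>\<open>block_inequality\<close> is applied to each single level \<open>j\<close>, with exploration from level \<open>j + l\<close>. Each vertex is
  charged by at most \<open>l + 1\<close> vertices and occurs in the Dirichlet forms of at most \<open>l\<close> blocks. The
  constant does not involve the number \<open>n\<close> of levels on which \<open>f\<close> depends.\<close>

lemma Poincare_infinite:
  assumes PI: "Poincare_depth l T" and T: "0 \<le> T" and small: "(real k * p) ^ l * (real l + 1) \<le> 1 / 4"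
    and f: "indep f {y. n \<le> length y}" and R: "R = levels k 0 (n + l + 1)"
  shows "Var R f \<sigma> \<le> 4 * real l * T * (\<Sum>y\<in>levels k 0 n. avg R (\<lambda>\<eta>. constraint k y \<eta> * var1 y f \<eta>) \<sigma>)"
proof -
  define \<epsilon> where "\<epsilon> = (real k * p) ^ l"
  have finR: "finite R" by (simp add: R)
  obtain r where ord: "level_order r R" using level_order_exists finR by blast
  let ?v = "\<lambda>x. influence r R f x \<sigma>"
  let ?d = "\<lambda>y. avg R (\<lambda>\<eta>. constraint k y \<eta> * var1 y f \<eta>) \<sigma>"
  let ?A = "\<lambda>x. insert x (descendants k l x)"
  have zero: "?v x = 0" "?d x = 0" if "n \<le> length x" for x
  proof -
    have ind: "indep f {x}" by (rule indep_subset[OF f]) (use that in auto)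
    have "indep (avg (later r R x) f) (later r R x \<union> {x})"
      using finR ind by (intro indep_avg_other) auto
    then have "indep (avg (later r R x) f) {x}" by (rule indep_subset) auto
    then have "var1 x (avg (later r R x) f) = (\<lambda>_. 0)" by (intro ext var1_indep)
    then show "?v x = 0" using finR by (simp add: influence_def)
    have "var1 x f = (\<lambda>_. 0)" by (intro ext var1_indep ind)
    then show "?d x = 0" using finR by simp
  qed
  have layers: "(\<Sum>x\<in>levels k 0 n. g x) = (\<Sum>j<n. \<Sum>x\<in>levels k j (Suc j). g x)" for g :: "nat list \<Rightarrow> real"
  proof (induction n)
    case (Suc n)
    then show ?case
      using sum.union_disjoint[of "levels k 0 n" "levels k n (Suc n)" g] levels_split[of 0 n "Suc n" k]
        levels_disjoint[of k 0 n "Suc n"] by simp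
  qed (simp add: levels_def)
  have V: "Var R f \<sigma> = (\<Sum>x\<in>levels k 0 n. ?v x)"
    unfolding Var_eq_influence[OF finR ord]
  proof (rule sum.mono_neutral_right[OF finR])
    show "levels k 0 n \<subseteq> R" by (auto simp: R levels_def)
    show "\<forall>x\<in>R - levels k 0 n. ?v x = 0" by (intro ballI zero(1)) (auto simp: R levels_def)
  qed
  have layer: "(\<Sum>x\<in>levels k j (Suc j). ?v x) \<le> 2 * (T * (\<Sum>y\<in>levels k j (j + l). ?d y))
      + 2 * \<epsilon> * (\<Sum>x\<in>levels k j (Suc j). \<Sum>y\<in>?A x. ?v y)" if "j < n" for j
  proof -
    have len: "length x = j" if "x \<in> levels k j (Suc j)" for x using levelsD[OF that] by simp
    have "l \<noteq> 0" using small by (cases "l = 0") simp_all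
    have "(\<Sum>x\<in>levels k j (Suc j). ?v x) \<le> (1 + 1 / 1) * (T * (\<Sum>y\<in>levels k j (j + l). ?d y))
      + (1 + 1) * \<epsilon> * (\<Sum>x\<in>levels k j (Suc j). \<Sum>y\<in>insert x (descendants k (j + l - length x) x). ?v y)"
    proof (rule block_inequality[OF finR ord _ _ _ T])
      show "levels k j (Suc (j + l)) \<subseteq> R" unfolding R using that by (intro levels_mono) auto
      show "Suc j \<le> j + l" using \<open>l \<noteq> 0\<close> by simp
      show "Poincare (levels k j (j + l)) T" using PI by (simp add: Poincare_depth_def)
      show "survival (j + l - length x) \<le> \<epsilon>" if "x \<in> levels k j (Suc j)" for x
        using survival_le_power[of l] by (simp add: len[OF that] \<epsilon>_def)
    qed simp
    also have "(\<Sum>x\<in>levels k j (Suc j). \<Sum>y\<in>insert x (descendants k (j + l - length x) x). ?v y)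
        = (\<Sum>x\<in>levels k j (Suc j). \<Sum>y\<in>?A x. ?v y)"
      by (rule sum.cong) (auto simp: len)
    finally show ?thesis by simp
  qed
  have "Var R f \<sigma> \<le> (\<Sum>j<n. 2 * (T * (\<Sum>y\<in>levels k j (j + l). ?d y))
      + 2 * \<epsilon> * (\<Sum>x\<in>levels k j (Suc j). \<Sum>y\<in>?A x. ?v y))"
    unfolding V layers by (intro sum_mono layer) simp
  also have "\<dots> = 2 * (T * (\<Sum>j<n. \<Sum>y\<in>levels k j (j + l). ?d y))
      + 2 * \<epsilon> * (\<Sum>x\<in>levels k 0 n. \<Sum>y\<in>?A x. ?v y)"
    by (simp only: sum.distrib sum_distrib_left layers)
  also have "\<dots> \<le> 2 * (T * (real l * (\<Sum>y\<in>levels k 0 (n + l). ?d y)))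
      + 2 * \<epsilon> * (real (l + 1) * (\<Sum>y\<in>R. ?v y))"
  proof (intro add_mono mult_left_mono T)
    show "(\<Sum>j<n. \<Sum>y\<in>levels k j (j + l). ?d y) \<le> real l * (\<Sum>y\<in>levels k 0 (n + l). ?d y)"
    proof (rule sum_swap_count_le)
      show "card {j \<in> {..<n}. y \<in> levels k j (j + l)} \<le> l" for y
      proof -
        have "{j \<in> {..<n}. y \<in> levels k j (j + l)} \<subseteq> {length y + 1 - l..<length y + 1}"
          by (auto simp: levels_def)
        then have "card {j \<in> {..<n}. y \<in> levels k j (j + l)} \<le> card {length y + 1 - l..<length y + 1}"
          by (intro card_mono) auto
        then show ?thesis by simp
      qed
      show "levels k j (j + l) \<subseteq> levels k 0 (n + l)" if "j \<in> {..<n}" for j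
        using that by (intro levels_mono) auto
    qed (auto intro!: avg_nonneg simp: finR)
    show "(\<Sum>x\<in>levels k 0 n. \<Sum>y\<in>?A x. ?v y) \<le> real (l + 1) * (\<Sum>y\<in>R. ?v y)"
    proof (rule sum_swap_count_le)
      show "?A x \<subseteq> R" if x: "x \<in> levels k 0 n" for x
      proof
        fix y assume "y \<in> ?A x"
        then have "length y \<le> length x + l \<and> y \<in> tree_vertices k"
          using descendantsD[of y k l x] levelsD[OF x] by auto
        then show "y \<in> R" using levelsD[OF x] by (simp add: R levels_def)
      qed
      show "card {x \<in> levels k 0 n. y \<in> ?A x} \<le> l + 1" for y
      proof -
        have "card {x \<in> levels k 0 n. y \<in> ?A x} \<le> card {length y - l..length y}"
          by (rule card_ancestors_le) (auto dest!: descendantsD)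
        then show ?thesis by simp
      qed
    qed (use finR in \<open>auto intro: influence_nonneg\<close>)
  qed (use p_pos in \<open>auto simp: \<epsilon>_def\<close>)
  also have "(\<Sum>y\<in>R. ?v y) = Var R f \<sigma>" by (simp add: Var_eq_influence[OF finR ord])
  also have "(\<Sum>y\<in>levels k 0 (n + l). ?d y) = (\<Sum>y\<in>levels k 0 n. ?d y)"
  proof (rule sum.mono_neutral_right)
    show "levels k 0 n \<subseteq> levels k 0 (n + l)" by (auto simp: levels_def)
    show "\<forall>x\<in>levels k 0 (n + l) - levels k 0 n. ?d x = 0"
      by (intro ballI zero(2)) (auto simp: levels_def)
  qed simp
  finally have "Var R f \<sigma> \<le> 2 * real l * T * (\<Sum>y\<in>levels k 0 n. ?d y) + 2 * (\<epsilon> * (real l + 1)) * Var R f \<sigma>"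
    by (simp add: algebra_simps)
  moreover have "2 * (\<epsilon> * (real l + 1)) * Var R f \<sigma> \<le> 2 * (1 / 4) * Var R f \<sigma>"
    using small Var_nonneg[OF finR] by (intro mult_right_mono mult_left_mono) (auto simp: \<epsilon>_def)
  ultimately show ?thesis by simp
qed

end

section \<open>Square-integrable functions\<close>

lemma in_L2_mult: "in_L2 M f \<Longrightarrow> in_L2 M g \<Longrightarrow> integrable M (\<lambda>x. f x * g x)"
proof -
  assume fg: "in_L2 M f" "in_L2 M g"
  then have [measurable]: "f \<in> borel_measurable M" "g \<in> borel_measurable M" by (auto simp: in_L2_def)
  show ?thesis
  proof (rule Bochner_Integration.integrable_bound)
    show "integrable M (\<lambda>x. (f x)\<^sup>2 + (g x)\<^sup>2)" using fg by (auto simp: in_L2_def)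
    have "\<bar>u * v\<bar> \<le> u\<^sup>2 + v\<^sup>2" for u v :: real
    proof -
      have "2 * (\<bar>u\<bar> * \<bar>v\<bar>) \<le> u\<^sup>2 + v\<^sup>2" using sum_squares_bound[of "\<bar>u\<bar>" "\<bar>v\<bar>"] by simp
      moreover have "0 \<le> \<bar>u\<bar> * \<bar>v\<bar>" by simp
      ultimately show ?thesis unfolding abs_mult by linarith
    qed
    then show "AE x in M. norm (f x * g x) \<le> norm ((f x)\<^sup>2 + (g x)\<^sup>2)" by simp
  qed simp
qed

lemma in_L2_diff: assumes "in_L2 M f" "in_L2 M g" shows "in_L2 M (\<lambda>x. f x - g x)"
proof -
  have [measurable]: "f \<in> borel_measurable M" "g \<in> borel_measurable M" using assms by (auto simp: in_L2_def)
  have "integrable M (\<lambda>x. (f x)\<^sup>2 - 2 * (f x * g x) + (g x)\<^sup>2)"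
    using assms in_L2_mult[OF assms] by (auto simp: in_L2_def)
  moreover have "(\<lambda>x. (f x - g x)\<^sup>2) = (\<lambda>x. (f x)\<^sup>2 - 2 * (f x * g x) + (g x)\<^sup>2)"
    by (simp add: power2_eq_square algebra_simps)
  ultimately show ?thesis by (simp add: in_L2_def)
qed

lemma Cauchy_Schwarz_L2:
  assumes "in_L2 M f" "in_L2 M g"
  shows "(\<integral>x. f x * g x \<partial>M)\<^sup>2 \<le> (\<integral>x. (f x)\<^sup>2 \<partial>M) * (\<integral>x. (g x)\<^sup>2 \<partial>M)"
proof (rule square_le_mult_of_nonneg_form)
  fix s t :: real
  have i: "integrable M (\<lambda>x. (f x)\<^sup>2)" "integrable M (\<lambda>x. (g x)\<^sup>2)" "integrable M (\<lambda>x. f x * g x)"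
    using assms in_L2_mult[OF assms] by (auto simp: in_L2_def)
  have "0 \<le> (\<integral>x. (s * f x - t * g x)\<^sup>2 \<partial>M)" by simp
  also have "(\<lambda>x. (s * f x - t * g x)\<^sup>2) = (\<lambda>x. s\<^sup>2 * (f x)\<^sup>2 - 2 * s * t * (f x * g x) + t\<^sup>2 * (g x)\<^sup>2)"
    by (simp add: power2_eq_square algebra_simps)
  also have "(\<integral>x. \<dots> x \<partial>M) = s\<^sup>2 * (\<integral>x. (f x)\<^sup>2 \<partial>M) - 2 * s * t * (\<integral>x. f x * g x \<partial>M) + t\<^sup>2 * (\<integral>x. (g x)\<^sup>2 \<partial>M)"
    using i by simp
  finally show "0 \<le> s\<^sup>2 * (\<integral>x. (f x)\<^sup>2 \<partial>M) - 2 * s * t * (\<integral>x. f x * g x \<partial>M) + t\<^sup>2 * (\<integral>x. (g x)\<^sup>2 \<partial>M)" .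
qed

lemma tendsto_zero_of_square_le:
  fixes X Y :: "nat \<Rightarrow> real"
  assumes "\<And>n. (X n)\<^sup>2 \<le> Y n" "Y \<longlonglongrightarrow> 0" shows "X \<longlonglongrightarrow> 0"
proof -
  have "(\<lambda>n. (X n)\<^sup>2) \<longlonglongrightarrow> 0"
    by (rule tendsto_sandwich[OF _ _ tendsto_const assms(2)]) (use assms(1) in auto)
  then have "(\<lambda>n. sqrt ((X n)\<^sup>2)) \<longlonglongrightarrow> sqrt 0" by (rule tendsto_real_sqrt)
  then show ?thesis using tendsto_rabs_zero_iff[of X] by simp
qed

text \<open>Continuity of the inner product; it carries all limits along the graph of the generator.\<close>

lemma tendsto_L2_inner:
  assumes F: "\<And>n. in_L2 M (F n)" "in_L2 M f" "tendsto_L2 M F f"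
    and G: "\<And>n. in_L2 M (G n)" "in_L2 M g" "tendsto_L2 M G g"
  shows "(\<lambda>n. \<integral>x. F n x * G n x \<partial>M) \<longlonglongrightarrow> (\<integral>x. f x * g x \<partial>M)"
proof -
  let ?u = "\<lambda>n x. F n x - f x" and ?v = "\<lambda>n x. G n x - g x"
  have u: "in_L2 M (?u n)" and v: "in_L2 M (?v n)" for n using F G by (auto intro: in_L2_diff)
  have lim: "(\<lambda>n. \<integral>x. (?u n x)\<^sup>2 \<partial>M) \<longlonglongrightarrow> 0" "(\<lambda>n. \<integral>x. (?v n x)\<^sup>2 \<partial>M) \<longlonglongrightarrow> 0"
    using F(3) G(3) by (auto simp: tendsto_L2_def)
  have 1: "(\<lambda>n. \<integral>x. ?u n x * ?v n x \<partial>M) \<longlonglongrightarrow> 0"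
    by (rule tendsto_zero_of_square_le[OF Cauchy_Schwarz_L2[OF u v]])
       (use tendsto_mult[OF lim] in simp)
  have 2: "(\<lambda>n. \<integral>x. ?u n x * g x \<partial>M) \<longlonglongrightarrow> 0"
    by (rule tendsto_zero_of_square_le[OF Cauchy_Schwarz_L2[OF u G(2)]])
       (use tendsto_mult_right[OF lim(1)] in simp)
  have 3: "(\<lambda>n. \<integral>x. f x * ?v n x \<partial>M) \<longlonglongrightarrow> 0"
    by (rule tendsto_zero_of_square_le[OF Cauchy_Schwarz_L2[OF F(2) v]])
       (use tendsto_mult_left[OF lim(2)] in simp)
  have "(\<integral>x. F n x * G n x \<partial>M) = (\<integral>x. ?u n x * ?v n x \<partial>M) + (\<integral>x. ?u n x * g x \<partial>M)
      + (\<integral>x. f x * ?v n x \<partial>M) + (\<integral>x. f x * g x \<partial>M)" for n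
  proof -
    have "(\<lambda>x. F n x * G n x) = (\<lambda>x. ?u n x * ?v n x + ?u n x * g x + f x * ?v n x + f x * g x)"
      by (simp add: algebra_simps)
    then show ?thesis
      using in_L2_mult[OF u v] in_L2_mult[OF u G(2)] in_L2_mult[OF F(2) v] in_L2_mult[OF F(2) G(2)]
      by simp
  qed
  then show ?thesis
    using tendsto_add[OF tendsto_add[OF tendsto_add[OF 1 2] 3] tendsto_const[of "\<integral>x. f x * g x \<partial>M"]]
    by simp
qed

section \<open>The product measure\<close>

context bernoulli_tree_sites
begin

abbreviation "M \<equiv> bernoulli_tree k p"

lemma prob_space_M: "prob_space M"
  unfolding bernoulli_tree_def by (intro prob_space_PiM prob_space_measure_pmf)

sublocale M: prob_space M by (rule prob_space_M)

lemma space_M: "space M = configs k"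
  by (simp add: bernoulli_tree_def configs_def space_PiM)

lemma measurable_site [measurable]: "x \<in> tree_vertices k \<Longrightarrow> (\<lambda>\<omega>. \<omega> x) \<in> measurable M (count_space UNIV)"
  using measurable_component_singleton[of x "tree_vertices k" "\<lambda>_. measure_pmf (bernoulli_pmf p)"]
  by (simp add: bernoulli_tree_def)

lemma cylinder_expand:
  assumes "finite A" "indep f (- A)"
  shows "f \<omega> = f (\<lambda>x. x \<in> {x \<in> A. \<omega> x})"
  by (rule indepD[OF assms(2)]) auto

lemma measurable_cylinder:
  fixes f :: "config \<Rightarrow> real"
  assumes A: "finite A" "A \<subseteq> tree_vertices k" and f: "indep f (- A)"
  shows "f \<in> borel_measurable M"
proof -
  have eq: "f = (\<lambda>\<omega>. \<Sum>B\<in>Pow A. f (\<lambda>x. x \<in> B) * (\<Prod>x\<in>A. of_bool (\<omega> x = (x \<in> B))))"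
  proof
    fix \<omega>
    let ?B = "{x \<in> A. \<omega> x}"
    have "(\<Sum>B\<in>Pow A. f (\<lambda>x. x \<in> B) * (\<Prod>x\<in>A. of_bool (\<omega> x = (x \<in> B))))
        = (\<Sum>B\<in>{?B}. f (\<lambda>x. x \<in> B) * (\<Prod>x\<in>A. of_bool (\<omega> x = (x \<in> B))))"
    proof (rule sum.mono_neutral_right)
      show "\<forall>B\<in>Pow A - {?B}. f (\<lambda>x. x \<in> B) * (\<Prod>x\<in>A. of_bool (\<omega> x = (x \<in> B))) = 0"
      proof
        fix B assume "B \<in> Pow A - {?B}"
        then obtain x where "x \<in> A" "\<omega> x \<noteq> (x \<in> B)" by blast
        then have "(\<Prod>x\<in>A. of_bool (\<omega> x = (x \<in> B)) :: real) = 0" using A by (intro prod_zero) auto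
        then show "f (\<lambda>x. x \<in> B) * (\<Prod>x\<in>A. of_bool (\<omega> x = (x \<in> B))) = 0" by simp
      qed
    qed (use A in auto)
    also have "\<dots> = f \<omega>"
    proof -
      have "(\<Prod>x\<in>A. of_bool (\<omega> x = (x \<in> ?B)) :: real) = 1" by (intro prod.neutral) auto
      then show ?thesis using cylinder_expand[OF A(1) f, of \<omega>] by simp
    qed
    finally show "f \<omega> = (\<Sum>B\<in>Pow A. f (\<lambda>x. x \<in> B) * (\<Prod>x\<in>A. of_bool (\<omega> x = (x \<in> B))))" ..
  qed
  have "(\<lambda>\<omega>. \<Sum>B\<in>Pow A. f (\<lambda>x. x \<in> B) * (\<Prod>x\<in>A. of_bool (\<omega> x = (x \<in> B)))) \<in> borel_measurable M"
  proof (intro borel_measurable_sum borel_measurable_times borel_measurable_const borel_measurable_prod)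
    fix B x assume "x \<in> A"
    then have [measurable]: "(\<lambda>\<omega>. \<omega> x) \<in> measurable M (count_space UNIV)" using A measurable_site by blast
    show "(\<lambda>\<omega>. of_bool (\<omega> x = (x \<in> B)) :: real) \<in> borel_measurable M"
      by (rule measurable_compose[of "\<lambda>\<omega>. \<omega> x" M "count_space UNIV"]) auto
  qed
  then show ?thesis by (subst eq)
qed

lemma cylinder_bounded:
  assumes "finite A" "indep f (- A)"
  shows "\<exists>C. \<forall>\<omega>. \<bar>f \<omega>\<bar> \<le> (C::real)"
proof -
  have "\<bar>f \<omega>\<bar> \<le> (\<Sum>B\<in>Pow A. \<bar>f (\<lambda>x. x \<in> B)\<bar>)" for \<omega>
    unfolding cylinder_expand[OF assms, of \<omega>]
    by (rule member_le_sum) (use assms in auto)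
  then show ?thesis by blast
qed

lemma integrable_cylinder:
  assumes "finite A" "A \<subseteq> tree_vertices k" "indep f (- A)"
  shows "integrable M (f :: config \<Rightarrow> real)"
proof -
  obtain C where "\<forall>\<omega>. \<bar>f \<omega>\<bar> \<le> C" using cylinder_bounded[OF assms(1,3)] by blast
  then show ?thesis
    using measurable_cylinder[OF assms] by (intro M.integrable_const_bound[of f C]) auto
qed

text \<open>Resampling the variable at \<open>x\<close> preserves the product measure.\<close>

lemma integral_avg1:
  assumes A: "finite A" "A \<subseteq> tree_vertices k" and f: "indep f (- A)" and x: "x \<in> tree_vertices k"
  shows "(\<integral>\<omega>. avg1 x f \<omega> \<partial>M) = (\<integral>\<omega>. f \<omega> \<partial>M)"
proof -
  let ?B = "measure_pmf (bernoulli_pmf p)"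
  interpret P: pair_prob_space ?B M ..
  have ins: "insert x (tree_vertices k) = tree_vertices k" using x by auto
  have distr: "distr (?B \<Otimes>\<^sub>M M) M (\<lambda>(b, X). X(x := b)) = M"
    using distr_pair_PiM_eq_PiM[of "tree_vertices k" "\<lambda>_. ?B" x,
        OF prob_space_measure_pmf prob_space_measure_pmf]
    by (simp only: ins bernoulli_tree_def)
  have m: "(\<lambda>(b, X). X(x := b)) \<in> measurable (?B \<Otimes>\<^sub>M M) M"
    unfolding bernoulli_tree_def
    unfolding case_prod_unfold
    by (rule measurable_fun_upd[where J = "tree_vertices k"]) (use x in auto)
  have mf: "f \<in> borel_measurable M" by (rule measurable_cylinder[OF A f])
  obtain C where C: "\<And>\<omega>. \<bar>f \<omega>\<bar> \<le> C" using cylinder_bounded[OF A(1) f] by blast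
  have int: "integrable (?B \<Otimes>\<^sub>M M) (\<lambda>(b, X). f (X(x := b)))"
  proof (rule P.integrable_const_bound[of _ C])
    show "AE z in ?B \<Otimes>\<^sub>M M. norm (case z of (b, X) \<Rightarrow> f (X(x := b))) \<le> C" using C by auto
    show "(\<lambda>(b, X). f (X(x := b))) \<in> borel_measurable (?B \<Otimes>\<^sub>M M)"
      using measurable_compose[OF m mf] by (simp add: case_prod_beta)
  qed
  have "(\<integral>\<omega>. f \<omega> \<partial>M) = (\<integral>\<omega>. f \<omega> \<partial>distr (?B \<Otimes>\<^sub>M M) M (\<lambda>(b, X). X(x := b)))" by (simp only: distr)
  also have "\<dots> = (\<integral>z. f (case z of (b, X) \<Rightarrow> X(x := b)) \<partial>(?B \<Otimes>\<^sub>M M))"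
    by (rule integral_distr[OF m mf])
  also have "\<dots> = (\<integral>(b, X). f (X(x := b)) \<partial>(?B \<Otimes>\<^sub>M M))" by (simp only: case_prod_unfold)
  also have "\<dots> = (\<integral>X. (\<integral>b. f (X(x := b)) \<partial>?B) \<partial>M)"
    using P.integral_snd[OF int] by simp
  finally show ?thesis by (simp add: site_average_def[abs_def])
qed

lemma integral_avg:
  assumes "finite B" "B \<subseteq> tree_vertices k" "finite A" "A \<subseteq> tree_vertices k" "indep f (- A)"
  shows "(\<integral>\<omega>. avg B f \<omega> \<partial>M) = (\<integral>\<omega>. f \<omega> \<partial>M)"
  using assms(1,2)
proof (induction B rule: finite_induct)
  case (insert x B)
  have "indep (avg B f) (B \<union> - A)" by (rule indep_avg_other) (use insert assms in auto)
  then have "indep (avg B f) (- A)" by (rule indep_subset) auto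
  then show ?case using insert assms(3,4) by (simp add: avg_insert integral_avg1[of A])
qed simp

lemma integral_cylinder:
  assumes "finite R" "R \<subseteq> tree_vertices k" "indep f (- R)"
  shows "(\<integral>\<omega>. f \<omega> \<partial>M) = avg R f \<sigma>"
proof -
  have "indep (avg R f) (R \<union> - R)" by (rule indep_avg_other) (use assms in auto)
  then have "avg R f \<omega> = avg R f \<sigma>" for \<omega> by (rule indepD) auto
  then have "(\<integral>\<omega>. avg R f \<omega> \<partial>M) = (\<integral>\<omega>. avg R f \<sigma> \<partial>M)"
    by (intro Bochner_Integration.integral_cong) auto
  then show ?thesis using integral_avg[OF assms(1,2,1,2,3)] M.prob_space by simp
qed

section \<open>Local functions and the generator\<close>

lemma levels_subset_tree: "levels k a b \<subseteq> tree_vertices k"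
  by (auto simp: levels_def)

text \<open>A local function may take any values outside \<open>configs k\<close>. The representative \<open>f'\<close> has the same
  values on \<open>configs k\<close> and depends on finitely many sites everywhere, so it can be averaged
  pointwise.\<close>

definition local_rep :: "nat \<Rightarrow> (config \<Rightarrow> real) \<Rightarrow> (config \<Rightarrow> real) \<Rightarrow> bool" where
  "local_rep n f f' \<longleftrightarrow> indep f' (- levels k 0 n) \<and> (\<forall>\<tau>\<in>configs k. f \<tau> = f' \<tau>)"

lemma local_rep_mono: "local_rep n f f' \<Longrightarrow> n \<le> m \<Longrightarrow> local_rep m f f'"
  using levels_mono[of 0 0 n m k] indep_subset[of f' "- levels k 0 n" "- levels k 0 m"]
  by (simp add: local_rep_def)

lemma local_fun_rep:
  assumes "local_fun k f" shows "\<exists>n f'. local_rep n f f'"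
proof -
  obtain A where A: "finite A" "A \<subseteq> tree_vertices k"
    and A': "\<forall>\<tau>\<in>configs k. \<forall>\<eta>\<in>configs k. (\<forall>x\<in>A. \<tau> x = \<eta> x) \<longrightarrow> f \<tau> = f \<eta>"
    using assms unfolding local_fun_def by blast
  have f: "f \<tau> = f \<eta>" if "\<tau> \<in> configs k" "\<eta> \<in> configs k" "\<And>x. x \<in> A \<Longrightarrow> \<tau> x = \<eta> x" for \<tau> \<eta>
    using A' that by blast
  define n where "n = Suc (Max (insert 0 (length ` A)))"
  have "length x < n" if "x \<in> A" for x
    unfolding n_def less_Suc_eq_le using A that by (intro Max_ge) auto
  then have An: "A \<subseteq> levels k 0 n" using A by (auto simp: levels_def)
  define g where "g \<tau> = (\<lambda>x. if x \<in> tree_vertices k then x \<in> A \<and> \<tau> x else undefined)" for \<tau> :: config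
  have g: "g \<tau> \<in> configs k" for \<tau> by (auto simp: g_def configs_def PiE_def extensional_def)
  have "indep (\<lambda>\<tau>. f (g \<tau>)) (- levels k 0 n)"
    unfolding indep_def
  proof (intro allI impI)
    fix \<tau> \<eta> :: config assume *: "\<forall>x. x \<notin> - levels k 0 n \<longrightarrow> \<tau> x = \<eta> x"
    show "f (g \<tau>) = f (g \<eta>)" by (rule f[OF g g]) (use * An in \<open>auto simp: g_def\<close>)
  qed
  moreover have "f \<tau> = f (g \<tau>)" if "\<tau> \<in> configs k" for \<tau>
    by (rule f[OF that g]) (use A in \<open>auto simp: g_def\<close>)
  ultimately show ?thesis unfolding local_rep_def by blast
qed

lemma local_rep_local: "local_rep n f f' \<Longrightarrow> local_fun k f"
proof -
  assume rep: "local_rep n f f'"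
  have "f \<tau> = f \<eta>" if "\<tau> \<in> configs k" "\<eta> \<in> configs k" "\<forall>x\<in>levels k 0 n. \<tau> x = \<eta> x" for \<tau> \<eta>
  proof -
    have "f' \<tau> = f' \<eta>" using rep that(3) by (intro indepD[of f' "- levels k 0 n"]) (auto simp: local_rep_def)
    then show ?thesis using rep that by (simp add: local_rep_def)
  qed
  then show ?thesis
    unfolding local_fun_def
    by (intro exI[of _ "levels k 0 n"] conjI ballI impI finite_levels levels_subset_tree) blast
qed

lemma local_rep_integral:
  assumes "local_rep n f f'" "n \<le> N"
  shows "(\<integral>\<tau>. f \<tau> \<partial>M) = avg (levels k 0 N) f' \<sigma>"
proof -
  have rep: "local_rep N f f'" by (rule local_rep_mono[OF assms])
  have "(\<integral>\<tau>. f \<tau> \<partial>M) = (\<integral>\<tau>. f' \<tau> \<partial>M)"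
    using rep by (intro Bochner_Integration.integral_cong) (auto simp: space_M local_rep_def)
  also have "\<dots> = avg (levels k 0 N) f' \<sigma>"
    using rep levels_subset_tree by (intro integral_cylinder) (auto simp: local_rep_def)
  finally show ?thesis .
qed

lemma local_rep_comp2:
  "local_rep n f f' \<Longrightarrow> local_rep n g g' \<Longrightarrow> local_rep n (\<lambda>\<tau>. h (f \<tau>) (g \<tau>)) (\<lambda>\<tau>. h (f' \<tau>) (g' \<tau>))"
  unfolding local_rep_def using indep_comp2[of f' "- levels k 0 n" g' h] by auto

lemma local_rep_in_L2:
  assumes "local_rep n f f'" shows "in_L2 M f"
proof -
  have f': "f' \<in> borel_measurable M" "integrable M (\<lambda>\<tau>. (f' \<tau>)\<^sup>2)"
    using assms levels_subset_tree indep_comp[of f' "- levels k 0 n" "\<lambda>t. t\<^sup>2"]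
    by (auto simp: local_rep_def intro!: measurable_cylinder[of "levels k 0 n"] integrable_cylinder[of "levels k 0 n"])
  have eq: "f \<tau> = f' \<tau>" if "\<tau> \<in> space M" for \<tau> using assms that by (simp add: space_M local_rep_def)
  show ?thesis
    unfolding in_L2_def using f' eq
    by (simp cong: measurable_cong Bochner_Integration.integrable_cong)
qed

definition gen_rep :: "nat \<Rightarrow> (config \<Rightarrow> real) \<Rightarrow> config \<Rightarrow> real" where
  "gen_rep n f \<tau> = (\<Sum>x\<in>levels k 0 n. constraint k x \<tau> * (avg1 x f \<tau> - f \<tau>))"

lemma configs_upd: "\<tau> \<in> configs k \<Longrightarrow> x \<in> tree_vertices k \<Longrightarrow> \<tau>(x := b) \<in> configs k"
  by (auto simp: configs_def PiE_def extensional_def)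

lemma indep_constraint: "indep (constraint k x) (- children k x)"
  unfolding indep_def constraint_def by auto

lemma local_rep_generator:
  assumes rep: "local_rep n f f'"
  shows "local_rep (Suc n) (local_generator k p f) (gen_rep n f')"
proof -
  have "local_generator k p f \<tau> = gen_rep n f' \<tau>" if \<tau>: "\<tau> \<in> configs k" for \<tau>
  proof -
    have f: "f \<tau> = f' \<tau>" using rep \<tau> by (simp add: local_rep_def)
    have af: "avg1 x f \<tau> = avg1 x f' \<tau>" if "x \<in> tree_vertices k" for x
      using rep configs_upd[OF \<tau> that] by (simp add: avg1_eq local_rep_def)
    have "local_generator k p f \<tau> = (\<Sum>\<^sub>\<infinity>x\<in>levels k 0 n. constraint k x \<tau> * (avg1 x f' \<tau> - f' \<tau>))"
      unfolding local_generator_def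
    proof (rule infsum_cong_neutral)
      fix x assume x: "x \<in> tree_vertices k - levels k 0 n"
      then have "avg1 x f' = f'"
        using rep by (intro avg1_indep, intro indep_subset[of f' "- levels k 0 n" "{x}"]) (auto simp: local_rep_def)
      then show "constraint k x \<tau> * (avg1 x f \<tau> - f \<tau>) = 0" using x af f by simp
    qed (use levels_subset_tree af f in auto)
    then show ?thesis by (simp add: gen_rep_def)
  qed
  moreover have "indep (gen_rep n f') (- levels k 0 (Suc n))"
    unfolding indep_def
  proof (intro allI impI)
    fix \<tau> \<eta> :: config assume *: "\<forall>x. x \<notin> - levels k 0 (Suc n) \<longrightarrow> \<tau> x = \<eta> x"
    then have eq: "\<tau> x = \<eta> x" if "x \<in> levels k 0 (Suc n)" for x using that by blast
    have "constraint k x \<tau> * (avg1 x f' \<tau> - f' \<tau>) = constraint k x \<eta> * (avg1 x f' \<eta> - f' \<eta>)"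
      if x: "x \<in> levels k 0 n" for x
    proof -
      have "children k x \<subseteq> levels k 0 (Suc n)"
        using levelsD[OF x] by (auto simp: levels_def length_child child_in_tree)
      then have "constraint k x \<tau> = constraint k x \<eta>"
        using eq by (intro indepD[OF indep_constraint]) auto
      moreover have f': "f' \<zeta> = f' \<xi>" if "\<And>x. x \<in> levels k 0 n \<Longrightarrow> \<zeta> x = \<xi> x" for \<zeta> \<xi>
        using rep that by (intro indepD[of f' "- levels k 0 n"]) (auto simp: local_rep_def)
      have eqn: "\<tau> z = \<eta> z" if "z \<in> levels k 0 n" for z
        using eq levels_mono[of 0 0 n "Suc n" k] that by auto
      have "f' \<tau> = f' \<eta>" "f' (\<tau>(x := b)) = f' (\<eta>(x := b))" for b
        by (intro f'; use eqn in simp)+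
      then have "f' \<tau> = f' \<eta>" "avg1 x f' \<tau> = avg1 x f' \<eta>" by (simp_all add: avg1_eq)
      ultimately show ?thesis by simp
    qed
    then show "gen_rep n f' \<tau> = gen_rep n f' \<eta>" by (simp add: gen_rep_def)
  qed
  ultimately show ?thesis by (simp add: local_rep_def)
qed

text \<open>The bilinear form of the generator. The constraint at \<open>x\<close> does not involve the variable at \<open>x\<close>, so
  averaging over that variable turns each summand into the symmetric expression in the gradients.
  The surplus level in \<open>N\<close> contains the sites on which the constraints depend.\<close>

lemma generator_form:
  assumes f: "local_rep n f f'" and h: "local_rep n h h'" and N: "n < N"
  shows "(\<integral>\<tau>. h \<tau> * local_generator k p f \<tau> \<partial>M) =
    - (\<Sum>x\<in>levels k 0 n. avg (levels k 0 N) (\<lambda>\<tau>. constraint k x \<tau> * (p * (1 - p) * (grad x h' \<tau> * grad x f' \<tau>))) \<sigma>)"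
proof -
  let ?R = "levels k 0 N"
  have "local_rep (Suc n) (\<lambda>\<tau>. h \<tau> * local_generator k p f \<tau>) (\<lambda>\<tau>. h' \<tau> * gen_rep n f' \<tau>)"
    by (rule local_rep_comp2[OF local_rep_mono[OF h] local_rep_generator[OF f], where h = "(*)"]) simp
  then have "(\<integral>\<tau>. h \<tau> * local_generator k p f \<tau> \<partial>M) = avg ?R (\<lambda>\<tau>. h' \<tau> * gen_rep n f' \<tau>) \<sigma>"
    by (rule local_rep_integral) (use N in simp)
  also have "(\<lambda>\<tau>. h' \<tau> * gen_rep n f' \<tau>) =
      (\<lambda>\<tau>. \<Sum>x\<in>levels k 0 n. h' \<tau> * (constraint k x \<tau> * (avg1 x f' \<tau> - f' \<tau>)))"
    by (simp add: gen_rep_def sum_distrib_left)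
  also have "avg ?R \<dots> \<sigma> = (\<Sum>x\<in>levels k 0 n. avg ?R (\<lambda>\<tau>. h' \<tau> * (constraint k x \<tau> * (avg1 x f' \<tau> - f' \<tau>))) \<sigma>)"
    by (simp add: avg_sum)
  also have "\<dots> = (\<Sum>x\<in>levels k 0 n. avg ?R (\<lambda>\<tau>. (-1) * (constraint k x \<tau> * (p * (1 - p) * (grad x h' \<tau> * grad x f' \<tau>)))) \<sigma>)"
  proof (rule sum.cong[OF refl])
    fix x assume x: "x \<in> levels k 0 n"
    let ?u = "\<lambda>\<tau>. h' \<tau> * (constraint k x \<tau> * (avg1 x f' \<tau> - f' \<tau>))"
    let ?w = "\<lambda>\<tau>. (-1) * (constraint k x \<tau> * (p * (1 - p) * (grad x h' \<tau> * grad x f' \<tau>)))"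
    have xR: "x \<in> ?R" using levels_mono[of 0 0 n N k] x N by auto
    have c: "constraint k x (\<tau>(x := b)) = constraint k x \<tau>" for \<tau> b
      by (rule indep_upd[OF indep_constraint]) (auto dest: length_child)
    have "avg1 x ?u = avg1 x ?w"
      by (rule ext) (simp add: avg1_eq c grad_def algebra_simps)
    then show "avg ?R ?u \<sigma> = avg ?R ?w \<sigma>"
      using avg_avg1_absorb[of ?R x ?u] avg_avg1_absorb[of ?R x ?w] xR by simp
  qed
  also have "\<dots> = - (\<Sum>x\<in>levels k 0 n. avg ?R (\<lambda>\<tau>. constraint k x \<tau> * (p * (1 - p) * (grad x h' \<tau> * grad x f' \<tau>))) \<sigma>)"
    by (simp only: avg_cmult[OF finite_levels] sum_distrib_left[symmetric])
  finally show ?thesis .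
qed

lemma local_generator_symmetric:
  assumes "local_fun k f" "local_fun k h"
  shows "(\<integral>\<tau>. h \<tau> * local_generator k p f \<tau> \<partial>M) = (\<integral>\<tau>. local_generator k p h \<tau> * f \<tau> \<partial>M)"
proof -
  obtain n f' m h' where "local_rep n f f'" "local_rep m h h'"
    using local_fun_rep assms by metis
  then have rep: "local_rep (max n m) f f'" "local_rep (max n m) h h'"
    by (auto elim!: local_rep_mono)
  show ?thesis
    using generator_form[OF rep, of "Suc (max n m)" undefined] generator_form[OF rep(2,1), of "Suc (max n m)" undefined]
    by (simp add: mult.commute[of "local_generator k p h _"] mult.commute[of "grad _ f' _"])
qed

lemma local_fun_in_L2:
  shows "local_fun k f \<Longrightarrow> in_L2 M f" and "local_fun k f \<Longrightarrow> in_L2 M (local_generator k p f)"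
proof -
  assume "local_fun k f"
  then obtain n f' where "local_rep n f f'" using local_fun_rep by blast
  then show "in_L2 M f" "in_L2 M (local_generator k p f)"
    using local_rep_in_L2 local_rep_generator by blast+
qed

lemma generator_graph_local:
  assumes "local_fun k f" shows "generator_graph k p f (local_generator k p f)"
  unfolding generator_graph_def
  by (intro conjI local_fun_in_L2 assms exI[of _ "\<lambda>_. f"] allI) (simp_all add: tendsto_L2_def)

lemma generator_graph_generator: "f \<in> generator_dom k p \<Longrightarrow> generator_graph k p f (generator k p f)"
  unfolding generator_dom_def generator_def by (simp add: someI_ex)

text \<open>The chosen value \<open>generator k p f\<close> is a limit of the generator along some sequence of local functions that
  tends to \<open>f\<close>. Testing it against \<open>f\<close> itself and using symmetry identifies the inner product
  whatever the sequence is.\<close>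

lemma dirichlet_form_local:
  assumes "local_fun k f"
  shows "dirichlet_form k p f = - (\<integral>\<tau>. f \<tau> * local_generator k p f \<tau> \<partial>M)"
proof -
  have "f \<in> generator_dom k p" using generator_graph_local[OF assms] unfolding generator_dom_def by blast
  then have "generator_graph k p f (generator k p f)" by (rule generator_graph_generator)
  then obtain F where F: "\<And>n. local_fun k (F n)" "tendsto_L2 M F f"
      "tendsto_L2 M (\<lambda>n. local_generator k p (F n)) (generator k p f)"
    and L2: "in_L2 M f" "in_L2 M (generator k p f)"
    by (auto simp: generator_graph_def)
  \<comment> \<open>The inner products of \<open>f\<close> with the approximating images have two expressions, related by
    symmetry; their limits identify the inner product with \<open>generator k p f\<close>.\<close>
  have const: "tendsto_L2 M (\<lambda>_. g) g" for g by (simp add: tendsto_L2_def)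
  have "(\<lambda>n. \<integral>\<tau>. f \<tau> * local_generator k p (F n) \<tau> \<partial>M) \<longlonglongrightarrow> (\<integral>\<tau>. f \<tau> * generator k p f \<tau> \<partial>M)"
    by (rule tendsto_L2_inner[OF L2(1) L2(1) const local_fun_in_L2(2)[OF F(1)] L2(2) F(3)])
  moreover have "(\<lambda>n. \<integral>\<tau>. local_generator k p f \<tau> * F n \<tau> \<partial>M) \<longlonglongrightarrow> (\<integral>\<tau>. local_generator k p f \<tau> * f \<tau> \<partial>M)"
    using local_fun_in_L2[OF assms]
    by (intro tendsto_L2_inner const F(2) local_fun_in_L2(1)[OF F(1)])
  ultimately have "(\<integral>\<tau>. f \<tau> * generator k p f \<tau> \<partial>M) = (\<integral>\<tau>. local_generator k p f \<tau> * f \<tau> \<partial>M)"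
    using local_generator_symmetric[OF F(1) assms] by (intro LIMSEQ_unique) auto
  then show ?thesis by (simp add: dirichlet_form_def mult.commute)
qed

section \<open>Variational bounds for the spectral gap\<close>

lemma variance_eq_L2:
  assumes "in_L2 M f" shows "M.variance f = (\<integral>\<tau>. (f \<tau>)\<^sup>2 \<partial>M) - (\<integral>\<tau>. f \<tau> \<partial>M)\<^sup>2"
proof -
  have f: "f \<in> borel_measurable M" "integrable M (\<lambda>\<tau>. (f \<tau>)\<^sup>2)" using assms by (auto simp: in_L2_def)
  show ?thesis by (rule M.variance_eq[OF M.square_integrable_imp_integrable[OF f] f(2)])
qed

lemma variance_limit:
  assumes "\<And>n. in_L2 M (F n)" "in_L2 M f" "tendsto_L2 M F f"
  shows "(\<lambda>n. M.variance (F n)) \<longlonglongrightarrow> M.variance f"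
proof -
  have var: "M.variance g = (\<integral>\<tau>. g \<tau> * g \<tau> \<partial>M) - (\<integral>\<tau>. g \<tau> * 1 \<partial>M)\<^sup>2" if "in_L2 M g" for g
  proof -
    have "M.variance g = (\<integral>\<tau>. (g \<tau>)\<^sup>2 \<partial>M) - (\<integral>\<tau>. g \<tau> \<partial>M)\<^sup>2"
      by (rule variance_eq_L2[OF that])
    then show ?thesis by (simp add: power2_eq_square)
  qed
  have one: "in_L2 M (\<lambda>_. 1)" "tendsto_L2 M (\<lambda>_ _. 1) (\<lambda>_. 1)" by (simp_all add: in_L2_def tendsto_L2_def)
  show ?thesis
    unfolding var[OF assms(1)] var[OF assms(2)]
    by (intro tendsto_intros tendsto_L2_inner assms one)
qed

lemma variance_local:
  assumes "local_rep n f f'" "n \<le> N"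
  shows "M.variance f = Var (levels k 0 N) f' \<sigma>"
proof -
  have L2: "in_L2 M f" by (rule local_rep_in_L2[OF assms(1)])
  have sq: "local_rep n (\<lambda>\<tau>. (f \<tau>)\<^sup>2) (\<lambda>\<tau>. (f' \<tau>)\<^sup>2)"
    using local_rep_comp2[OF assms(1) assms(1), of "\<lambda>s t. s\<^sup>2"] .
  show ?thesis
  proof -
    have "M.variance f = (\<integral>\<tau>. (f \<tau>)\<^sup>2 \<partial>M) - (\<integral>\<tau>. f \<tau> \<partial>M)\<^sup>2"
      by (rule variance_eq_L2[OF L2])
    then show ?thesis
      unfolding Var_def local_rep_integral[OF sq assms(2), of \<sigma>] local_rep_integral[OF assms, of \<sigma>] .
  qed
qed

lemma variance_pos:
  assumes "in_L2 M f" "\<not> ae_const M f" shows "0 < M.variance f"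
proof -
  have int: "integrable M (\<lambda>\<tau>. (f \<tau> - M.expectation f)\<^sup>2)"
    using in_L2_diff[OF assms(1), of "\<lambda>_. M.expectation f"] by (simp add: in_L2_def)
  have "M.variance f \<noteq> 0"
  proof
    assume "M.variance f = 0"
    then have "AE \<tau> in M. (f \<tau> - M.expectation f)\<^sup>2 = 0"
      using integral_nonneg_eq_0_iff_AE[OF int] by simp
    then have "AE \<tau> in M. f \<tau> = M.expectation f" by simp
    then show False using assms(2) by (auto simp: ae_const_def)
  qed
  then show ?thesis using M.variance_positive[of f] by linarith
qed

lemma variance_ae_const:
  assumes "ae_const M f" "f \<in> borel_measurable M" shows "M.variance f = 0"
proof -
  obtain c where c: "AE \<tau> in M. f \<tau> = c" using assms(1) by (auto simp: ae_const_def)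
  have "M.expectation f = M.expectation (\<lambda>_. c)"
    using c assms(2) by (intro integral_cong_AE) auto
  then have "M.expectation f = c" using M.prob_space by simp
  moreover have "M.expectation (\<lambda>\<tau>. (f \<tau> - c)\<^sup>2) = M.expectation (\<lambda>_. 0)"
    using c assms(2) by (intro integral_cong_AE) auto
  ultimately show ?thesis by simp
qed

text \<open>A Poincare inequality on the core extends to the domain of the closed generator.\<close>

lemma spectral_gap_ge:
  assumes C: "0 < C"
    and local: "\<And>f. local_fun k f \<Longrightarrow> M.variance f \<le> C * - (\<integral>\<tau>. f \<tau> * local_generator k p f \<tau> \<partial>M)"
  shows "ereal (1 / C) \<le> spectral_gap k p"
  unfolding spectral_gap_def
proof (rule INF_greatest)
  fix f assume f: "f \<in> {f \<in> generator_dom k p. \<not> ae_const M f}"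
  then have "generator_graph k p f (generator k p f)" using generator_graph_generator by blast
  then obtain F where F: "\<And>n. local_fun k (F n)" "tendsto_L2 M F f"
      "tendsto_L2 M (\<lambda>n. local_generator k p (F n)) (generator k p f)"
    and L2: "in_L2 M f" "in_L2 M (generator k p f)"
    by (auto simp: generator_graph_def)
  have "(\<lambda>n. \<integral>\<tau>. F n \<tau> * local_generator k p (F n) \<tau> \<partial>M) \<longlonglongrightarrow> (\<integral>\<tau>. f \<tau> * generator k p f \<tau> \<partial>M)"
    using local_fun_in_L2[OF F(1)] by (intro tendsto_L2_inner F L2)
  then have "(\<lambda>n. C * - (\<integral>\<tau>. F n \<tau> * local_generator k p (F n) \<tau> \<partial>M)) \<longlonglongrightarrow> C * dirichlet_form k p f"
    unfolding dirichlet_form_def by (intro tendsto_intros) (simp add: tendsto_minus)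
  moreover have "(\<lambda>n. M.variance (F n)) \<longlonglongrightarrow> M.variance f"
    using local_fun_in_L2(1)[OF F(1)] by (intro variance_limit L2 F)
  ultimately have "M.variance f \<le> C * dirichlet_form k p f"
    using local[OF F(1)] by (intro LIMSEQ_le[of "\<lambda>n. M.variance (F n)" _ "\<lambda>n. C * - (\<integral>\<tau>. F n \<tau> * local_generator k p (F n) \<tau> \<partial>M)"]) auto
  moreover have "0 < M.variance f" using f L2 by (intro variance_pos) auto
  ultimately show "ereal (1 / C) \<le> ereal (dirichlet_form k p f / M.variance f)"
    using C by (simp add: field_simps)
qed

lemma spectral_gap_le:
  assumes f: "local_fun k f" and var: "0 < M.variance f"
    and D: "- (\<integral>\<tau>. f \<tau> * local_generator k p f \<tau> \<partial>M) \<le> g * M.variance f"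
  shows "spectral_gap k p \<le> ereal g"
proof -
  have "f \<in> generator_dom k p" using generator_graph_local[OF f] unfolding generator_dom_def by blast
  moreover have "\<not> ae_const M f" using var variance_ae_const local_fun_in_L2(1)[OF f] by (auto simp: in_L2_def)
  ultimately have "spectral_gap k p \<le> ereal (dirichlet_form k p f / M.variance f)"
    unfolding spectral_gap_def by (intro INF_lower) auto
  also have "\<dots> \<le> ereal g"
    using D var by (simp only: dirichlet_form_local[OF f] ereal_less_eq pos_divide_le_eq)
  finally show ?thesis .
qed

end

section \<open>The cluster martingale\<close>

lemma card_level: "card (levels k n (Suc n)) = k ^ n"
proof -
  have "levels k n (Suc n) = {xs. set xs \<subseteq> {..<k} \<and> length xs = n}"
    by (auto simp: levels_def tree_vertices_def)
  then show ?thesis using card_lists_length_eq[of "{..<k}" n] by simp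
qed

context bernoulli_tree_sites
begin

definition ancestors_one :: "nat list \<Rightarrow> config \<Rightarrow> real" where
  "ancestors_one y \<sigma> = (\<Prod>i<length y. of_bool (\<sigma> (take i y)))"

definition centred :: "nat list \<Rightarrow> config \<Rightarrow> real" where
  "centred y \<sigma> = of_bool (\<sigma> y) - p"

text \<open>Up to a boundary term on the last level this is \<open>1 - k p\<close> times the centred size of the cluster of
  ones of the root, written as a sum of martingale differences.\<close>

definition cluster_martingale :: "nat \<Rightarrow> config \<Rightarrow> real" where
  "cluster_martingale n \<sigma> = (\<Sum>y\<in>levels k 0 (Suc n). ancestors_one y \<sigma> * centred y \<sigma>)"

lemma ancestors_one_cong:
  "(\<And>i. i < length y \<Longrightarrow> \<sigma> (take i y) = \<tau> (take i y)) \<Longrightarrow> ancestors_one y \<sigma> = ancestors_one y \<tau>"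
  unfolding ancestors_one_def by (intro prod.cong) auto

lemma ancestors_one_upd:
  assumes "\<And>i. i < length y \<Longrightarrow> take i y \<noteq> x"
  shows "ancestors_one y (\<sigma>(x := b)) = ancestors_one y \<sigma>"
  by (rule ancestors_one_cong) (simp add: assms)

lemma ancestors_one_upd_long:
  assumes "length y \<le> length x" shows "ancestors_one y (\<sigma>(x := b)) = ancestors_one y \<sigma>"
  by (rule ancestors_one_upd) (use assms in auto)

lemma ancestors_one_cases: "ancestors_one y \<sigma> = 0 \<or> ancestors_one y \<sigma> = 1"
proof (cases "\<forall>i<length y. \<sigma> (take i y)")
  case True
  then show ?thesis by (simp add: ancestors_one_def)
next
  case False
  then obtain i where "i < length y" "\<not> \<sigma> (take i y)" by auto
  then have "ancestors_one y \<sigma> = 0" unfolding ancestors_one_def by (intro prod_zero) auto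
  then show ?thesis ..
qed

lemma centred_upd: "x \<noteq> y \<Longrightarrow> centred y (\<sigma>(x := b)) = centred y \<sigma>"
  by (simp add: centred_def)

lemma avg_ancestors_one:
  assumes "y \<in> tree_vertices k" "length y \<le> N"
  shows "avg (levels k 0 N) (ancestors_one y) \<sigma> = p ^ length y"
proof -
  let ?R = "levels k 0 N" and ?I = "{..<length y}"
  let ?A = "\<lambda>i. {take i y}"
  have sub: "(\<Union>i\<in>?I. ?A i) \<subseteq> ?R"
    using assms set_take_subset by (fastforce simp: levels_def tree_vertices_def)
  have "avg (\<Union>i\<in>?I. ?A i) (\<lambda>\<eta>. \<Prod>i\<in>?I. of_bool (\<eta> (take i y))) \<tau>
      = (\<Prod>i\<in>?I. avg (?A i) (\<lambda>\<eta>. of_bool (\<eta> (take i y))) \<tau>)" for \<tau>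
  proof (rule avg_prod)
    fix i j assume "i \<in> ?I" "j \<in> ?I" "i \<noteq> j"
    then have "length (take i y) = i" "length (take j y) = j" by auto
    then have "take i y \<noteq> take j y" using \<open>i \<noteq> j\<close> by metis
    then show "?A i \<inter> ?A j = {}" by simp
  qed (auto simp: indep_def)
  then have "avg (\<Union>i\<in>?I. ?A i) (ancestors_one y) = (\<lambda>\<tau>. p ^ length y)"
    by (simp add: ancestors_one_def[abs_def] avg1_eq fun_eq_iff)
  then show ?thesis
    using fun_cong[OF avg_absorb[OF finite_levels sub, of "ancestors_one y"], of \<sigma>] by simp
qed

lemma indep_cluster_martingale: "indep (cluster_martingale n) (- levels k 0 (Suc n))"
  unfolding indep_def
proof (intro allI impI)
  fix \<tau> \<eta> :: config assume *: "\<forall>x. x \<notin> - levels k 0 (Suc n) \<longrightarrow> \<tau> x = \<eta> x"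
  have "ancestors_one y \<tau> * centred y \<tau> = ancestors_one y \<eta> * centred y \<eta>" if y: "y \<in> levels k 0 (Suc n)" for y
  proof -
    have "take i y \<in> levels k 0 (Suc n)" for i
      using y set_take_subset[of i y] by (auto simp: levels_def tree_vertices_def)
    then have "ancestors_one y \<tau> = ancestors_one y \<eta>" using * by (intro ancestors_one_cong) auto
    then show ?thesis using * y by (simp add: centred_def)
  qed
  then show "cluster_martingale n \<tau> = cluster_martingale n \<eta>" by (simp add: cluster_martingale_def)
qed

text \<open>The summands at two vertices are orthogonal: neither the other summand nor the ancestors'
  indicator involves the variable of the vertex that lies deeper.\<close>

lemma Var_cluster_martingale:
  "Var (levels k 0 (Suc n)) (cluster_martingale n) \<sigma> = p * (1 - p) * (\<Sum>y\<in>levels k 0 (Suc n). p ^ length y)"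
proof -
  let ?R = "levels k 0 (Suc n)"
  let ?d = "\<lambda>y \<eta>. ancestors_one y \<eta> * centred y \<eta>"
  have mean: "avg ?R (?d y) \<sigma> = 0" if y: "y \<in> ?R" for y
  proof -
    have "avg1 y (?d y) = (\<lambda>_. 0)"
      by (rule ext) (simp add: avg1_eq ancestors_one_upd_long centred_def algebra_simps)
    then show ?thesis using fun_cong[OF avg_avg1_absorb[OF finite_levels y, of "?d y"], of \<sigma>] by simp
  qed
  have cov0: "avg ?R (\<lambda>\<eta>. ?d y \<eta> * ?d z \<eta>) \<sigma> = 0" if "y \<in> ?R" "z \<in> ?R" "y \<noteq> z" "length y \<le> length z" for y z
  proof -
    have "avg1 z (\<lambda>\<eta>. ?d y \<eta> * ?d z \<eta>) = (\<lambda>_. 0)"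
    proof
      fix \<tau>
      have "centred y (\<tau>(z := b)) = centred y \<tau>" for b using that(3) by (intro centred_upd) simp
      then show "avg1 z (\<lambda>\<eta>. ?d y \<eta> * ?d z \<eta>) \<tau> = 0"
        using that(4) by (simp add: avg1_eq ancestors_one_upd_long centred_def algebra_simps)
    qed
    then show ?thesis using fun_cong[OF avg_avg1_absorb[OF finite_levels that(2), of "\<lambda>\<eta>. ?d y \<eta> * ?d z \<eta>"], of \<sigma>] by simp
  qed
  have cov: "avg ?R (\<lambda>\<eta>. ?d y \<eta> * ?d z \<eta>) \<sigma> = (if z = y then p * (1 - p) * p ^ length y else 0)"
    if y: "y \<in> ?R" and z: "z \<in> ?R" for y z
  proof (cases "z = y")
    case True
    have "avg1 y (\<lambda>\<eta>. ?d y \<eta> * ?d y \<eta>) = (\<lambda>\<eta>. p * (1 - p) * ancestors_one y \<eta>)"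
    proof
      fix \<tau>
      show "avg1 y (\<lambda>\<eta>. ?d y \<eta> * ?d y \<eta>) \<tau> = p * (1 - p) * ancestors_one y \<tau>"
        using ancestors_one_cases[of y \<tau>]
        by (auto simp: avg1_eq ancestors_one_upd_long centred_def algebra_simps)
    qed
    then have "avg ?R (\<lambda>\<eta>. ?d y \<eta> * ?d y \<eta>) \<sigma> = avg ?R (\<lambda>\<eta>. p * (1 - p) * ancestors_one y \<eta>) \<sigma>"
      using fun_cong[OF avg_avg1_absorb[OF finite_levels y, of "\<lambda>\<eta>. ?d y \<eta> * ?d y \<eta>"], of \<sigma>] by simp
    also have "\<dots> = p * (1 - p) * p ^ length y"
      using levelsD[OF y] by (simp only: avg_cmult[OF finite_levels]) (simp add: avg_ancestors_one)
    finally show ?thesis using True by simp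
  next
    case False
    then show ?thesis
      using cov0[OF y z] cov0[OF z y] by (cases "length y \<le> length z") (simp_all add: mult.commute)
  qed
  have "avg ?R (cluster_martingale n) \<sigma> = 0"
    unfolding cluster_martingale_def[abs_def] by (simp add: avg_sum mean)
  moreover have "avg ?R (\<lambda>\<eta>. (cluster_martingale n \<eta>)\<^sup>2) \<sigma> = (\<Sum>y\<in>?R. \<Sum>z\<in>?R. avg ?R (\<lambda>\<eta>. ?d y \<eta> * ?d z \<eta>) \<sigma>)"
    unfolding cluster_martingale_def power2_eq_square sum_product by (simp only: avg_sum[OF finite_levels])
  ultimately have "Var ?R (cluster_martingale n) \<sigma> = (\<Sum>y\<in>?R. \<Sum>z\<in>?R. if z = y then p * (1 - p) * p ^ length y else 0)"
    by (simp add: Var_def cov)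
  then show ?thesis by (simp add: sum_distrib_left)
qed

text \<open>When the children of \<open>x\<close> are zero, the variable at \<open>x\<close> enters the summand at \<open>x\<close> itself and, through
  the ancestors' indicator, the summands at the children of \<open>x\<close>. Each of these contributes \<open>- p\<close>. Deeper
  summands vanish. Vertices of level \<open>n\<close> have no children in the sum.\<close>

lemma grad_cluster_martingale:
  assumes x: "x \<in> levels k 0 (Suc n)" and free: "\<And>z. z \<in> children k x \<Longrightarrow> \<not> \<sigma> z"
  shows "grad x (cluster_martingale n) \<sigma> = (if length x < n then 1 - real k * p else 1) * ancestors_one x \<sigma>"
proof -
  let ?R = "levels k 0 (Suc n)"
  let ?d = "\<lambda>y \<eta>. ancestors_one y \<eta> * centred y \<eta>"
  let ?a = "ancestors_one x \<sigma>"
  have lx: "length x \<le> n" "x \<in> tree_vertices k" using levelsD[OF x] by auto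
  have child_ne: "x \<notin> children k x" by (auto dest: length_child)
  have summand: "?d y (\<sigma>(x := True)) - ?d y (\<sigma>(x := False)) = (if y = x then ?a else 0) + (if y \<in> children k x then - p * ?a else 0)"
    if y: "y \<in> ?R" for y
  proof (cases "\<exists>i<length y. take i y = x")
    case False
    then have "ancestors_one y (\<sigma>(x := b)) = ancestors_one y \<sigma>" for b by (intro ancestors_one_upd) auto
    moreover have "y \<notin> children k x"
    proof
      assume c: "y \<in> children k x"
      have "length x < length y" using length_child[OF c] by simp
      then show False using False take_child[OF c] by blast
    qed
    ultimately show ?thesis by (cases "y = x") (simp_all add: centred_def algebra_simps)
  next
    case True
    then obtain i where i: "i < length y" "take i y = x" by auto
    then have ix: "i = length x" by auto
    have neq: "y \<noteq> x" using i(1) ix by auto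
    show ?thesis
    proof (cases "length y = Suc (length x)")
      case len: True
      have "y = x @ [y ! i]" using take_Suc_conv_app_nth[OF i(1)] i len ix by simp
      moreover have "y ! i < k" using levelsD[OF y] i(1) by (auto simp: tree_vertices_def dest: nth_mem)
      ultimately have c: "y \<in> children k x" by (auto simp: children_def)
      have "ancestors_one y (\<sigma>(x := b)) = ?a * of_bool b" for b
      proof -
        have "take j y = take j x" if "j < length x" for j
          using that i(2) ix by (metis min.absorb1 less_imp_le take_take)
        then have "(\<Prod>j<length x. of_bool ((\<sigma>(x := b)) (take j y)) :: real) = (\<Prod>j<length x. of_bool (\<sigma> (take j x)))"
          by (intro prod.cong) auto
        then show ?thesis using i ix by (simp add: ancestors_one_def len)
      qed
      moreover have "centred y (\<sigma>(x := b)) = - p" for b using free[OF c] neq by (simp add: centred_def)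
      ultimately show ?thesis using c neq by simp
    next
      case False
      then have len: "Suc i < length y" using i(1) ix by simp
      have nc: "y \<notin> children k x" using False by (auto dest: length_child)
      have "take (Suc i) y = x @ [y ! i]" using take_Suc_conv_app_nth[OF i(1)] i by simp
      moreover have "y ! i < k" using levelsD[OF y] i(1) by (auto simp: tree_vertices_def dest: nth_mem)
      ultimately have c: "take (Suc i) y \<in> children k x" by (auto simp: children_def)
      have "ancestors_one y (\<sigma>(x := b)) = 0" for b
        unfolding ancestors_one_def
      proof (rule prod_zero)
        have "take (Suc i) y \<noteq> x" using c child_ne by auto
        then show "\<exists>j\<in>{..<length y}. of_bool ((\<sigma>(x := b)) (take j y)) = (0 :: real)"
          using len free[OF c] by (intro bexI[of _ "Suc i"]) auto
      qed simp
      then show ?thesis using nc neq by simp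
    qed
  qed
  have "grad x (cluster_martingale n) \<sigma> = (\<Sum>y\<in>?R. ?d y (\<sigma>(x := True)) - ?d y (\<sigma>(x := False)))"
    by (simp add: grad_def cluster_martingale_def sum_subtractf)
  also have "\<dots> = (\<Sum>y\<in>?R. (if y = x then ?a else 0) + (if y \<in> children k x then - p * ?a else 0))"
    by (rule sum.cong[OF refl summand])
  also have "\<dots> = ?a + (\<Sum>y\<in>?R. if y \<in> children k x then - p * ?a else 0)"
    using x by (simp add: sum.distrib)
  also have "(\<Sum>y\<in>?R. if y \<in> children k x then - p * ?a else 0) = (\<Sum>y\<in>?R \<inter> children k x. - p * ?a)"
    by (rule sum.inter_restrict[symmetric]) simp
  also have "?R \<inter> children k x = (if length x < n then children k x else {})"
    using lx child_in_tree[OF lx(2)] by (auto simp: levels_def dest: length_child)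
  finally show ?thesis by (cases "length x < n") (simp_all add: card_children algebra_simps)
qed

end

context subcritical_tree
begin

text \<open>Vertices of level \<open>n\<close> lack the cancellation in \<open>grad_cluster_martingale\<close>. Their total weight is
  \<open>(k p) ^ n\<close>, which is below \<open>(1 - k p)\<^sup>2\<close> for large \<open>n\<close>; this costs the factor of two.\<close>

lemma spectral_gap_upper: "spectral_gap k p \<le> ereal (2 * (1 - real k * p)\<^sup>2)"
proof -
  define \<delta> where "\<delta> = 1 - real k * p"
  have \<delta>: "0 < \<delta>" using subcritical by (simp add: \<delta>_def)
  obtain n where n: "(real k * p) ^ n < \<delta>\<^sup>2"
    using real_arch_pow_inv[of "\<delta>\<^sup>2" "real k * p"] subcritical \<delta> by auto
  let ?f = "cluster_martingale n" and ?R = "levels k 0 (Suc n)" and ?R' = "levels k 0 (Suc (Suc n))"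
  define \<sigma> :: config where "\<sigma> = (\<lambda>_. True)"
  define S where "S = (\<Sum>y\<in>?R. p ^ length y)"
  have rep: "local_rep (Suc n) ?f ?f" by (simp add: local_rep_def indep_cluster_martingale)
  have S: "1 \<le> S" "(\<Sum>y\<in>levels k 0 n. p ^ length y) \<le> S"
  proof -
    have "(\<Sum>y\<in>{[] :: nat list}. p ^ length y) \<le> S"
      unfolding S_def using p_pos by (intro sum_mono2 finite_levels) (auto simp: levels_def tree_vertices_def)
    then show "1 \<le> S" by simp
    show "(\<Sum>y\<in>levels k 0 n. p ^ length y) \<le> S"
      unfolding S_def using p_pos by (intro sum_mono2 finite_levels levels_mono) auto
  qed
  have pq: "0 < p * (1 - p)" using p_pos p_less_1 by simp
  have var: "M.variance ?f = p * (1 - p) * S"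
    using variance_local[OF rep order_refl, of \<sigma>] by (simp add: Var_cluster_martingale S_def)
  have D: "- (\<integral>\<tau>. ?f \<tau> * local_generator k p ?f \<tau> \<partial>M) \<le> 2 * \<delta>\<^sup>2 * M.variance ?f"
  proof -
    let ?w = "\<lambda>x. if length x < n then \<delta> else 1"
    have "- (\<integral>\<tau>. ?f \<tau> * local_generator k p ?f \<tau> \<partial>M)
        = (\<Sum>x\<in>?R. avg ?R' (\<lambda>\<tau>. constraint k x \<tau> * (p * (1 - p) * (grad x ?f \<tau> * grad x ?f \<tau>))) \<sigma>)"
      using generator_form[OF rep rep, of "Suc (Suc n)" \<sigma>] by simp
    also have "\<dots> \<le> (\<Sum>x\<in>?R. p * (1 - p) * (?w x)\<^sup>2 * p ^ length x)"
    proof (rule sum_mono)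
      fix x assume x: "x \<in> ?R"
      have "avg ?R' (\<lambda>\<tau>. constraint k x \<tau> * (p * (1 - p) * (grad x ?f \<tau> * grad x ?f \<tau>))) \<sigma>
          \<le> avg ?R' (\<lambda>\<tau>. p * (1 - p) * (?w x)\<^sup>2 * ancestors_one x \<tau>) \<sigma>"
      proof (rule avg_mono[OF finite_levels])
        fix \<tau>
        show "constraint k x \<tau> * (p * (1 - p) * (grad x ?f \<tau> * grad x ?f \<tau>)) \<le> p * (1 - p) * (?w x)\<^sup>2 * ancestors_one x \<tau>"
        proof (cases "\<forall>z\<in>children k x. \<not> \<tau> z")
          case True
          then have "grad x ?f \<tau> = ?w x * ancestors_one x \<tau>"
            using grad_cluster_martingale[OF x, of \<tau>] by (simp add: \<delta>_def)
          then show ?thesis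
            using ancestors_one_cases[of x \<tau>] True by (auto simp: constraint_def power2_eq_square)
        next
          case False
          then show ?thesis using ancestors_one_cases[of x \<tau>] pq by (auto simp: constraint_def)
        qed
      qed
      also have "\<dots> = p * (1 - p) * (?w x)\<^sup>2 * p ^ length x"
        using levelsD[OF x] by (simp only: avg_cmult[OF finite_levels]) (simp add: avg_ancestors_one)
      finally show "avg ?R' (\<lambda>\<tau>. constraint k x \<tau> * (p * (1 - p) * (grad x ?f \<tau> * grad x ?f \<tau>))) \<sigma>
          \<le> p * (1 - p) * (?w x)\<^sup>2 * p ^ length x" .
    qed
    also have "\<dots> = p * (1 - p) * (\<Sum>x\<in>?R. (?w x)\<^sup>2 * p ^ length x)"
      by (simp only: sum_distrib_left mult.assoc)
    also have "\<dots> \<le> p * (1 - p) * (2 * \<delta>\<^sup>2 * S)"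
    proof (rule mult_left_mono)
      have "(\<Sum>x\<in>?R. (?w x)\<^sup>2 * p ^ length x)
          = (\<Sum>x\<in>levels k 0 n. (?w x)\<^sup>2 * p ^ length x) + (\<Sum>x\<in>levels k n (Suc n). (?w x)\<^sup>2 * p ^ length x)"
        by (subst levels_split[of 0 n "Suc n"], simp, simp, rule sum.union_disjoint) (simp_all add: levels_disjoint)
      also have "(\<Sum>x\<in>levels k 0 n. (?w x)\<^sup>2 * p ^ length x) = \<delta>\<^sup>2 * (\<Sum>x\<in>levels k 0 n. p ^ length x)"
        unfolding sum_distrib_left by (rule sum.cong) (auto dest: levelsD)
      also have "(\<Sum>x\<in>levels k n (Suc n). (?w x)\<^sup>2 * p ^ length x) = (\<Sum>x\<in>levels k n (Suc n). p ^ n)"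
      proof (rule sum.cong[OF refl])
        fix x assume "x \<in> levels k n (Suc n)"
        then have "length x = n" using levelsD by fastforce
        then show "(?w x)\<^sup>2 * p ^ length x = p ^ n" by simp
      qed
      also have "\<dots> = (real k * p) ^ n" by (simp add: card_level power_mult_distrib)
      also have "\<delta>\<^sup>2 * (\<Sum>x\<in>levels k 0 n. p ^ length x) + (real k * p) ^ n \<le> \<delta>\<^sup>2 * S + \<delta>\<^sup>2 * S"
      proof (rule add_mono)
        show "\<delta>\<^sup>2 * (\<Sum>x\<in>levels k 0 n. p ^ length x) \<le> \<delta>\<^sup>2 * S" using S(2) by (intro mult_left_mono) auto
        have "\<delta>\<^sup>2 * 1 \<le> \<delta>\<^sup>2 * S" using S(1) by (intro mult_left_mono) auto
        then show "(real k * p) ^ n \<le> \<delta>\<^sup>2 * S" using n by simp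
      qed
      finally show "(\<Sum>x\<in>?R. (?w x)\<^sup>2 * p ^ length x) \<le> 2 * \<delta>\<^sup>2 * S"
        by (simp add: mult_ac)
    qed (use pq in simp)
    finally show ?thesis by (simp add: var mult_ac)
  qed
  have "0 < M.variance ?f" unfolding var using pq S(1) by simp
  then show ?thesis
    using spectral_gap_le[OF local_rep_local[OF rep] _ D] by (simp add: \<delta>_def)
qed

end

section \<open>The relaxation time\<close>

text \<open>Constants of \<open>Poincare_depth_poly\<close>: \<open>2178\<close> levels at a factor of \<open>400\<close> each, and an exponent \<open>\<beta>\<close> with
  \<open>1 + \<beta> / 67 = 6\<close>.\<close>

definition depth_const :: real where "depth_const = 400 ^ 2178"

definition depth_exponent :: nat where "depth_exponent = 335"

lemma depth_const_pos: "0 < depth_const"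
  unfolding depth_const_def by (rule zero_less_power) simp

context subcritical_tree
begin

lemma Poincare_depth_bound:
  assumes "1 \<le> n" shows "Poincare_depth n (depth_const * real n ^ depth_exponent)"
proof (rule Poincare_depth_poly[OF _ _ _ assms])
  show "Poincare_depth m depth_const" if "m < 2178" for m
  proof (rule Poincare_depth_mono[OF Poincare_depth_exp order_refl])
    show "400 ^ m \<le> depth_const"
      unfolding depth_const_def by (rule power_increasing) (use that in simp_all)
  qed simp
  show "0 \<le> depth_const" using depth_const_pos by simp
  have "1 + real depth_exponent * (1 / 67) \<le> (1 + 1 / 67 :: real) ^ depth_exponent"
    by (rule Bernoulli_inequality) simp
  moreover have "1 + real depth_exponent * (1 / 67) = 6" by (simp add: depth_exponent_def)
  moreover have "1 + 1 / 67 = (68 / 67 :: real)" by simp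
  ultimately show "6 \<le> (68 / 67 :: real) ^ depth_exponent" by (simp only:)
qed

text \<open>The depth \<open>l\<close> is \<open>16 / (1 - k p)\<^sup>2\<close> rounded up. Then \<open>(k p) ^ l \<le> exp (- z)\<close> for
  \<open>z = (1 - k p) l\<close>, and \<open>exp z \<ge> z\<^sup>2 / 2\<close> is all that \<open>Poincare_infinite\<close> requires.\<close>

lemma spectral_gap_lower:
  "ereal (1 / (4 * depth_const * (17 / (1 - real k * p)\<^sup>2) ^ Suc depth_exponent)) \<le> spectral_gap k p"
proof -
  define \<delta> where "\<delta> = 1 - real k * p"
  have \<delta>: "0 < \<delta>" "\<delta> < 1" using subcritical p_pos two_le_k by (auto simp: \<delta>_def)
  define l where "l = nat \<lceil>16 / \<delta>\<^sup>2\<rceil>"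
  have l16: "16 / \<delta>\<^sup>2 \<le> real l" unfolding l_def by (simp add: real_nat_ceiling_ge)
  have \<delta>2: "0 < \<delta>\<^sup>2" "\<delta>\<^sup>2 \<le> 1" using \<delta> by (auto simp: power_le_one)
  have "1 \<le> 1 / \<delta>\<^sup>2" using \<delta>2 by simp
  moreover have "16 / \<delta>\<^sup>2 + 1 / \<delta>\<^sup>2 = 17 / \<delta>\<^sup>2" by (simp add: add_divide_distrib[symmetric])
  moreover have "16 / \<delta>\<^sup>2 = 16 * (1 / \<delta>\<^sup>2)" by simp
  moreover have "real l < 16 / \<delta>\<^sup>2 + 1"
    unfolding l_def using \<delta>2 ceiling_correct[of "16 / \<delta>\<^sup>2"] by simp
  ultimately have l17: "real l \<le> 17 / \<delta>\<^sup>2" "1 \<le> real l"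
    using l16 by linarith+
  note K = depth_const_pos
  define T where "T = depth_const * real l ^ depth_exponent"
  have T: "0 \<le> T" using K by (simp add: T_def)
  have PI: "Poincare_depth l T" unfolding T_def using l17(2) by (intro Poincare_depth_bound) simp
  have small: "(real k * p) ^ l * (real l + 1) \<le> 1 / 4"
  proof -
    define z where "z = \<delta> * real l"
    have z: "0 < z" using \<delta> l17 by (simp add: z_def)
    have "real k * p \<le> exp (- \<delta>)" using exp_ge_add_one_self[of "- \<delta>"] by (simp add: \<delta>_def)
    then have "(real k * p) ^ l \<le> exp (- \<delta>) ^ l" using p_pos by (intro power_mono) auto
    also have "\<dots> = inverse (exp z)" by (simp add: z_def exp_of_nat2_mult exp_minus power_inverse)
    also have "\<dots> \<le> inverse (z\<^sup>2 / 2)"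
      using exp_lower_Taylor_quadratic[of z] z by (intro le_imp_inverse_le) auto
    finally have "(real k * p) ^ l * (real l + 1) \<le> inverse (z\<^sup>2 / 2) * (2 * real l)"
      using l17 p_pos by (intro mult_mono) auto
    also have "\<dots> = 4 / (\<delta>\<^sup>2 * real l)" using l17 \<delta> by (simp add: z_def power2_eq_square field_simps)
    also have "\<dots> \<le> 4 / 16"
      using l16 \<delta>2 by (intro divide_left_mono) (auto simp: field_simps)
    finally show ?thesis by simp
  qed
  define C where "C = 4 * real l * T"
  have Cpos: "0 < C" using K l17 by (simp add: C_def T_def)
  have "ereal (1 / C) \<le> spectral_gap k p"
  proof (rule spectral_gap_ge[OF Cpos])
    fix f assume "local_fun k f"
    then obtain n f' where rep: "local_rep n f f'" using local_fun_rep by blast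
    let ?R = "levels k 0 (n + l + 1)"
    define \<sigma> :: config where "\<sigma> = (\<lambda>_. True)"
    have ind: "indep f' {y. n \<le> length y}"
      by (rule indep_subset[of f' "- levels k 0 n"]) (use rep in \<open>auto simp: local_rep_def levels_def\<close>)
    have "M.variance f = Var ?R f' \<sigma>" by (rule variance_local[OF rep]) simp
    also have "\<dots> \<le> C * (\<Sum>y\<in>levels k 0 n. avg ?R (\<lambda>\<eta>. constraint k y \<eta> * var1 y f' \<eta>) \<sigma>)"
      unfolding C_def by (rule Poincare_infinite[OF PI T small ind refl])
    also have "(\<Sum>y\<in>levels k 0 n. avg ?R (\<lambda>\<eta>. constraint k y \<eta> * var1 y f' \<eta>) \<sigma>)
        = - (\<integral>\<tau>. f \<tau> * local_generator k p f \<tau> \<partial>M)"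
      using generator_form[OF rep rep, of "n + l + 1" \<sigma>] by (simp add: var1_def power2_eq_square)
    finally show "M.variance f \<le> C * - (\<integral>\<tau>. f \<tau> * local_generator k p f \<tau> \<partial>M)" .
  qed
  moreover have "1 / (4 * depth_const * (17 / \<delta>\<^sup>2) ^ Suc depth_exponent) \<le> 1 / C"
  proof (rule divide_left_mono)
    have "C = 4 * depth_const * real l ^ Suc depth_exponent" by (simp add: C_def T_def)
    also have "\<dots> \<le> 4 * depth_const * (17 / \<delta>\<^sup>2) ^ Suc depth_exponent"
      using K l17 by (intro mult_left_mono power_mono) auto
    finally show "C \<le> 4 * depth_const * (17 / \<delta>\<^sup>2) ^ Suc depth_exponent" .
    show "0 < 4 * depth_const * (17 / \<delta>\<^sup>2) ^ Suc depth_exponent * C" using Cpos K \<delta>2 by (intro mult_pos_pos) auto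
  qed simp
  ultimately show ?thesis unfolding \<delta>_def[symmetric] by (meson ereal_less_eq(3) order_trans)
qed

end

theorem theorem2:
  "\<exists>\<alpha>::real. \<alpha> \<ge> 0 \<and>
     (\<forall>k::nat. k \<ge> 2 \<longrightarrow>
       (\<exists>a::real. a > 0 \<and>
         (\<forall>p::real. 0 < p \<and> p < critical_density k \<longrightarrow>
            ereal (inverse a * (critical_density k - p) powr (- 2)) \<le> relaxation_time k p \<and>
            relaxation_time k p \<le> ereal (a * (critical_density k - p) powr (- (2 + \<alpha>))))))"
proof (rule exI[of _ "2 * real depth_exponent"], intro conjI allI impI)
  fix k :: nat assume k: "2 \<le> k"
  define A where "A = 4 * depth_const * 17 ^ Suc depth_exponent"
  define a where "a = A + 2 * (real k)\<^sup>2"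
  have A: "0 < A" unfolding A_def using depth_const_pos by (intro mult_pos_pos zero_less_power) auto
  have a: "0 < a" "A \<le> a" "2 * (real k)\<^sup>2 \<le> a" using A k by (auto simp: a_def intro: add_pos_nonneg)
  show "\<exists>a>0. \<forall>p. 0 < p \<and> p < critical_density k \<longrightarrow>
      ereal (inverse a * (critical_density k - p) powr - 2) \<le> relaxation_time k p \<and>
      relaxation_time k p \<le> ereal (a * (critical_density k - p) powr - (2 + 2 * real depth_exponent))"
  proof (intro exI[of _ a] conjI allI impI a)
    fix p assume p: "0 < p \<and> p < critical_density k"
    define d where "d = critical_density k - p"
    have d: "0 < d" using p by (simp add: d_def)
    have kd: "1 - real k * p = real k * d" using k by (simp add: d_def critical_density_def field_simps)
    have kp: "real k * p < 1" 
    proof -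
      have "0 < real k * d" using d k by (intro mult_pos_pos) auto
      then show ?thesis using kd by linarith
    qed
    have "p \<le> real k * p" using p k by simp
    then have "p < 1" using kp by simp
    interpret subcritical_tree p k by standard (use p k kp \<open>p < 1\<close> in auto)
    have lower: "ereal (1 / (A * (1 / (real k * d)\<^sup>2) ^ Suc depth_exponent)) \<le> spectral_gap k p"
      using spectral_gap_lower unfolding kd A_def by (simp only: power_divide mult.assoc times_divide_eq_right mult_1_right power_one)
    have upper: "spectral_gap k p \<le> ereal (2 * (real k * d)\<^sup>2)" using spectral_gap_upper unfolding kd .
    have pos: "0 < A * (1 / (real k * d)\<^sup>2) ^ Suc depth_exponent" using A d k by (intro mult_pos_pos) auto
    have lower_nonneg: "0 \<le> ereal (1 / (A * (1 / (real k * d)\<^sup>2) ^ Suc depth_exponent))"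
      unfolding zero_ereal_def ereal_less_eq
      by (rule less_imp_le, rule divide_pos_pos[OF zero_less_one pos])
    then have nn: "0 \<le> spectral_gap k p" using lower by (rule order_trans)
    show "ereal (inverse a * (critical_density k - p) powr - 2) \<le> relaxation_time k p"
    proof -
      have "inverse a * d powr - 2 = 1 / (a * d\<^sup>2)" using d by (simp add: powr_minus powr_numeral field_simps)
      also have "\<dots> \<le> 1 / (2 * (real k)\<^sup>2 * d\<^sup>2)" using a d k by (intro divide_left_mono mult_right_mono mult_pos_pos) auto
      also have "\<dots> = inverse (2 * (real k * d)\<^sup>2)" by (simp add: power_mult_distrib field_simps)
      finally have "ereal (inverse a * d powr - 2) \<le> inverse (ereal (2 * (real k * d)\<^sup>2))" using d k by simp
      also have "\<dots> \<le> relaxation_time k p"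
        unfolding relaxation_time_def by (rule ereal_inverse_antimono[OF nn upper])
      finally show ?thesis unfolding d_def .
    qed
    show "relaxation_time k p \<le> ereal (a * (critical_density k - p) powr - (2 + 2 * real depth_exponent))"
    proof -
      let ?x = "A * (1 / (real k * d)\<^sup>2) ^ Suc depth_exponent"
      have "relaxation_time k p \<le> inverse (ereal (1 / ?x))"
        unfolding relaxation_time_def by (rule ereal_inverse_antimono[OF lower_nonneg lower])
      also have "inverse (ereal (1 / ?x)) = ereal ?x"
      proof -
        have "inverse (ereal (1 / t)) = ereal t" if "0 < t" for t using that by simp
        from this[OF pos] show ?thesis .
      qed
      also have "ereal ?x \<le> ereal (a * d powr - (2 + 2 * real depth_exponent))"
      proof -
        have "real k * d \<ge> d" using d k by simp
        then have "d\<^sup>2 \<le> (real k * d)\<^sup>2" using d by (intro power_mono) auto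
        then have "1 / (real k * d)\<^sup>2 \<le> 1 / d\<^sup>2" using d k by (intro divide_left_mono) auto
        then have "(1 / (real k * d)\<^sup>2) ^ Suc depth_exponent \<le> (1 / d\<^sup>2) ^ Suc depth_exponent"
          by (rule power_mono) simp
        then have "?x \<le> a * (1 / d\<^sup>2) ^ Suc depth_exponent"
          using a by (intro mult_mono) (auto simp: less_imp_le)
        also have "(1 / d\<^sup>2) ^ Suc depth_exponent = d powr - (2 + 2 * real depth_exponent)"
        proof -
          have "(1 / d\<^sup>2) ^ Suc depth_exponent = inverse (d ^ (2 * Suc depth_exponent))"
            by (simp only: power_mult inverse_eq_divide power_one_over)
          also have "d ^ (2 * Suc depth_exponent) = d powr (real (2 * Suc depth_exponent))"
            using d by (simp only: powr_realpow)
          also have "real (2 * Suc depth_exponent) = 2 + 2 * real depth_exponent" by simp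
          finally show ?thesis by (simp only: powr_minus)
        qed
        finally show ?thesis by (simp only: ereal_less_eq)
      qed
      finally show ?thesis unfolding d_def .
    qed
  qed
qed simp

end
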